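(* For every $\varepsilon>0$ there exists a positive integer $k=k(\varepsilon)$ with the following property. There is an infinite sequence of $3$-uniform hypergraphs $H_n$, where $H_n$ has $n$ vertices and $n$ tends to infinity, such that every vertex of every $H_n$ belongs to exactly $k$ hyperedges, and such that for every injective map $f:V(H_n)\to\mathbb{R}^2$ there is a point $p\in\mathbb{R}^2$ belonging to at least $\left(\frac{2}{9}-\varepsilon\right)|E(H_n)|$ of the closed triangles $\mathrm{conv}(f(e))$, $e\in E(H_n)$. Moreover, the constant $\frac{2}{9}$ cannot be improved: it cannot be replaced by any larger constant in this statement.
   Context: A hypergraph $H=(V,E)$ is $3$-uniform if every hyperedge is a $3$-element subset of $V$; $\mathrm{conv}(A)$ denotes the convex hull of $A\subseteq\mathbb{R}^2$. The paper adopts the convention that embeddings of vertex sets map the vertices to points in general position. *)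

theory Defs
  imports "HOL-Analysis.Analysis"
begin

definition three_uniform_hypergraph :: "'a set \<Rightarrow> 'a set set \<Rightarrow> bool" where
  "three_uniform_hypergraph V E \<longleftrightarrow> finite V \<and> (\<forall>e\<in>E. e \<subseteq> V \<and> card e = 3)"

definition regular_hypergraph :: "nat \<Rightarrow> 'a set \<Rightarrow> 'a set set \<Rightarrow> bool" where
  "regular_hypergraph k V E \<longleftrightarrow> (\<forall>v\<in>V. card {e \<in> E. v \<in> e} = k)"

definition in_general_position :: "(real ^ 2) set \<Rightarrow> bool" where
  "in_general_position S \<longleftrightarrow> (\<forall>T\<subseteq>S. card T = 3 \<longrightarrow> \<not> collinear T)"

definition injective_map :: "'a set \<Rightarrow> ('a \<Rightarrow> real ^ 2) \<Rightarrow> bool" where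
  "injective_map V f \<longleftrightarrow> inj_on f V"

definition general_position_map :: "'a set \<Rightarrow> ('a \<Rightarrow> real ^ 2) \<Rightarrow> bool" where
  "general_position_map V f \<longleftrightarrow> inj_on f V \<and> in_general_position (f ` V)"

text \<open>
  The sequence of hypergraphs is \<open>(V i, E i)\<close>, so the number of vertices ``\<open>n\<close>'' of the
  \<open>i\<close>-th member is \<open>card (V i)\<close>; since the hypergraphs are finite, it is no restriction that the
  vertices are natural numbers.  The parameter \<open>adm\<close> says which maps of the vertex set into the
  plane are considered (\<^const>\<open>injective_map\<close> or \<^const>\<open>general_position_map\<close>), and
  \<open>c\<close> is the overlap constant.
\<close>

definition overlap_property ::
  "(nat set \<Rightarrow> (nat \<Rightarrow> real ^ 2) \<Rightarrow> bool) \<Rightarrow> real \<Rightarrow> bool" where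
  "overlap_property adm c \<longleftrightarrow>
    (\<forall>\<epsilon>>0. \<exists>k>0. \<exists>(V :: nat \<Rightarrow> nat set) (E :: nat \<Rightarrow> nat set set).
       (\<forall>i. three_uniform_hypergraph (V i) (E i)) \<and>
       filterlim (\<lambda>i. card (V i)) at_top sequentially \<and>
       (\<forall>i. regular_hypergraph k (V i) (E i)) \<and>
       (\<forall>i f. adm (V i) f \<longrightarrow>
          (\<exists>p. real (card {e \<in> E i. p \<in> convex hull (f ` e)}) \<ge> (c - \<epsilon>) * real (card (E i)))))"

end

theory Submission
  imports Defs "HOL-Computational_Algebra.Polynomial"
begin

text \<open>
  Lower bound. For a point set in general position let p minimise the largest absolute imbalance
  D between the two sides of a line through p; then lines with imbalance D exist in three
  directions whose normals have 0 in their convex hull. Sorting the points by the angle modulo pi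
  of the line joining them to p turns the set into a sequence of signs, and a triangle contains p
  iff its three signs alternate. The imbalances form a \<open>\<plusminus>1\<close>-walk W bounded by D that crosses
  the strip \<open>[-D, D]\<close> three times per half turn, so \<open>\<Sum>W\<^sup>2 \<le> n D\<^sup>2 - 4 D\<^sup>3 + O(n\<^sup>2) \<le> n\<^sup>3/108 + O(n\<^sup>2)\<close>,
  and the number of alternating triples is \<open>n\<^sup>3/24 - \<Sum>W\<^sup>2/2 + O(n\<^sup>2) \<ge> n\<^sup>3/27 - O(n\<^sup>2)\<close>. Cutting the
  sequence into boundedly many intervals shows that all but an \<open>\<epsilon>\<close>-fraction of the alternating
  triples are described by a bounded labelling of the points. Hence the estimate passes to any
  sparse hypergraph in which every bounded labelling sees the same triple statistics as in the
  complete hypergraph, and the union of k random perfect matchings into triples is one.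

  Upper bound. Put the vertices on the curve \<open>y = exp (K x)\<close> near randomly chosen integer abscissae.
  For large K a triangle contains p essentially only if it has one vertex above p, one below to
  the left and one below to the right, which has probability at most \<open>6/27\<close>; a second moment
  computation makes this hold for all p at once.
\<close>

section \<open>Random permutations against random functions\<close>

text \<open>The degree k may depend on \<epsilon> only, while the map is chosen after the
  hypergraph. A union bound over maps becomes possible once every map is replaced by a labelling
  whose number of labels is fixed in advance: there are only exp(O(n)) labellings, and each one
  fails with probability about exp(-c k n), so a constant k suffices. Exact regularity is the reason
  for perfect matchings instead of independent triples; the resulting dependence is paid for by the
  exchange with random functions, which costs a factor polynomial in n.

  The fraction 2/9 is n^3/27 out of n^3/6 triples. In the lower bound it comes from maximising n D^2
  - 4 D^3, which happens at D = n/6; in the upper bound it comes from AM-GM for three disjoint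
  classes of types.

  In the upper bound the hypergraph is given and the map is adapted to it. A point p matters only
  through the family of type sets it allows; for m types there are finitely many such families, so
  one assignment of types serves all p as soon as the number of edges is large compared with k and
  m.\<close>

lemma fact_le_exp_power:
  assumes "n > 0"
  shows "fact n \<le> exp 1 * real n * (real n / exp 1) ^ n"
  using assms
proof (induction n rule: nat_induct_non_zero)
  case 1
  then show ?case by simp
next
  case (Suc n)
  have n: "real n > 0" using Suc by simp
  \<comment> \<open>Applying ln x \<le> x - 1 to n/(n+1), not to its inverse, bounds ln (1 + 1/n)
    from below. This gives (1 + 1/n)^(n+1) \<ge> e, which is what the induction step needs.\<close>
  have "ln (real n / (real n + 1)) \<le> real n / (real n + 1) - 1"
    using n by (intro ln_le_minus_one) simp
  moreover have "ln (1 + 1 / real n) = - ln (real n / (real n + 1))"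
    using n by (simp add: ln_div field_simps)
  moreover have "real n / (real n + 1) - 1 = - (1 / (real n + 1))"
    using n by (simp add: field_simps)
  ultimately have "1 / (real n + 1) \<le> ln (1 + 1 / real n)" by linarith
  hence "1 \<le> (real n + 1) * ln (1 + 1 / real n)"
    using n by (simp add: field_simps)
  hence "exp 1 \<le> exp ((real n + 1) * ln (1 + 1 / real n))" by simp
  also have "\<dots> = (1 + 1 / real n) ^ Suc n"
    using n exp_of_nat_mult[of "Suc n" "ln (1 + 1 / real n)"] by (simp add: add_pos_pos add.commute)
  also have "1 + 1 / real n = (real n + 1) / real n" using n by (simp add: field_simps)
  finally have e: "exp 1 * real n ^ Suc n \<le> (real n + 1) ^ Suc n"
    using n by (simp add: field_simps power_divide)
  have "fact (Suc n) = (real n + 1) * fact n" by simp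
  also have "\<dots> \<le> (real n + 1) * (exp 1 * real n * (real n / exp 1) ^ n)"
    using Suc by (intro mult_left_mono) auto
  also have "\<dots> = (real n + 1) * (exp 1 * real n ^ Suc n) / exp 1 ^ n"
    by (simp add: power_divide)
  also have "\<dots> \<le> (real n + 1) * ((real n + 1) ^ Suc n) / exp 1 ^ n"
    by (intro divide_right_mono mult_left_mono e) auto
  also have "\<dots> = exp 1 * real (Suc n) * (real (Suc n) / exp 1) ^ Suc n"
    by (simp add: power_divide field_simps)
  finally show ?case .
qed

text \<open>A single term of the exponential series at n is at most its sum. This half of Stirling
  is applied to the whole set, the other half to the label classes.\<close>

lemma power_self_le_exp_fact: "real n ^ n \<le> exp (real n) * fact n"
proof -
  have "real n ^ n / fact n \<le> exp (real n)"
    using sum_le_suminf[of "\<lambda>i. real n ^ i /\<^sub>R fact i" "{n}"] summable_exp_generic[of "real n"]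
    by (simp add: exp_def divide_inverse mult.commute)
  thus ?thesis by (simp add: field_simps)
qed

text \<open>Composing with the inverse of one solution turns every solution into a permutation that
  fixes \<open>X\<close> pointwise.\<close>

lemma card_permutes_extending_le:
  assumes "finite S" "X \<subseteq> S"
  shows "card {\<pi>. \<pi> permutes S \<and> (\<forall>x\<in>X. \<pi> x = g x)} \<le> fact (card S - card X)"
proof (cases "{\<pi>. \<pi> permutes S \<and> (\<forall>x\<in>X. \<pi> x = g x)} = {}")
  case True
  then show ?thesis by (simp only: card.empty)
next
  case False
  then obtain \<rho> where \<rho>: "\<rho> permutes S" "\<forall>x\<in>X. \<rho> x = g x" by blast
  let ?A = "{\<pi>. \<pi> permutes S \<and> (\<forall>x\<in>X. \<pi> x = g x)}"
  have inj: "inj_on (\<lambda>\<pi>. inv \<rho> \<circ> \<pi>) ?A"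
  proof (rule inj_onI)
    fix \<pi> \<pi>' assume "inv \<rho> \<circ> \<pi> = inv \<rho> \<circ> \<pi>'"
    hence "\<rho> ((inv \<rho> \<circ> \<pi>) x) = \<rho> ((inv \<rho> \<circ> \<pi>') x)" for x by simp
    thus "\<pi> = \<pi>'" using \<rho>(1) by (auto simp: permutes_inverses)
  qed
  have sub: "(\<lambda>\<pi>. inv \<rho> \<circ> \<pi>) ` ?A \<subseteq> {p. p permutes (S - X)}"
  proof (safe)
    fix \<pi> assume \<pi>: "\<pi> permutes S" "\<forall>x\<in>X. \<pi> x = g x"
    have "inv \<rho> \<circ> \<pi> permutes S" using \<pi> \<rho> by (simp add: permutes_compose permutes_inv)
    moreover have "(inv \<rho> \<circ> \<pi>) x = x" if "x \<in> X" for x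
      using \<pi>(2) \<rho>(2) that permutes_inverses(2)[OF \<rho>(1), of x] by simp
    ultimately show "inv \<rho> \<circ> \<pi> permutes (S - X)"
      by (auto intro: permutes_superset)
  qed
  have fin: "finite {p. p permutes (S - X)}" using assms by (intro finite_permutations) auto
  have "card ?A \<le> card {p. p permutes (S - X)}"
    using card_inj_on_le[OF inj sub fin] .
  also have "\<dots> = fact (card S - card X)"
    using assms by (subst card_permutations[OF refl]) (auto simp: card_Diff_subset finite_subset)
  finally show ?thesis .
qed

text \<open>Composing with the inverse of one solution maps all solutions into the stabiliser of
  \<open>t\<close>, whose elements permute each label class separately.\<close>

lemma card_permutes_word_le:
  assumes "finite S" "finite C" "t ` S \<subseteq> C"
  shows "card {\<pi>. \<pi> permutes S \<and> (\<forall>x\<in>S. t (\<pi> x) = w x)} \<le> (\<Prod>c\<in>C. fact (card {v\<in>S. t v = c}))"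
proof (cases "{\<pi>. \<pi> permutes S \<and> (\<forall>x\<in>S. t (\<pi> x) = w x)} = {}")
  case True
  then show ?thesis by (simp only: card.empty)
next
  case False
  then obtain \<rho> where \<rho>: "\<rho> permutes S" "\<forall>x\<in>S. t (\<rho> x) = w x" by blast
  let ?A = "{\<pi>. \<pi> permutes S \<and> (\<forall>x\<in>S. t (\<pi> x) = w x)}"
  let ?B = "{\<pi>. \<pi> permutes S \<and> (\<forall>x\<in>S. t (\<pi> x) = t x)}"
  let ?F = "\<lambda>c. {v\<in>S. t v = c}"
  have finB: "finite ?B" using finite_permutations[OF assms(1)] by (rule rev_finite_subset) auto
  have inj: "inj_on (\<lambda>\<pi>. \<pi> \<circ> inv \<rho>) ?A"
  proof (rule inj_onI)
    fix \<pi> \<pi>' assume "\<pi> \<circ> inv \<rho> = \<pi>' \<circ> inv \<rho>"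
    hence "(\<pi> \<circ> inv \<rho>) (\<rho> x) = (\<pi>' \<circ> inv \<rho>) (\<rho> x)" for x by simp
    thus "\<pi> = \<pi>'" using \<rho>(1) by (auto simp: permutes_inverses)
  qed
  have sub: "(\<lambda>\<pi>. \<pi> \<circ> inv \<rho>) ` ?A \<subseteq> ?B"
  proof (safe)
    fix \<pi> assume \<pi>: "\<pi> permutes S" "\<forall>x\<in>S. t (\<pi> x) = w x"
    show "\<pi> \<circ> inv \<rho> permutes S" using \<pi> \<rho> by (simp add: permutes_compose permutes_inv)
    fix x assume "x \<in> S"
    hence "inv \<rho> x \<in> S" using \<rho>(1) by (metis permutes_in_image permutes_inv)
    thus "t ((\<pi> \<circ> inv \<rho>) x) = t x"
      using \<pi>(2) \<rho>(2) permutes_inverses(1)[OF \<rho>(1), of x] by fastforce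
  qed
  let ?R = "\<lambda>\<pi>. \<lambda>c\<in>C. (\<lambda>x. if x \<in> ?F c then \<pi> x else x)"
  have injR: "inj_on ?R ?B"
  proof (rule inj_onI)
    fix \<pi> \<pi>' assume h: "\<pi> \<in> ?B" "\<pi>' \<in> ?B" "?R \<pi> = ?R \<pi>'"
    show "\<pi> = \<pi>'"
    proof
      fix x
      show "\<pi> x = \<pi>' x"
      proof (cases "x \<in> S")
        case True
        hence "t x \<in> C" using assms by auto
        have "?R \<pi> (t x) x = ?R \<pi>' (t x) x" using h(3) by metis
        thus ?thesis using True \<open>t x \<in> C\<close> by simp
      qed (use h in \<open>auto simp: permutes_not_in\<close>)
    qed
  qed
  have subR: "?R ` ?B \<subseteq> PiE C (\<lambda>c. {p. p permutes ?F c})"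
  proof
    fix y assume "y \<in> ?R ` ?B"
    then obtain \<pi> where \<pi>: "\<pi> permutes S" "\<forall>x\<in>S. t (\<pi> x) = t x" and y: "y = ?R \<pi>" by blast
    have "(\<lambda>x. if x \<in> ?F c then \<pi> x else x) permutes ?F c" for c
    proof (rule bij_imp_permutes)
      have 1: "\<pi> ` ?F c \<subseteq> ?F c" using \<pi> by (auto simp: permutes_in_image)
      have 2: "inj_on \<pi> (?F c)" using \<pi>(1) permutes_inj_on by blast
      have "bij_betw \<pi> (?F c) (?F c)"
        using 1 2 assms(1) by (simp add: bij_betw_def endo_inj_surj)
      thus "bij_betw (\<lambda>x. if x \<in> ?F c then \<pi> x else x) (?F c) (?F c)"
        by (subst bij_betw_cong[of _ _ \<pi>]) auto
    qed auto
    thus "y \<in> PiE C (\<lambda>c. {p. p permutes ?F c})" unfolding y by (intro PiE_I) simp_all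
  qed
  have finF: "finite (?F c)" for c using assms by simp
  have "finite (PiE C (\<lambda>c. {p. p permutes ?F c}))"
    by (intro finite_PiE assms finite_permutations finF)
  hence "card ?B \<le> card (PiE C (\<lambda>c. {p. p permutes ?F c}))"
    by (rule card_inj_on_le[OF injR subR])
  also have "\<dots> = (\<Prod>c\<in>C. fact (card (?F c)))"
    by (simp add: card_PiE assms card_permutations)
  finally show ?thesis using card_inj_on_le[OF inj sub finB] by linarith
qed

text \<open>
  A random permutation and a random function induce the same conditional distribution on words
  with the label frequencies of \<open>t\<close>, and by Stirling a random function has these frequencies with
  polynomial probability. This reduces exponential bounds for permutations to independent sampling.
\<close>
lemma sum_permutes_le_sum_functions:
  fixes F :: "('a \<Rightarrow> 'c) \<Rightarrow> real"
  assumes S: "finite S" "S \<noteq> {}" and C: "finite C" "t ` S \<subseteq> C" and F: "\<And>w. F w \<ge> 0"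
  shows "(\<Sum>\<pi> | \<pi> permutes S. F (restrict (t \<circ> \<pi>) S))
    \<le> (exp 1 * real (card S)) ^ card C * (fact (card S) / real (card S) ^ card S)
        * (\<Sum>\<phi>\<in>S \<rightarrow>\<^sub>E S. F (restrict (t \<circ> \<phi>) S))"
proof -
  let ?n = "card S"
  let ?K = "(exp 1 * real ?n) ^ card C * (fact ?n / real ?n ^ ?n)"
  let ?Wd = "S \<rightarrow>\<^sub>E C"
  let ?N = "\<lambda>c. {v\<in>S. t v = c}"
  have n: "?n > 0" using S by auto
  have finP: "finite {\<pi>. \<pi> permutes S}" by (rule finite_permutations[OF S(1)])
  have finPhi: "finite (S \<rightarrow>\<^sub>E S)" and finW: "finite ?Wd" using S C by (auto intro: finite_PiE)
  \<comment> \<open>The comparison is made word by word. With class sizes N_c, a word attained by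
    some permutation has at most \<Prod> N_c! permutations and exactly \<Prod> N_c^(N_c) functions,
    and each N_c! costs at most e n (N_c / e)^(N_c).\<close>
  have key: "real (card {\<pi>. \<pi> permutes S \<and> restrict (t \<circ> \<pi>) S = w})
      \<le> ?K * real (card {\<phi> \<in> S \<rightarrow>\<^sub>E S. restrict (t \<circ> \<phi>) S = w})" if w: "w \<in> ?Wd" for w
  proof (cases "{\<pi>. \<pi> permutes S \<and> restrict (t \<circ> \<pi>) S = w} = {}")
    case True
    show ?thesis unfolding True by simp
  next
    case False
    then obtain \<rho> where \<rho>: "\<rho> permutes S" "restrict (t \<circ> \<rho>) S = w" by blast
    have w\<rho>: "w x = t (\<rho> x)" if "x \<in> S" for x using \<rho>(2) that by auto
    have eqw: "restrict (t \<circ> g) S = w \<longleftrightarrow> (\<forall>x\<in>S. t (g x) = w x)" for g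
      using w by (auto simp: fun_eq_iff PiE_iff extensional_def)
    have "{\<phi> \<in> S \<rightarrow>\<^sub>E S. restrict (t \<circ> \<phi>) S = w} = PiE S (\<lambda>x. ?N (w x))"
      unfolding eqw by (auto simp: PiE_iff extensional_def)
    hence "card {\<phi> \<in> S \<rightarrow>\<^sub>E S. restrict (t \<circ> \<phi>) S = w} = (\<Prod>x\<in>S. card (?N (w x)))"
      by (simp add: card_PiE S)
    also have "\<dots> = (\<Prod>x\<in>S. card (?N (t (\<rho> x))))" by (intro prod.cong) (auto simp: w\<rho>)
    also have "\<dots> = (\<Prod>x\<in>S. card (?N (t x)))"
      using prod.permute[OF \<rho>(1), of "\<lambda>x. card (?N (t x))"] by (simp add: comp_def)
    also have "\<dots> = (\<Prod>c\<in>C. \<Prod>x\<in>?N c. card (?N (t x)))"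
      using prod.group[OF S(1) C(1) C(2), of "\<lambda>x. card (?N (t x))"] by simp
    also have "\<dots> = (\<Prod>c\<in>C. card (?N c) ^ card (?N c))"
      by (intro prod.cong refl) simp
    finally have phi: "card {\<phi> \<in> S \<rightarrow>\<^sub>E S. restrict (t \<circ> \<phi>) S = w} = (\<Prod>c\<in>C. card (?N c) ^ card (?N c))" .
    have "fact (card (?N c)) \<le> exp 1 * real ?n * (real (card (?N c)) / exp 1) ^ card (?N c)" for c
    proof (cases "card (?N c) = 0")
      case True
      have "1 \<le> exp 1 * real ?n" using n one_le_exp_iff[of 1] 
        by (metis mult_mono mult_1 of_nat_1 of_nat_le_iff Suc_leI One_nat_def zero_le_one exp_ge_zero)
      thus ?thesis using True by simp
    next
      case False
      have "card (?N c) \<le> ?n" using S by (intro card_mono) auto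
      hence "exp 1 * real (card (?N c)) * (real (card (?N c)) / exp 1) ^ card (?N c)
         \<le> exp 1 * real ?n * (real (card (?N c)) / exp 1) ^ card (?N c)"
        by (intro mult_right_mono mult_left_mono) auto
      thus ?thesis using fact_le_exp_power[of "card (?N c)"] False by linarith
    qed
    hence "(\<Prod>c\<in>C. fact (card (?N c)))
      \<le> (\<Prod>c\<in>C. exp 1 * real ?n * (real (card (?N c)) / exp 1) ^ card (?N c))"
      by (intro prod_mono) auto
    also have "\<dots> = (exp 1 * real ?n) ^ card C * ((\<Prod>c\<in>C. real (card (?N c)) ^ card (?N c)) / (\<Prod>c\<in>C. exp 1 ^ card (?N c)))"
      by (simp add: prod.distrib power_divide prod_dividef)
    also have "(\<Prod>c\<in>C. exp 1 ^ card (?N c)) = exp (real ?n)"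
    proof -
      have "(\<Sum>c\<in>C. card (?N c)) = ?n"
        using sum.group[OF S(1) C(1) C(2), of "\<lambda>x. 1::nat"] by simp
      thus ?thesis by (simp flip: exp_sum of_nat_sum add: C exp_of_nat_mult[symmetric])
    qed
    also have "(exp 1 * real ?n) ^ card C * ((\<Prod>c\<in>C. real (card (?N c)) ^ card (?N c)) / exp (real ?n))
       \<le> (exp 1 * real ?n) ^ card C * ((\<Prod>c\<in>C. real (card (?N c)) ^ card (?N c)) * (fact ?n / real ?n ^ ?n))"
    proof (rule mult_left_mono)
      \<comment> \<open>The factors e^(-N_c) of all classes multiply to e^(-n), which is exchanged
        for n!/n^n, the ratio of the number of permutations to the number of functions.\<close>
      have "1 / exp (real ?n) \<le> fact ?n / real ?n ^ ?n"
        using power_self_le_exp_fact[of ?n] n by (simp add: field_simps)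
      from mult_left_mono[OF this, of "\<Prod>c\<in>C. real (card (?N c)) ^ card (?N c)"]
      show "(\<Prod>c\<in>C. real (card (?N c)) ^ card (?N c)) / exp (real ?n)
        \<le> (\<Prod>c\<in>C. real (card (?N c)) ^ card (?N c)) * (fact ?n / real ?n ^ ?n)"
        by (simp add: prod_nonneg)
    qed simp
    finally have "(\<Prod>c\<in>C. fact (card (?N c))) \<le> ?K * real (\<Prod>c\<in>C. card (?N c) ^ card (?N c))"
      by (simp add: mult_ac)
    moreover have "real (card {\<pi>. \<pi> permutes S \<and> restrict (t \<circ> \<pi>) S = w}) \<le> (\<Prod>c\<in>C. fact (card (?N c)))"
      using card_permutes_word_le[OF S(1) C, of w] unfolding eqw
      by (metis (mono_tags, lifting) of_nat_fact of_nat_le_iff of_nat_prod prod.cong)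
    ultimately show ?thesis unfolding phi by linarith
  qed
  have "(\<Sum>\<pi> | \<pi> permutes S. F (restrict (t \<circ> \<pi>) S))
     = (\<Sum>w\<in>?Wd. \<Sum>\<pi> | \<pi> permutes S \<and> restrict (t \<circ> \<pi>) S = w. F w)"
    using sum.group[OF finP finW, of "\<lambda>\<pi>. restrict (t \<circ> \<pi>) S" "\<lambda>\<pi>. F (restrict (t \<circ> \<pi>) S)"] C(2)
    by (auto simp: permutes_in_image image_subset_iff PiE_iff intro!: sum.cong)
  also have "\<dots> = (\<Sum>w\<in>?Wd. real (card {\<pi>. \<pi> permutes S \<and> restrict (t \<circ> \<pi>) S = w}) * F w)"
    by simp
  also have "\<dots> \<le> (\<Sum>w\<in>?Wd. ?K * real (card {\<phi> \<in> S \<rightarrow>\<^sub>E S. restrict (t \<circ> \<phi>) S = w}) * F w)"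
    by (intro sum_mono mult_right_mono key F)
  also have "\<dots> = ?K * (\<Sum>w\<in>?Wd. \<Sum>\<phi> | \<phi> \<in> S \<rightarrow>\<^sub>E S \<and> restrict (t \<circ> \<phi>) S = w. F w)"
    by (simp add: sum_distrib_left mult.assoc)
  also have "(\<Sum>w\<in>?Wd. \<Sum>\<phi> | \<phi> \<in> S \<rightarrow>\<^sub>E S \<and> restrict (t \<circ> \<phi>) S = w. F w)
     = (\<Sum>\<phi>\<in>S \<rightarrow>\<^sub>E S. F (restrict (t \<circ> \<phi>) S))"
    using sum.group[OF finPhi finW, of "\<lambda>\<pi>. restrict (t \<circ> \<pi>) S" "\<lambda>\<pi>. F (restrict (t \<circ> \<pi>) S)"] C(2)
    by (force simp: image_subset_iff PiE_iff intro!: sum.cong)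
  finally show ?thesis .
qed

section \<open>Exponential moments of the number of blocks with prescribed labels\<close>

abbreviation cube :: "'a set \<Rightarrow> ('a \<times> 'a \<times> 'a) set" where
  "cube A \<equiv> A \<times> A \<times> A"

text \<open>A permutation of \<open>{..<3*N}\<close> encodes a perfect matching into triples: the
  images of three consecutive positions form one edge, together with an order on it.\<close>

definition hits :: "(nat \<Rightarrow> 'c) \<Rightarrow> ('c \<times> 'c \<times> 'c) set \<Rightarrow> nat \<Rightarrow> (nat \<Rightarrow> nat) \<Rightarrow> nat" where
  "hits t W N \<pi> = card {i\<in>{..<N}. (t (\<pi> (3*i)), t (\<pi> (3*i+1)), t (\<pi> (3*i+2))) \<in> W}"

text \<open>Triples with repeated vertices are included, so that this is exactly the success
  probability of one block under independent sampling.\<close>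

definition triple_density :: "(nat \<Rightarrow> 'c) \<Rightarrow> ('c \<times> 'c \<times> 'c) set \<Rightarrow> nat set \<Rightarrow> real" where
  "triple_density t W V =
     real (card {(u,v,w) \<in> cube V. (t u, t v, t w) \<in> W}) / real (card V) ^ 3"

text \<open>A function on \<open>3*N\<close> positions is the same as N independent triples, so the
  sum of products factorises.\<close>

lemma sum_functions_by_triples:
  fixes g :: "'b \<times> 'b \<times> 'b \<Rightarrow> real"
  assumes "finite A"
  shows "(\<Sum>\<phi>\<in>{..<3*N} \<rightarrow>\<^sub>E A. \<Prod>i<N. g (\<phi> (3*i), \<phi> (3*i+1), \<phi> (3*i+2))) = (\<Sum>x\<in>cube A. g x) ^ N"
proof -
  let ?to = "\<lambda>\<phi>. \<lambda>i\<in>{..<N}. (\<phi> (3*i), \<phi> (3*i+1), \<phi> (3*i+2))"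
  let ?from = "\<lambda>\<psi>. \<lambda>x\<in>{..<3*N}. case \<psi> (x div 3) of (a, b, c) \<Rightarrow>
      if x mod 3 = 0 then a else if x mod 3 = 1 then b else (c :: 'b)"
  have m: "Suc (3*i) mod 3 = 1" "Suc (Suc (3*i)) mod 3 = 2" "Suc (3*i) div 3 = i" "Suc (Suc (3*i)) div 3 = i" for i :: nat
    by presburger+
  have "(\<Sum>x\<in>cube A. g x) ^ N = (\<Prod>i\<in>{..<N}. \<Sum>x\<in>cube A. g x)" by simp
  also have "\<dots> = (\<Sum>\<psi>\<in>{..<N} \<rightarrow>\<^sub>E (cube A). \<Prod>i<N. g (\<psi> i))"
    using assms by (intro prod_sum_PiE) auto
  also have "\<dots> = (\<Sum>\<phi>\<in>{..<3*N} \<rightarrow>\<^sub>E A. \<Prod>i<N. g (\<phi> (3*i), \<phi> (3*i+1), \<phi> (3*i+2)))"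
  proof (rule sum.reindex_bij_witness[of _ ?to ?from])
    fix \<psi> assume \<psi>: "\<psi> \<in> {..<N} \<rightarrow>\<^sub>E (cube A)"
    have mem: "\<psi> i \<in> cube A" if "i < N" for i using \<psi> that by auto
    show "?from \<psi> \<in> {..<3*N} \<rightarrow>\<^sub>E A"
    proof (rule PiE_I)
      fix x assume "x \<in> {..<3*N}"
      hence "x div 3 < N" by auto
      from mem[OF this] show "?from \<psi> x \<in> A" using \<open>x \<in> {..<3*N}\<close> by (auto split: prod.splits)
    qed auto
    show "?to (?from \<psi>) = \<psi>"
    proof
      fix i
      show "?to (?from \<psi>) i = \<psi> i"
        using \<psi> by (cases "i < N"; cases "\<psi> i") (auto simp: m PiE_iff extensional_def)
    qed
    show "(\<Prod>i<N. g (?from \<psi> (3*i), ?from \<psi> (3*i+1), ?from \<psi> (3*i+2))) = (\<Prod>i<N. g (\<psi> i))"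
      by (intro prod.cong refl) (auto simp: m split: prod.splits)
  next
    fix \<phi> assume \<phi>: "\<phi> \<in> {..<3*N} \<rightarrow>\<^sub>E A"
    show "?to \<phi> \<in> {..<N} \<rightarrow>\<^sub>E (cube A)" using \<phi> by (auto simp: PiE_iff)
    show "?from (?to \<phi>) = \<phi>"
    proof
      fix x
      show "?from (?to \<phi>) x = \<phi> x"
      proof (cases "x < 3*N")
        case True
        hence d: "x div 3 < N" by auto
        have "x mod 3 = 0 \<and> x = 3 * (x div 3) \<or> x mod 3 = 1 \<and> x = Suc (3 * (x div 3))
          \<or> x mod 3 = 2 \<and> x = Suc (Suc (3 * (x div 3)))" by presburger
        thus ?thesis using True d by (elim disjE conjE) simp_all
      qed (use \<phi> in \<open>auto simp: PiE_iff extensional_def\<close>)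
    qed
  qed
  finally show ?thesis ..
qed

text \<open>(1 + x)(1 - x + x^2) = 1 + x^3 \<ge> 1, and 1 + x \<le> exp x.\<close>

lemma exp_minus_le_quadratic:
  fixes x :: real assumes "x \<ge> 0" shows "exp (- x) \<le> 1 - x + x\<^sup>2"
proof -
  have "1 \<le> (1 + x) * (1 - x + x\<^sup>2)" using assms by (simp add: algebra_simps power2_eq_square)
  also have "\<dots> \<le> exp x * (1 - x + x\<^sup>2)"
  proof (rule mult_right_mono)
    have "1 - x + x\<^sup>2 = (x - 1/2)\<^sup>2 + 3/4" by (simp add: power2_eq_square algebra_simps)
    thus "0 \<le> 1 - x + x\<^sup>2" by simp
  qed (rule exp_ge_add_one_self)
  finally show ?thesis by (simp add: exp_minus field_simps)
qed

lemma triple_density_bounds: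
  assumes "finite V" shows "0 \<le> triple_density t W V" "triple_density t W V \<le> 1"
proof -
  have "card {(u,v,w) \<in> cube V. (t u, t v, t w) \<in> W} \<le> card (cube V)"
    using assms by (intro card_mono) auto
  hence "real (card {(u,v,w) \<in> cube V. (t u, t v, t w) \<in> W}) \<le> real (card V ^ 3)"
    by (simp only: of_nat_le_iff card_cartesian_product power3_eq_cube mult.assoc)
  thus "triple_density t W V \<le> 1" unfolding triple_density_def by (auto simp: divide_le_eq_1)
qed (simp add: triple_density_def)

text \<open>The weight depends only on the word of labels, so permutations can be exchanged for
  functions, whose blocks are independent. The factor with exponent \<open>card C\<close> is the
  price of the exchange; the n^n functions cancel its denominator.\<close>

lemma permutation_mgf_le:
  assumes N: "N > 0" and C: "finite C" "t ` {..<3*N} \<subseteq> C" and l: "\<mu> \<ge> 0"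
  shows "(\<Sum>\<pi> | \<pi> permutes {..<3*N}. exp (- \<mu> * real (hits t W N \<pi>)))
    \<le> (exp 1 * real (3*N)) ^ card C * fact (3*N)
        * exp ((\<mu>\<^sup>2 - \<mu> * triple_density t W {..<3*N}) * real N)"
proof -
  let ?V = "{..<3*N}" and ?n = "3*N"
  let ?q = "triple_density t W ?V"
  define g where "g = (\<lambda>(a,b,c). if (a,b,c) \<in> W then exp (-\<mu>) else 1)"
  define F where "F = (\<lambda>w. \<Prod>i<N. g (w (3*i), w (3*i+1), w (3*i+2)))"
  have F: "exp (- \<mu> * real (hits t W N \<phi>)) = F (restrict (t \<circ> \<phi>) ?V)" for \<phi>
  proof -
    have "F (restrict (t \<circ> \<phi>) ?V) =
      (\<Prod>i<N. if (t (\<phi> (3*i)), t (\<phi> (3*i+1)), t (\<phi> (3*i+2))) \<in> W then exp (-\<mu>) else 1)"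
      unfolding F_def g_def by (intro prod.cong) auto
    also have "\<dots> = exp (-\<mu>) ^ hits t W N \<phi>"
      unfolding hits_def by (simp add: prod.If_cases Collect_conj_eq lessThan_def)
    finally show ?thesis by (simp add: exp_of_nat_mult[symmetric] mult.commute)
  qed
  have "(\<Sum>\<pi> | \<pi> permutes ?V. exp (- \<mu> * real (hits t W N \<pi>)))
     \<le> (exp 1 * real ?n) ^ card C * (fact ?n / real ?n ^ ?n) * (\<Sum>\<phi>\<in>?V \<rightarrow>\<^sub>E ?V. F (restrict (t \<circ> \<phi>) ?V))"
  proof -
    have "?V \<noteq> {}" using N by (simp add: lessThan_empty_iff)
    moreover have "F w \<ge> 0" for w
      unfolding F_def g_def by (intro prod_nonneg) auto
    ultimately show ?thesis
      unfolding F using sum_permutes_le_sum_functions[of ?V C t F] C by simp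
  qed
  also have "(\<Sum>\<phi>\<in>?V \<rightarrow>\<^sub>E ?V. F (restrict (t \<circ> \<phi>) ?V))
      = (\<Sum>\<phi>\<in>?V \<rightarrow>\<^sub>E ?V. \<Prod>i<N. (\<lambda>(u,v,w). g (t u, t v, t w)) (\<phi> (3*i), \<phi> (3*i+1), \<phi> (3*i+2)))"
    unfolding F_def by (intro sum.cong prod.cong) auto
  also have "\<dots> = (\<Sum>x\<in>cube ?V. (\<lambda>(u,v,w). g (t u, t v, t w)) x) ^ N"
    by (rule sum_functions_by_triples) simp
  also have "(\<Sum>x\<in>cube ?V. (\<lambda>(u,v,w). g (t u, t v, t w)) x) = real ?n ^ 3 * (1 + ?q * (exp (-\<mu>) - 1))"
  proof -
    let ?G = "{(u,v,w) \<in> cube ?V. (t u, t v, t w) \<in> W}"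
    have "(\<Sum>x\<in>cube ?V. (\<lambda>(u,v,w). g (t u, t v, t w)) x)
       = (\<Sum>x\<in>cube ?V. 1 + (if x \<in> ?G then exp (-\<mu>) - 1 else 0))"
      by (intro sum.cong) (auto simp: g_def split: if_splits)
    also have "\<dots> = real (card (cube ?V)) + (\<Sum>x\<in>cube ?V. if x \<in> ?G then exp (-\<mu>) - 1 else 0)"
      by (simp only: sum.distrib) simp
    also have "(\<Sum>x\<in>cube ?V. if x \<in> ?G then exp (-\<mu>) - 1 else 0) = real (card ?G) * (exp (-\<mu>) - 1)"
    proof -
      have "(cube ?V) \<inter> ?G = ?G" by auto
      thus ?thesis by (subst sum.inter_restrict[symmetric]) auto
    qed
    also have "real (card ?G) = ?q * real ?n ^ 3" using N by (simp add: triple_density_def)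
    also have "real (card (cube ?V)) = real ?n ^ 3"
      by (simp add: card_cartesian_product power3_eq_cube)
    finally show ?thesis by (simp add: algebra_simps)
  qed
  also have "(real ?n ^ 3 * (1 + ?q * (exp (-\<mu>) - 1))) ^ N = real ?n ^ ?n * (1 + ?q * (exp (-\<mu>) - 1)) ^ N"
    by (simp add: power_mult_distrib power_mult)
  also have "(1 + ?q * (exp (-\<mu>) - 1)) ^ N \<le> exp ((\<mu>\<^sup>2 - \<mu> * ?q) * real N)"
  proof -
    have q: "0 \<le> ?q" "?q \<le> 1" by (intro triple_density_bounds; simp)+
    have e1: "exp (-\<mu>) \<le> 1" using l by simp
    have "?q * (1 - exp (-\<mu>)) \<le> 1 * 1" using q e1 by (intro mult_mono) auto
    hence nn: "0 \<le> 1 + ?q * (exp (-\<mu>) - 1)" by (simp add: algebra_simps)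
    have "?q * (exp (-\<mu>) - 1) \<le> ?q * (\<mu>\<^sup>2 - \<mu>)"
      using exp_minus_le_quadratic[OF l] q by (intro mult_left_mono) auto
    also have "\<dots> \<le> \<mu>\<^sup>2 - \<mu> * ?q"
      using mult_right_mono[OF q(2), of "\<mu>\<^sup>2"] by (simp add: algebra_simps)
    finally have "1 + ?q * (exp (-\<mu>) - 1) \<le> exp (\<mu>\<^sup>2 - \<mu> * ?q)"
      using exp_ge_add_one_self[of "\<mu>\<^sup>2 - \<mu> * ?q"] by linarith
    hence "(1 + ?q * (exp (-\<mu>) - 1)) ^ N \<le> exp (\<mu>\<^sup>2 - \<mu> * ?q) ^ N" by (intro power_mono nn)
    also have "\<dots> = exp ((\<mu>\<^sup>2 - \<mu> * ?q) * real N)"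
      by (simp add: exp_of_nat_mult[symmetric] mult.commute)
    finally show ?thesis .
  qed
  finally show ?thesis using N by (simp add: mult_left_mono field_simps)
qed

section \<open>Sparse hypergraphs with the triple statistics of the complete one\<close>

definition block :: "(nat \<Rightarrow> nat) \<Rightarrow> nat \<Rightarrow> nat set" where
  "block \<pi> i = \<pi> ` {3*i, 3*i+1, 3*i+2}"

text \<open>Chernoff's method for a k-tuple of independent permutations: the exponential moment
  factorises over the tuple, so concentration acts on \<open>k * N\<close> blocks while the number
  of vertices stays \<open>3*N\<close>.\<close>

lemma card_bad_mixing_le:
  fixes t :: "nat \<Rightarrow> 'c" and W :: "('c \<times> 'c \<times> 'c) set" and \<delta> :: real
  assumes N: "N > 0" and C: "finite C" "t ` {..<3*N} \<subseteq> C" and d: "\<delta> > 0"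
  defines "q \<equiv> triple_density t W {..<3*N}"
  shows "real (card {\<omega> \<in> {..<k} \<rightarrow>\<^sub>E {\<pi>. \<pi> permutes {..<3*N}}.
            real (\<Sum>j<k. hits t W N (\<omega> j)) < (q - \<delta>) * real (k * N)})
    \<le> (exp 1 * real (3*N)) ^ (card C * k) * fact (3*N) ^ k * exp (- (\<delta>\<^sup>2 * real (k * N) / 4))"
proof -
  let ?P = "{\<pi>. \<pi> permutes {..<3*N}}"
  let ?Om = "{..<k} \<rightarrow>\<^sub>E ?P"
  let ?S = "\<lambda>\<omega>. real (\<Sum>j<k. hits t W N (\<omega> j))"
  let ?B = "{\<omega> \<in> ?Om. ?S \<omega> < (q - \<delta>) * real (k * N)}"
  \<comment> \<open>This parameter minimises ?m^2 - \<delta> ?m, the exponent per block that is left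
    after the terms with \<open>q\<close> cancel.\<close>
  let ?m = "\<delta> / 2"
  have finP: "finite ?P" by (simp add: finite_permutations)
  hence finOm: "finite ?Om" by (intro finite_PiE) auto
  have "real (card ?B) = (\<Sum>\<omega>\<in>?B. 1)" by simp
  also have "\<dots> \<le> (\<Sum>\<omega>\<in>?B. exp (?m * ((q - \<delta>) * real (k * N) - ?S \<omega>)))"
    using d by (intro sum_mono) auto
  also have "\<dots> \<le> (\<Sum>\<omega>\<in>?Om. exp (?m * ((q - \<delta>) * real (k * N) - ?S \<omega>)))"
    by (intro sum_mono2 finOm) auto
  also have "\<dots> = exp (?m * (q - \<delta>) * real (k * N)) * (\<Sum>\<omega>\<in>?Om. \<Prod>j<k. exp (- ?m * real (hits t W N (\<omega> j))))"
    unfolding sum_distrib_left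
  proof (intro sum.cong refl)
    fix \<omega>
    have "(\<Prod>j<k. exp (- ?m * real (hits t W N (\<omega> j)))) = exp (- ?m * ?S \<omega>)"
      by (simp add: exp_sum[symmetric] sum_distrib_left)
    thus "exp (?m * ((q - \<delta>) * real (k * N) - ?S \<omega>)) =
      exp (?m * (q - \<delta>) * real (k * N)) * (\<Prod>j<k. exp (- ?m * real (hits t W N (\<omega> j))))"
      by (simp only: exp_add[symmetric]) (simp add: algebra_simps)
  qed
  also have "(\<Sum>\<omega>\<in>?Om. \<Prod>j<k. exp (- ?m * real (hits t W N (\<omega> j))))
      = (\<Sum>\<pi>\<in>?P. exp (- ?m * real (hits t W N \<pi>))) ^ k"
    using finP by (subst prod_sum_PiE[symmetric]) auto
  also have "exp (?m * (q - \<delta>) * real (k * N)) * (\<Sum>\<pi>\<in>?P. exp (- ?m * real (hits t W N \<pi>))) ^ k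
     \<le> exp (?m * (q - \<delta>) * real (k * N)) * ((exp 1 * real (3*N)) ^ card C * fact (3*N)
        * exp ((?m\<^sup>2 - ?m * q) * real N)) ^ k"
  proof (intro mult_left_mono power_mono)
    show "(\<Sum>\<pi>\<in>?P. exp (- ?m * real (hits t W N \<pi>)))
      \<le> (exp 1 * real (3*N)) ^ card C * fact (3*N) * exp ((?m\<^sup>2 - ?m * q) * real N)"
      using permutation_mgf_le[OF N C, of ?m W] d unfolding q_def by simp
  qed (auto intro: sum_nonneg)
  also have "\<dots> = (exp 1 * real (3*N)) ^ (card C * k) * fact (3*N) ^ k
     * (exp (?m * (q - \<delta>) * real (k * N)) * exp ((?m\<^sup>2 - ?m * q) * real N) ^ k)"
    unfolding power_mult_distrib power_mult by (simp only: mult_ac)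
  also have "exp (?m * (q - \<delta>) * real (k * N)) * exp ((?m\<^sup>2 - ?m * q) * real N) ^ k
     = exp (- (\<delta>\<^sup>2 * real (k * N) / 4))"
    by (simp add: exp_of_nat_mult[symmetric] exp_add[symmetric] field_simps power2_eq_square)
  finally show ?thesis .
qed

text \<open>The factor 27 = 3^3 counts all maps of the three positions into \<open>T\<close>,
  injective or not; a constant loss does no harm.\<close>

lemma card_permutes_block_le:
  assumes "i < N" "finite T" "card T \<le> 3"
  shows "card {\<pi>. \<pi> permutes {..<3*N} \<and> block \<pi> i = T} \<le> 27 * fact (3*N - 3)"
proof -
  let ?X = "{3*i, 3*i+1, 3*i+2}"
  have c3: "card ?X = 3" by simp
  have sub: "?X \<subseteq> {..<3*N}" using assms by auto
  have "{\<pi>. \<pi> permutes {..<3*N} \<and> block \<pi> i = T}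
     \<subseteq> (\<Union>g\<in>?X \<rightarrow>\<^sub>E T. {\<pi>. \<pi> permutes {..<3*N} \<and> (\<forall>x\<in>?X. \<pi> x = g x)})"
  proof
    fix \<pi> assume "\<pi> \<in> {\<pi>. \<pi> permutes {..<3*N} \<and> block \<pi> i = T}"
    hence "\<pi> permutes {..<3*N}" "restrict \<pi> ?X \<in> ?X \<rightarrow>\<^sub>E T" by (auto simp: block_def)
    thus "\<pi> \<in> (\<Union>g\<in>?X \<rightarrow>\<^sub>E T. {\<pi>. \<pi> permutes {..<3*N} \<and> (\<forall>x\<in>?X. \<pi> x = g x)})"
      by (intro UN_I[of "restrict \<pi> ?X"]) auto
  qed
  moreover have fin: "finite (?X \<rightarrow>\<^sub>E T)" using assms by (intro finite_PiE) auto
  moreover have "finite {\<pi>. \<pi> permutes {..<3*N} \<and> (\<forall>x\<in>?X. \<pi> x = g x)}" for g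
    by (rule finite_subset[OF _ finite_permutations[of "{..<3*N}"]]) auto
  ultimately have "card {\<pi>. \<pi> permutes {..<3*N} \<and> block \<pi> i = T}
    \<le> card (\<Union>g\<in>?X \<rightarrow>\<^sub>E T. {\<pi>. \<pi> permutes {..<3*N} \<and> (\<forall>x\<in>?X. \<pi> x = g x)})"
    by (intro card_mono finite_UN_I) auto
  also have "\<dots> \<le> (\<Sum>g\<in>?X \<rightarrow>\<^sub>E T. card {\<pi>. \<pi> permutes {..<3*N} \<and> (\<forall>x\<in>?X. \<pi> x = g x)})"
    by (rule card_UN_le[OF fin])
  also have "\<dots> \<le> (\<Sum>g\<in>?X \<rightarrow>\<^sub>E T. fact (3*N - 3))"
  proof (intro sum_mono)
    fix g
    show "card {\<pi>. \<pi> permutes {..<3*N} \<and> (\<forall>x\<in>?X. \<pi> x = g x)} \<le> fact (3*N - 3)"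
      using card_permutes_extending_le[OF _ sub, of g] unfolding c3 by simp
  qed
  also have "\<dots> = card T ^ 3 * fact (3*N - 3)" by (subst sum_constant, subst card_PiE) (simp_all add: c3 power3_eq_cube)
  also have "\<dots> \<le> 3 ^ 3 * fact (3*N - 3)" using assms by (intro mult_right_mono power_mono) auto
  finally show ?thesis by simp
qed

text \<open>A triple common to two matchings would be a single hyperedge and would spoil the
  degrees. With all permutations except the one at \<open>j'\<close> fixed, the block that it has to
  hit is a fixed set. Relative to all tuples the bound is of order k^2 / N.\<close>

lemma card_block_collisions_le:
  "card {\<omega> \<in> {..<k} \<rightarrow>\<^sub>E {\<pi>. \<pi> permutes {..<3*N}}.
      \<exists>j<k. \<exists>j'<k. \<exists>i<N. \<exists>i'<N. j \<noteq> j' \<and> block (\<omega> j) i = block (\<omega> j') i'}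
    \<le> k\<^sup>2 * N\<^sup>2 * (27 * fact (3*N - 3) * fact (3*N) ^ (k - 1))"
proof -
  let ?P = "{\<pi>. \<pi> permutes {..<3*N}}"
  let ?Om = "{..<k} \<rightarrow>\<^sub>E ?P"
  let ?B = "\<lambda>(j,j',i,i'). {\<omega> \<in> ?Om. j \<noteq> j' \<and> block (\<omega> j) i = block (\<omega> j') i'}"
  let ?I = "{..<k} \<times> {..<k} \<times> {..<N} \<times> {..<N}"
  have finP: "finite ?P" by (simp add: finite_permutations)
  have finOm: "finite ?Om" using finP by (intro finite_PiE) auto
  have cP: "card ?P = fact (3*N)" by (simp add: card_permutations)
  have each: "card (?B x) \<le> 27 * fact (3*N - 3) * fact (3*N) ^ (k - 1)" if xI: "x \<in> ?I" for x
  proof -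
    obtain j j' i i' where x: "x = (j,j',i,i')" and b: "j < k" "j' < k" "i < N" "i' < N"
      using xI by auto
    show ?thesis
    proof (cases "j = j'")
      case True
      then show ?thesis unfolding x by simp
    next
      case False
      let ?K = "{..<k} - {j'}"
      \<comment> \<open>The tuple is split into its entries outside \<open>j'\<close> and the entry
        at \<open>j'\<close>, so that the second factor is constrained by a set depending on the
        first.\<close>
      let ?Sg = "SIGMA \<omega>:?K \<rightarrow>\<^sub>E ?P. {\<pi>. \<pi> permutes {..<3*N} \<and> block \<pi> i' = block (\<omega> j) i}"
      let ?h = "\<lambda>\<omega>. (restrict \<omega> ?K, \<omega> j')"
      have finK: "finite (?K \<rightarrow>\<^sub>E ?P)" using finP by (intro finite_PiE) auto
      have finS: "finite {\<pi>. \<pi> permutes {..<3*N} \<and> block \<pi> i' = T}" for T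
        by (rule finite_subset[OF _ finP]) auto
      have "inj_on ?h (?B x)"
      proof (rule inj_onI)
        fix \<omega> \<omega>' assume h: "\<omega> \<in> ?B x" "\<omega>' \<in> ?B x" "?h \<omega> = ?h \<omega>'"
        hence O: "\<omega> \<in> ?Om" "\<omega>' \<in> ?Om" unfolding x by auto
        show "\<omega> = \<omega>'"
        proof (rule PiE_ext[OF O])
          fix a assume "a \<in> {..<k}"
          show "\<omega> a = \<omega>' a"
          proof (cases "a = j'")
            case False
            have "restrict \<omega> ?K a = restrict \<omega>' ?K a" using h(3) by simp
            thus ?thesis using False \<open>a \<in> {..<k}\<close> by simp
          qed (use h(3) in auto)
        qed
      qed
      moreover have "?h ` ?B x \<subseteq> ?Sg"
      proof (rule image_subsetI)
        fix \<omega> assume "\<omega> \<in> ?B x"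
        hence h: "\<omega> \<in> ?Om" "block (\<omega> j') i' = block (\<omega> j) i" unfolding x by simp_all
        have "restrict \<omega> ?K \<in> ?K \<rightarrow>\<^sub>E ?P" using h(1) by (intro restrict_PiE_iff[THEN iffD2]) auto
        moreover have "\<omega> j' permutes {..<3*N}" using h(1) b by auto
        ultimately show "?h \<omega> \<in> ?Sg" using h(2) b False by simp
      qed
      moreover have "finite ?Sg" by (intro finite_SigmaI finK finS)
      ultimately have "card (?B x) \<le> card ?Sg" by (rule card_inj_on_le)
      also have "\<dots> = (\<Sum>\<omega>\<in>?K \<rightarrow>\<^sub>E ?P. card {\<pi>. \<pi> permutes {..<3*N} \<and> block \<pi> i' = block (\<omega> j) i})"
        by (rule card_SigmaI[OF finK]) (intro ballI finS)
      also have "\<dots> \<le> (\<Sum>\<omega>\<in>?K \<rightarrow>\<^sub>E ?P. 27 * fact (3*N - 3))"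
      proof (intro sum_mono card_permutes_block_le)
        fix \<omega> :: "nat \<Rightarrow> nat \<Rightarrow> nat"
        have "card (block (\<omega> j) i) \<le> card {3*i, 3*i+1, 3*i+2}"
          unfolding block_def by (intro card_image_le) simp
        thus "card (block (\<omega> j) i) \<le> 3" by simp
      qed (use b in \<open>auto simp: block_def\<close>)
      also have "\<dots> = 27 * fact (3*N - 3) * fact (3*N) ^ (k - 1)"
        using b by (simp add: card_PiE cP)
      finally show ?thesis .
    qed
  qed
  have eq: "{\<omega> \<in> ?Om. \<exists>j<k. \<exists>j'<k. \<exists>i<N. \<exists>i'<N. j \<noteq> j' \<and> block (\<omega> j) i = block (\<omega> j') i'}
     = (\<Union>x\<in>?I. ?B x)" (is "?L = ?R")
  proof (intro equalityI subsetI)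
    fix \<omega> assume "\<omega> \<in> ?L"
    then obtain j j' i i' where h: "\<omega> \<in> ?Om" "j < k" "j' < k" "i < N" "i' < N" "j \<noteq> j'"
      "block (\<omega> j) i = block (\<omega> j') i'" by blast
    show "\<omega> \<in> ?R" by (rule UN_I[of "(j,j',i,i')"]) (use h in simp_all)
  next
    fix \<omega> assume "\<omega> \<in> ?R"
    then obtain x where x: "x \<in> ?I" "\<omega> \<in> ?B x" by (rule UN_E)
    obtain j j' i i' where "x = (j,j',i,i')" by (cases x) 
    thus "\<omega> \<in> ?L" using x by simp blast
  qed
  have "card (\<Union>x\<in>?I. ?B x) \<le> (\<Sum>x\<in>?I. card (?B x))" by (rule card_UN_le) simp
  also have "\<dots> \<le> (\<Sum>x\<in>?I. 27 * fact (3*N - 3) * fact (3*N) ^ (k - 1))"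
    by (intro sum_mono each)
  also have "\<dots> = k\<^sup>2 * N\<^sup>2 * (27 * fact (3*N - 3) * fact (3*N) ^ (k - 1))"
    by (simp add: card_cartesian_product power2_eq_square mult_ac)
  finally show ?thesis unfolding eq .
qed

section \<open>The union of k perfect matchings as a hypergraph\<close>

lemma block_disjoint:
  assumes "\<pi> permutes {..<3*N}" "x \<in> block \<pi> i"
  shows "i = inv \<pi> x div 3"
proof -
  from assms(2) obtain a where a: "a \<in> {3*i, 3*i+1, 3*i+2}" "x = \<pi> a" by (auto simp: block_def)
  have "inv \<pi> x = a" using a assms(1) by (simp add: permutes_inverses)
  thus ?thesis using a by auto
qed

lemma mem_block_inv:
  assumes "\<pi> permutes {..<3*N}"
  shows "x \<in> block \<pi> (inv \<pi> x div 3)"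
proof -
  let ?y = "inv \<pi> x"
  have "?y = 3 * (?y div 3) \<or> ?y = 3 * (?y div 3) + 1 \<or> ?y = 3 * (?y div 3) + 2" by presburger
  hence "?y \<in> {3 * (?y div 3), 3 * (?y div 3) + 1, 3 * (?y div 3) + 2}" by blast
  hence "\<pi> ?y \<in> block \<pi> (?y div 3)" unfolding block_def by (rule imageI)
  thus ?thesis using assms by (simp add: permutes_inverses)
qed

text \<open>As an image, this set merges equal blocks; absence of collisions is therefore what makes
  the edge count and the degrees exact.\<close>

definition block_edges :: "nat \<Rightarrow> nat \<Rightarrow> (nat \<Rightarrow> nat \<Rightarrow> nat) \<Rightarrow> nat set set" where
  "block_edges k N \<omega> = (\<lambda>(j,i). block (\<omega> j) i) ` ({..<k} \<times> {..<N})"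

text \<open>Hyperedges carry no order, so some ordering with labels in \<open>W\<close> is asked
  for. The ordered count \<open>hits\<close> then gives a lower bound.\<close>

abbreviation labelled_edges :: "('a \<Rightarrow> 'c) \<Rightarrow> ('c \<times> 'c \<times> 'c) set \<Rightarrow> 'a set \<Rightarrow> 'a set set \<Rightarrow> 'a set set" where
  "labelled_edges t W V E \<equiv>
     {e \<in> E. \<exists>u v w. e = {u,v,w} \<and> u \<in> V \<and> v \<in> V \<and> w \<in> V \<and> (t u, t v, t w) \<in> W}"

text \<open>Every vertex lies in exactly one block of each permutation, the one with index
  \<open>inv (\<omega> j) v div 3\<close>, and \<open>dist\<close> keeps the k blocks at a vertex
  distinct.\<close>

lemma block_edges_properties:
  assumes perm: "\<And>j. j < k \<Longrightarrow> \<omega> j permutes {..<3*N}"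
    and dist: "\<And>j j' i i'. \<lbrakk>j < k; j' < k; i < N; i' < N; j \<noteq> j'\<rbrakk> \<Longrightarrow> block (\<omega> j) i \<noteq> block (\<omega> j') i'"
  shows "three_uniform_hypergraph {..<3*N} (block_edges k N \<omega>)"
    and "regular_hypergraph k {..<3*N} (block_edges k N \<omega>)"
    and "card (block_edges k N \<omega>) = k * N"
    and "(\<Sum>j<k. hits t W N (\<omega> j))
       \<le> card (labelled_edges t W {..<3*N} (block_edges k N \<omega>))"
proof -
  let ?e = "\<lambda>(j,i). block (\<omega> j) i"
  let ?I = "{..<k} \<times> {..<N}"
  have inj: "inj_on ?e ?I"
  proof (rule inj_onI, clarsimp)
    fix j i j' i' assume h: "block (\<omega> j) i = block (\<omega> j') i'" "j < k" "i < N" "j' < k" "i' < N"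
    have j: "j = j'" using dist h by blast
    have "\<omega> j (3*i) \<in> block (\<omega> j) i" by (simp add: block_def)
    moreover from this have "\<omega> j (3*i) \<in> block (\<omega> j) i'" using h(1) j by simp
    ultimately show "j = j' \<and> i = i'" using j block_disjoint[OF perm[OF h(2)], of "\<omega> j (3*i)"] by blast
  qed
  show "card (block_edges k N \<omega>) = k * N"
    unfolding block_edges_def by (simp add: card_image[OF inj])
  have c3: "card (block (\<omega> j) i) = 3" if "j < k" for j i
    unfolding block_def card_image[OF permutes_inj_on[OF perm[OF that]]] by simp
  show "three_uniform_hypergraph {..<3*N} (block_edges k N \<omega>)"
    unfolding three_uniform_hypergraph_def
  proof (intro conjI ballI)
    fix e assume "e \<in> block_edges k N \<omega>"
    then obtain j i where ji: "j < k" "i < N" "e = block (\<omega> j) i" by (auto simp: block_edges_def)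
    show "card e = 3" using c3 ji by simp
    have "\<omega> j ` {3*i, 3*i+1, 3*i+2} \<subseteq> \<omega> j ` {..<3*N}" using ji by (intro image_mono) auto
    thus "e \<subseteq> {..<3*N}" using ji permutes_image[OF perm[OF ji(1)]] by (simp add: block_def)
  qed simp
  show "regular_hypergraph k {..<3*N} (block_edges k N \<omega>)"
    unfolding regular_hypergraph_def
  proof
    fix v assume v: "v \<in> {..<3*N}"
    let ?f = "\<lambda>j. block (\<omega> j) (inv (\<omega> j) v div 3)"
    have lt: "inv (\<omega> j) v div 3 < N" if "j < k" for j
    proof -
      have "inv (\<omega> j) v \<in> {..<3*N}" using permutes_in_image[OF permutes_inv[OF perm[OF that]]] v by simp
      thus ?thesis by auto
    qed
    have "{e \<in> block_edges k N \<omega>. v \<in> e} = ?f ` {..<k}"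
    proof (intro equalityI subsetI)
      fix e assume "e \<in> {e \<in> block_edges k N \<omega>. v \<in> e}"
      then obtain j i where ji: "j < k" "i < N" "e = block (\<omega> j) i" "v \<in> e" by (auto simp: block_edges_def)
      hence "i = inv (\<omega> j) v div 3" using block_disjoint[OF perm] by blast
      thus "e \<in> ?f ` {..<k}" using ji by blast
    next
      fix e assume "e \<in> ?f ` {..<k}"
      then obtain j where j: "j < k" "e = ?f j" by auto
      thus "e \<in> {e \<in> block_edges k N \<omega>. v \<in> e}"
        using mem_block_inv[OF perm[OF j(1)], of v] lt[OF j(1)] by (force simp: block_edges_def)
    qed
    moreover have "inj_on ?f {..<k}"
    proof (rule inj_onI, rule ccontr)
      fix j j' assume "j \<in> {..<k}" "j' \<in> {..<k}" "?f j = ?f j'" "j \<noteq> j'"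
      thus False using dist[of j j' "inv (\<omega> j) v div 3" "inv (\<omega> j') v div 3"] lt by simp
    qed
    ultimately show "card {e \<in> block_edges k N \<omega>. v \<in> e} = k" by (simp add: card_image)
  qed
  let ?H = "{x \<in> ?I. case x of (j,i) \<Rightarrow> (t (\<omega> j (3*i)), t (\<omega> j (3*i+1)), t (\<omega> j (3*i+2))) \<in> W}"
  have "(\<Sum>j<k. hits t W N (\<omega> j)) = card (SIGMA j:{..<k}. {i\<in>{..<N}. (t (\<omega> j (3*i)), t (\<omega> j (3*i+1)), t (\<omega> j (3*i+2))) \<in> W})"
    unfolding hits_def by (subst card_SigmaI) auto
  also have "(SIGMA j:{..<k}. {i\<in>{..<N}. (t (\<omega> j (3*i)), t (\<omega> j (3*i+1)), t (\<omega> j (3*i+2))) \<in> W}) = ?H"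
    by auto
  also have "card ?H = card (?e ` ?H)"
    using inj by (intro card_image[symmetric]) (auto intro: inj_on_subset)
  also have "\<dots> \<le> card (labelled_edges t W {..<3*N} (block_edges k N \<omega>))"
  proof (rule card_mono)
    show "finite (labelled_edges t W {..<3*N} (block_edges k N \<omega>))"
      by (simp add: block_edges_def)
    show "?e ` ?H \<subseteq> (labelled_edges t W {..<3*N} (block_edges k N \<omega>))"
    proof (rule image_subsetI)
      fix x assume "x \<in> ?H"
      then obtain j i where x: "x = (j,i)" and ji: "j \<in> {..<k}" "i \<in> {..<N}"
        "(t (\<omega> j (3*i)), t (\<omega> j (3*i+1)), t (\<omega> j (3*i+2))) \<in> W" by auto
      have "block (\<omega> j) i \<in> block_edges k N \<omega>" using ji by (force simp: block_edges_def)
      moreover have "\<omega> j (3*i) \<in> {..<3*N}" "\<omega> j (3*i+1) \<in> {..<3*N}" "\<omega> j (3*i+2) \<in> {..<3*N}"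
        using ji permutes_in_image[OF perm[of j]] by auto
      moreover have "block (\<omega> j) i = {\<omega> j (3*i), \<omega> j (3*i+1), \<omega> j (3*i+2)}"
        by (simp add: block_def)
      ultimately show "?e x \<in> (labelled_edges t W {..<3*N} (block_edges k N \<omega>))"
        unfolding x prod.case using ji(3) by blast
    qed
  qed
  finally show "(\<Sum>j<k. hits t W N (\<omega> j))
       \<le> card (labelled_edges t W {..<3*N} (block_edges k N \<omega>))" .
qed

text \<open>Two kinds of tuples of permutations are excluded: those with wrong statistics for some
  labelling and those with a repeated edge. Each kind makes up less than half of all tuples.\<close>

lemma mixing_hypergraphs_exist:
  fixes C :: "'c set" and \<delta> :: real
  assumes C: "finite C" "C \<noteq> {}" and d: "\<delta> > 0"
  shows "\<exists>k>0. \<forall>\<^sub>F N in sequentially. \<exists>E. three_uniform_hypergraph {..<3*N} E \<and>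
    regular_hypergraph k {..<3*N} E \<and> (\<forall>t W. t ` {..<3*N} \<subseteq> C \<longrightarrow> W \<subseteq> cube C \<longrightarrow>
      (triple_density t W {..<3*N} - \<delta>) * real (card E)
        \<le> real (card (labelled_edges t W {..<3*N} E)))"
proof -
  let ?m = "card C"
  have m: "?m > 0" using C by (simp add: card_gt_0_iff)
  \<comment> \<open>The gain \<delta>^2 k / 4 per block must beat 3 ln m, the entropy of labelling
    three vertices with m labels. The surplus 1 leaves a factor exp(-N), which absorbs the
    polynomial factors.\<close>
  obtain k :: nat where k: "real k > 4 * (3 * ln (real ?m) + 1) / \<delta>\<^sup>2" using reals_Archimedean2 by blast
  have "0 \<le> 4 * (3 * ln (real ?m) + 1) / \<delta>\<^sup>2" using m by (simp add: ln_ge_zero)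
  hence kpos: "k > 0" using k by linarith
  have kd: "3 * ln (real ?m) + 1 \<le> \<delta>\<^sup>2 * real k / 4" using k d by (simp add: field_simps)
  let ?q = "?m * k"
  define c :: real where "c = 2 ^ (?m ^ 3) * (3 * exp 1) ^ ?q"
  have "((\<lambda>x::real. c * (x ^ ?q / exp x)) \<longlongrightarrow> c * 0) at_top"
    by (intro tendsto_mult tendsto_const tendsto_power_div_exp_0)
  hence "((\<lambda>N. c * (real N ^ ?q / exp (real N))) \<longlongrightarrow> 0) sequentially"
    using filterlim_compose[OF _ filterlim_real_sequentially] by fastforce
  hence ev1: "\<forall>\<^sub>F N in sequentially. c * (real N ^ ?q / exp (real N)) < 1/2"
    by (rule order_tendstoD) simp
  \<comment> \<open>Since (3N)(3N - 1)(3N - 2) \<ge> 3 N^3, the condition N > 18 k^2 puts 27 k^2 N^2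
    below half of this product.\<close>
  have ev2: "\<forall>\<^sub>F N in sequentially. N > 18 * k\<^sup>2" by (rule eventually_gt_at_top)
  have "\<forall>\<^sub>F N in sequentially. \<exists>E. three_uniform_hypergraph {..<3*N} E \<and>
    regular_hypergraph k {..<3*N} E \<and> (\<forall>t W. t ` {..<3*N} \<subseteq> C \<longrightarrow> W \<subseteq> cube C \<longrightarrow>
      (triple_density t W {..<3*N} - \<delta>) * real (card E)
        \<le> real (card (labelled_edges t W {..<3*N} E)))"
    using ev1 ev2
  proof eventually_elim
    case (elim N)
    hence N: "N > 0" by auto
    let ?V = "{..<3*N}"
    let ?P = "{\<pi>. \<pi> permutes ?V}"
    let ?Om = "{..<k} \<rightarrow>\<^sub>E ?P"
    let ?bad = "\<lambda>(t,W). {\<omega> \<in> ?Om. real (\<Sum>j<k. hits t W N (\<omega> j)) < (triple_density t W ?V - \<delta>) * real (k * N)}"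
    let ?col = "{\<omega> \<in> ?Om. \<exists>j<k. \<exists>j'<k. \<exists>i<N. \<exists>i'<N. j \<noteq> j' \<and> block (\<omega> j) i = block (\<omega> j') i'}"
    \<comment> \<open>Extensional labellings make the union bound finite: m^(3N) labellings and
      2^(m^3) sets of label triples. An arbitrary \<open>t\<close> is restricted to the vertex set
      afterwards.\<close>
    let ?J = "(?V \<rightarrow>\<^sub>E C) \<times> Pow (cube C)"
    let ?f = "fact (3*N) :: real"
    have finP: "finite ?P" by (simp add: finite_permutations)
    have finOm: "finite ?Om" using finP by (intro finite_PiE) auto
    have cOm: "real (card ?Om) = ?f ^ k" by (simp add: card_PiE card_permutations)
    have finJ: "finite ?J" using C by (auto intro: finite_PiE)
    have cJ: "real (card ?J) = real ?m ^ (3*N) * 2 ^ (?m ^ 3)"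
      using C by (simp add: card_cartesian_product card_PiE card_Pow power3_eq_cube mult.assoc)
    have ceq: "2 ^ (?m ^ 3) * (exp 1 * real (3*N)) ^ ?q * exp (- real N) = c * (real N ^ ?q / exp (real N))"
      unfolding c_def by (simp add: power_mult_distrib exp_minus divide_inverse mult_ac)
    have e1: "real ?m ^ (3*N) * exp (- (\<delta>\<^sup>2 * real (k * N) / 4)) \<le> exp (- real N)"
    proof -
      have e0: "real ?m ^ (3*N) = exp (real (3*N) * ln (real ?m))"
        using m exp_of_nat_mult[of "3*N" "ln (real ?m)"] by simp
      have "real (3*N) * ln (real ?m) + - (\<delta>\<^sup>2 * real (k * N) / 4) \<le> - real N"
        using mult_right_mono[OF kd, of "real N"] by (simp add: algebra_simps)
      thus ?thesis unfolding e0 exp_add[symmetric] by simp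
    qed
    have arith: "(a * b) * (c * d * e) = d * (b * c * (a * e))" for a b c d e :: real
      by (simp add: mult_ac)
    have "real (card (\<Union>x\<in>?J. ?bad x)) \<le> real (\<Sum>x\<in>?J. card (?bad x))"
      by (simp only: of_nat_le_iff) (rule card_UN_le[OF finJ])
    also have "\<dots> = (\<Sum>x\<in>?J. real (card (?bad x)))" by simp
    also have "\<dots> \<le> (\<Sum>x\<in>?J. (exp 1 * real (3*N)) ^ ?q * ?f ^ k * exp (- (\<delta>\<^sup>2 * real (k * N) / 4)))"
    proof (rule sum_mono)
      fix x assume "x \<in> ?J"
      then obtain t W where x: "x = (t,W)" and t: "t \<in> ?V \<rightarrow>\<^sub>E C" by auto
      hence "t ` ?V \<subseteq> C" by auto
      from card_bad_mixing_le[OF N C(1) this d, of k W]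
      show "real (card (?bad x)) \<le> (exp 1 * real (3*N)) ^ ?q * ?f ^ k * exp (- (\<delta>\<^sup>2 * real (k * N) / 4))"
        unfolding x by simp
    qed
    also have "\<dots> = ?f ^ k * (2 ^ (?m ^ 3) * (exp 1 * real (3*N)) ^ ?q * (real ?m ^ (3*N) * exp (- (\<delta>\<^sup>2 * real (k * N) / 4))))"
      unfolding sum_constant cJ by (rule arith)
    also have "\<dots> \<le> ?f ^ k * (2 ^ (?m ^ 3) * (exp 1 * real (3*N)) ^ ?q * exp (- real N))"
      by (rule mult_left_mono[OF mult_left_mono[OF e1]]) simp_all
    also have "\<dots> < ?f ^ k * (1/2)"
      unfolding ceq using elim(1) by (intro mult_strict_left_mono) auto
    finally have b1: "real (card (\<Union>x\<in>?J. ?bad x)) < ?f ^ k / 2" by simp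
    have fr: "?f = real (3*N) * (real (3*N) - 1) * (real (3*N) - 2) * fact (3*N - 3)"
    proof -
      obtain a where a: "3*N = Suc (Suc (Suc a))" using N by (intro that[of "3*N - 3"]) linarith
      show ?thesis unfolding a by (simp add: algebra_simps)
    qed
    have "real (card ?col) \<le> real (k\<^sup>2 * N\<^sup>2 * (27 * fact (3*N - 3) * fact (3*N) ^ (k - 1)))"
      using card_block_collisions_le[of k N] by (simp only: of_nat_le_iff)
    also have "\<dots> = ?f ^ (k - 1) * (27 * (real k)\<^sup>2 * (real N)\<^sup>2 * fact (3*N - 3))" by simp
    also have "\<dots> < ?f ^ (k - 1) * (?f / 2)"
    proof (rule mult_strict_left_mono)
      have "real (18 * k\<^sup>2) < real N" using elim(2) by (simp only: of_nat_less_iff)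
      hence "18 * (real k)\<^sup>2 < real N" by simp
      hence "27 * (real k)\<^sup>2 * (real N)\<^sup>2 < (3/2) * real N * (real N)\<^sup>2" using N by simp
      also have "\<dots> = real (3*N) * real N * real N / 2" by (simp add: power2_eq_square)
      also have "\<dots> \<le> real (3*N) * (real (3*N) - 1) * (real (3*N) - 2) / 2"
        using N by (intro divide_right_mono mult_mono) auto
      finally have "27 * (real k)\<^sup>2 * (real N)\<^sup>2 * fact (3*N - 3)
        < real (3*N) * (real (3*N) - 1) * (real (3*N) - 2) / 2 * fact (3*N - 3)"
        by (intro mult_strict_right_mono) auto
      thus "27 * (real k)\<^sup>2 * (real N)\<^sup>2 * fact (3*N - 3) < ?f / 2" unfolding fr by simp
    qed simp
    also have "\<dots> = ?f ^ k / 2" using kpos by (cases k) auto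
    finally have b2: "real (card ?col) < ?f ^ k / 2" .
    have "card ((\<Union>x\<in>?J. ?bad x) \<union> ?col) \<le> card (\<Union>x\<in>?J. ?bad x) + card ?col" by (rule card_Un_le)
    hence "real (card ((\<Union>x\<in>?J. ?bad x) \<union> ?col)) < real (card ?Om)" unfolding cOm using b1 b2 by linarith
    hence lt: "card ((\<Union>x\<in>?J. ?bad x) \<union> ?col) < card ?Om" by simp
    have "\<not> ?Om \<subseteq> (\<Union>x\<in>?J. ?bad x) \<union> ?col"
    proof
      assume "?Om \<subseteq> (\<Union>x\<in>?J. ?bad x) \<union> ?col"
      moreover have "finite ((\<Union>x\<in>?J. ?bad x) \<union> ?col)" by (rule finite_subset[OF _ finOm]) auto
      ultimately have "card ?Om \<le> card ((\<Union>x\<in>?J. ?bad x) \<union> ?col)" by (intro card_mono)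
      thus False using lt by linarith
    qed
    then obtain \<omega> where \<omega>1: "\<omega> \<in> ?Om" "\<omega> \<notin> (\<Union>x\<in>?J. ?bad x) \<union> ?col" by (meson subsetI)
    hence \<omega>: "\<omega> \<in> ?Om" "\<omega> \<notin> (\<Union>x\<in>?J. ?bad x)" "\<omega> \<notin> ?col" by (simp_all only: Un_iff de_Morgan_disj simp_thms)
    hence nc: "\<not> (\<exists>j<k. \<exists>j'<k. \<exists>i<N. \<exists>i'<N. j \<noteq> j' \<and> block (\<omega> j) i = block (\<omega> j') i')"
      by (simp only: mem_Collect_eq simp_thms)
    have perm: "\<omega> j permutes ?V" if "j < k" for j using \<omega>(1) that by auto
    have dist: "block (\<omega> j) i \<noteq> block (\<omega> j') i'" if "j < k" "j' < k" "i < N" "i' < N" "j \<noteq> j'" for j j' i i'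
      using nc that by blast
    have props: "three_uniform_hypergraph ?V (block_edges k N \<omega>)" "regular_hypergraph k ?V (block_edges k N \<omega>)"
      "card (block_edges k N \<omega>) = k * N"
      by (rule block_edges_properties; fact perm dist)+
    have props4: "(\<Sum>j<k. hits t W N (\<omega> j))
       \<le> card (labelled_edges t W ?V (block_edges k N \<omega>))" for t :: "nat \<Rightarrow> 'c" and W
      by (rule block_edges_properties(4); fact perm dist)
    show ?case
    proof (intro exI[of _ "block_edges k N \<omega>"] conjI allI impI)
      fix t :: "nat \<Rightarrow> 'c" and W assume t: "t ` ?V \<subseteq> C" and W: "W \<subseteq> cube C"
      define t' where "t' = restrict t ?V"
      have t'J: "(t', W) \<in> ?J" using t W by (auto simp: t'_def)
      have td: "triple_density t' W ?V = triple_density t W ?V"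
      proof -
        have "{(u,v,w) \<in> cube ?V. (t' u, t' v, t' w) \<in> W} = {(u,v,w) \<in> cube ?V. (t u, t v, t w) \<in> W}"
          unfolding t'_def by auto
        thus ?thesis unfolding triple_density_def by simp
      qed
      have hit: "hits t' W N (\<omega> j) = hits t W N (\<omega> j)" if "j < k" for j
      proof -
        have "\<omega> j x \<in> ?V" if "x < 3*N" for x using permutes_in_image[OF perm[OF \<open>j<k\<close>]] that by simp
        hence "t' (\<omega> j x) = t (\<omega> j x)" if "x < 3*N" for x using that by (simp add: t'_def)
        hence "{i \<in> {..<N}. (t' (\<omega> j (3*i)), t' (\<omega> j (3*i+1)), t' (\<omega> j (3*i+2))) \<in> W}
          = {i \<in> {..<N}. (t (\<omega> j (3*i)), t (\<omega> j (3*i+1)), t (\<omega> j (3*i+2))) \<in> W}"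
          by (intro Collect_cong conj_cong) simp_all
        thus ?thesis unfolding hits_def by (rule arg_cong)
      qed
      have "\<not> (real (\<Sum>j<k. hits t' W N (\<omega> j)) < (triple_density t' W ?V - \<delta>) * real (k * N))"
      proof -
        have "\<omega> \<notin> ?bad (t', W)" using \<omega>(2) UN_I[OF t'J] by (rule contrapos_nn)
        thus ?thesis using \<omega>(1) by (simp only: prod.case mem_Collect_eq simp_thms)
      qed
      hence "(triple_density t W ?V - \<delta>) * real (k * N) \<le> real (\<Sum>j<k. hits t W N (\<omega> j))"
        unfolding td using hit by simp
      also have "\<dots> \<le> real (card (labelled_edges t W ?V (block_edges k N \<omega>)))"
        using props4[of t W] by (simp only: of_nat_le_iff)
      finally show "(triple_density t W ?V - \<delta>) * real (card (block_edges k N \<omega>))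
        \<le> real (card (labelled_edges t W ?V (block_edges k N \<omega>)))"
        using props(3) by simp
    qed (fact props(1) props(2))+
  qed
  thus ?thesis using kpos by blast
qed

section \<open>A point of minimal imbalance\<close>

text \<open>Each term lies strictly between -1/2 and 1/2. As \<sigma> tends to 0 it tends to half
  the sign, so the sum approximates half the difference of the point counts on the two sides of the
  line through \<open>p\<close> with normal \<open>u\<close>.\<close>

definition smooth_balance :: "('v \<Rightarrow> real^2) \<Rightarrow> 'v set \<Rightarrow> real \<Rightarrow> real^2 \<Rightarrow> real^2 \<Rightarrow> real" where
  "smooth_balance x V \<sigma> p u = (\<Sum>v\<in>V. arctan (u \<bullet> (x v - p) / \<sigma>) / pi)"

text \<open>
  If 0 were not in the hull, a small step from p in a separating direction would decrease F in all
  maximising directions at once.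
\<close>
lemma minimax_balanced_directions:
  fixes F :: "'a::euclidean_space \<Rightarrow> 'a \<Rightarrow> real"
  assumes cont: "continuous_on UNIV (\<lambda>z. F (fst z) (snd z))"
    and mono: "\<And>p u w. \<lbrakk>norm u = 1; u \<bullet> w > 0\<rbrakk> \<Longrightarrow> F (p + w) u < F p u"
    and inside: "norm p0 \<le> R" "\<And>u. norm u = 1 \<Longrightarrow> F p0 u \<le> B"
    and outside: "\<And>p. norm p > R \<Longrightarrow> \<exists>u. norm u = 1 \<and> F p u > B"
  shows "\<exists>p D. norm p \<le> R \<and> (\<forall>u. norm u = 1 \<longrightarrow> F p u \<le> D) \<and>
     0 \<in> convex hull {u. norm u = 1 \<and> F p u = D}"
proof -
  let ?S = "sphere (0::'a) 1"
  obtain e :: 'a where "e \<in> Basis" using nonempty_Basis by blast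
  hence neS: "?S \<noteq> {}" by (auto simp: sphere_def dist_norm intro!: exI[of _ e])
  have contu: "continuous_on ?S (F p)" for p
    using continuous_on_compose2[OF cont, of ?S "\<lambda>u. (p, u)"] by (simp add: continuous_intros)
  have "\<exists>u. norm u = 1 \<and> (\<forall>u'. norm u' = 1 \<longrightarrow> F p u' \<le> F p u)" for p
    using continuous_attains_sup[OF compact_sphere neS contu[of p]] by (auto simp: dist_norm)
  then obtain m where m: "\<And>p. norm (m p) = 1" "\<And>p u. norm u = 1 \<Longrightarrow> F p u \<le> F p (m p)" by metis
  define G where "G p = F p (m p)" for p
  have B0: "G p0 \<le> B" using inside m by (simp add: G_def)
  have out: "G p > B" if "norm p > R" for p
    using outside[OF that] m(2) unfolding G_def by (meson less_le_trans)
  obtain p where p: "norm p \<le> R" "\<And>p'. norm p' \<le> R \<Longrightarrow> G p \<le> G p'"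
  proof -
    have e1: "norm e = 1" using \<open>e \<in> Basis\<close> by simp
    have "continuous_on (cball 0 R) (\<lambda>p. F p e)"
      using continuous_on_compose2[OF cont, of "cball 0 R" "\<lambda>p. (p, e)"] by (simp add: continuous_intros)
    then obtain p1 where "\<And>p. p \<in> cball 0 R \<Longrightarrow> F p1 e \<le> F p e"
      using continuous_attains_inf[of "cball (0::'a) R"] inside(1) by fastforce
    hence "F p1 e \<le> G p" if "p \<in> cball 0 R" for p
      using that m(2)[OF e1, of p] unfolding G_def by (meson order_trans)
    hence bdd: "bdd_below (G ` cball 0 R)" by (intro bdd_belowI2) auto
    let ?I = "Inf (G ` cball 0 R)"
    have ne: "G ` cball 0 R \<noteq> {}" 
    proof -
      have "p0 \<in> cball 0 R" using inside(1) by (simp add: dist_norm)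
      thus ?thesis by blast
    qed
    have "\<exists>q\<in>cball 0 R. G q < ?I + 1 / real (Suc n)" for n
      using cInf_lessD[OF ne, of "?I + 1 / real (Suc n)"] by auto
    then obtain q where q: "\<And>n. q n \<in> cball 0 R" "\<And>n. G (q n) < ?I + 1 / real (Suc n)" by metis
    then obtain p r where p: "p \<in> cball 0 R" "strict_mono r" "(q \<circ> r) \<longlonglongrightarrow> p"
      using compact_cball[of "0::'a" R] unfolding compact_def by meson
    have "(\<lambda>n. ?I + 1 / real (Suc n)) \<longlonglongrightarrow> ?I + 0"
      by (intro tendsto_intros LIMSEQ_Suc[OF lim_1_over_n])
    from LIMSEQ_subseq_LIMSEQ[OF this p(2)]
    have lim: "(\<lambda>n. ?I + 1 / real (Suc (r n))) \<longlonglongrightarrow> ?I" by (simp add: comp_def)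
    \<comment> \<open>Lower semicontinuity of G is enough here: the fixed direction
      \<open>m p\<close> gives a lower bound for G along the minimising sequence, and F in that
      direction is continuous.\<close>
    have "(\<lambda>n. (q (r n), m p)) \<longlonglongrightarrow> (p, m p)"
      using p(3) by (intro tendsto_Pair tendsto_const) (simp add: comp_def)
    hence "(\<lambda>n. F (q (r n)) (m p)) \<longlonglongrightarrow> F p (m p)"
      using continuous_on_tendsto_compose[OF cont] by fastforce
    moreover have "F (q (r n)) (m p) \<le> ?I + 1 / real (Suc (r n))" for n
      using m(2)[OF m(1)[of p], of "q (r n)"] q(2)[of "r n"] unfolding G_def by linarith
    ultimately have "F p (m p) \<le> ?I" by (intro LIMSEQ_le[OF _ lim]) auto
    hence "G p \<le> ?I" by (simp add: G_def)
    hence "G p \<le> G p'" if "norm p' \<le> R" for p'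
      using cInf_lower[OF _ bdd, of "G p'"] that by (force simp: dist_norm)
    thus ?thesis using that p(1) by (auto simp: dist_norm)
  qed
  have glob: "G p \<le> G p'" for p'
    using p(2)[of p'] p(2)[OF inside(1)] out[of p'] B0 by linarith
  let ?U = "{u. norm u = 1 \<and> F p u = G p}"
  have contp: "continuous_on A (F p)" for A
    using continuous_on_compose2[OF cont, of A "\<lambda>u. (p, u)"] by (simp add: continuous_intros)
  have clU: "compact ?U"
  proof -
    have "?U = ?S \<inter> F p -` {G p}" by (auto simp: dist_norm)
    moreover have "closed (F p -` {G p})"
      using continuous_closed_vimage[OF _ , of "{G p}" "F p"] contp[of UNIV] by (simp add: continuous_on_eq_continuous_at)
    ultimately show ?thesis by (simp add: compact_Int_closed)
  qed
  have "0 \<in> convex hull ?U"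
  proof (rule ccontr)
    assume "0 \<notin> convex hull ?U"
    moreover have "closed (convex hull ?U)" using clU compact_convex_hull compact_imp_closed by blast
    ultimately obtain w b where "0 < b" and wb: "\<forall>x\<in>convex hull ?U. w \<bullet> x > b"
      using separating_hyperplane_closed_0[OF convex_convex_hull] by metis
    hence w: "w \<bullet> u > 0" if "u \<in> ?U" for u
      using hull_inc[OF that, of convex] by fastforce
    define q where "q n = p + (1 / real (Suc n)) *\<^sub>R w" for n
    have q: "q \<longlonglongrightarrow> p"
    proof -
      have "(\<lambda>n. p + (1 / real (Suc n)) *\<^sub>R w) \<longlonglongrightarrow> p + 0 *\<^sub>R w"
        by (intro tendsto_intros LIMSEQ_Suc[OF lim_1_over_n])
      thus ?thesis by (simp add: q_def[abs_def])
    qed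
    \<comment> \<open>The maximisers at the shifted points accumulate at a maximiser
      \<open>u\<close> for \<open>p\<close>. There w has positive inner product with
      \<open>u\<close>, hence eventually also with the maximisers at the shifted points, and the
      shift has lowered the value in exactly those directions.\<close>
    have "\<forall>n. m (q n) \<in> ?S" using m by (simp add: dist_norm)
    then obtain u r where u: "u \<in> ?S" "strict_mono r" "((\<lambda>n. m (q n)) \<circ> r) \<longlonglongrightarrow> u"
      using compact_sphere[of "0::'a" 1] unfolding compact_def by meson
    have "(\<lambda>n. (q (r n), m (q (r n)))) \<longlonglongrightarrow> (p, u)"
      using u(3) LIMSEQ_subseq_LIMSEQ[OF q u(2)] by (intro tendsto_Pair) (auto simp: comp_def)
    hence lim: "(\<lambda>n. F (q (r n)) (m (q (r n)))) \<longlonglongrightarrow> F p u"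
      using continuous_on_tendsto_compose[OF cont] by fastforce
    have "G p \<le> F p u"
      by (rule LIMSEQ_le_const[OF lim]) (use glob in \<open>auto simp: G_def\<close>)
    hence "u \<in> ?U" using m(2)[of u p] u(1) by (auto simp: G_def dist_norm)
    hence "w \<bullet> u > 0" by (rule w)
    moreover have "(\<lambda>n. w \<bullet> m (q (r n))) \<longlonglongrightarrow> w \<bullet> u"
      using u(3) by (intro tendsto_intros) (simp add: comp_def)
    ultimately have "\<forall>\<^sub>F n in sequentially. w \<bullet> m (q (r n)) > 0" by (simp add: order_tendstoD)
    then obtain n where n: "w \<bullet> m (q (r n)) > 0" by (auto dest: eventually_happens)
    have "F (q (r n)) (m (q (r n))) < F p (m (q (r n)))"
      unfolding q_def by (rule mono) (use m n in \<open>auto simp: inner_commute q_def\<close>)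
    also have "\<dots> \<le> G p" using m by (simp add: G_def)
    finally show False using glob[of "q (r n)"] by (simp add: G_def)
  qed
  thus ?thesis using p(1) m(2)[of _ p] unfolding G_def by blast
qed

definition sign_balance :: "('v \<Rightarrow> real^2) \<Rightarrow> 'v set \<Rightarrow> real^2 \<Rightarrow> real^2 \<Rightarrow> real" where
  "sign_balance x V p u = (\<Sum>v\<in>V. sgn (u \<bullet> (x v - p))) / 2"

text \<open>Repetitions among the three vectors and zero weights are allowed, so hulls of one or two
  vectors fit the same form.\<close>

lemma caratheodory_plane:
  fixes U :: "(real^2) set"
  assumes "0 \<in> convex hull U"
  shows "\<exists>a b c \<alpha> \<beta> \<gamma>. a \<in> U \<and> b \<in> U \<and> c \<in> U \<and> \<alpha> \<ge> 0 \<and> \<beta> \<ge> 0 \<and> \<gamma> \<ge> 0 \<and> \<alpha> + \<beta> + \<gamma> = (1::real)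
    \<and> \<alpha> *\<^sub>R a + \<beta> *\<^sub>R b + \<gamma> *\<^sub>R c = 0"
proof -
  from assms obtain S where S: "finite S" "S \<subseteq> U" "card S \<le> 3" "0 \<in> convex hull S"
    by (auto simp: caratheodory[of U])
  hence "S \<noteq> {}" by auto
  then obtain a where a: "a \<in> S" by blast
  have "\<exists>b c. b \<in> S \<and> c \<in> S \<and> S \<subseteq> {a,b,c}"
  proof -
    have "card (S - {a}) \<le> 2" using S a by simp
    then consider "card (S - {a}) = 0" | "card (S - {a}) = 1" | "card (S - {a}) = 2" by linarith
    thus ?thesis
    proof cases
      case 1
      have "finite (S - {a})" using S(1) by simp
      hence "S - {a} = {}" using 1 by (simp only: card_0_eq)
      hence "S \<subseteq> {a,a,a}" by blast
      thus ?thesis using a by blast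
    next
      case 2
      from card_1_singletonE[OF this] obtain b where "S - {a} = {b}" .
      hence "b \<in> S" "S \<subseteq> {a,b,b}" by blast+
      thus ?thesis by blast
    next
      case 3
      then obtain b c where "S - {a} = {b,c}" unfolding card_2_iff by blast
      hence "b \<in> S" "c \<in> S" "S \<subseteq> {a,b,c}" by blast+
      thus ?thesis by blast
    qed
  qed
  then obtain b c where bc: "b \<in> S" "c \<in> S" "S \<subseteq> {a,b,c}" by blast
  have "0 \<in> convex hull {a,b,c}" using S(4) hull_mono[OF bc(3), of convex] by blast
  then obtain \<alpha> \<beta> \<gamma> where h: "0 \<le> \<alpha> \<and> 0 \<le> \<beta> \<and> 0 \<le> \<gamma> \<and> \<alpha> + \<beta> + \<gamma> = 1" "0 = \<alpha> *\<^sub>R a + \<beta> *\<^sub>R b + \<gamma> *\<^sub>R c"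
    unfolding convex_hull_3 by blast
  have "a \<in> U" "b \<in> U" "c \<in> U" using a bc S(2) by blast+
  with h show ?thesis by metis
qed

lemma tendsto_arctan_scaled:
  assumes "a \<longlonglongrightarrow> A" "A \<noteq> 0" "\<sigma> \<longlonglongrightarrow> 0" "\<And>n. \<sigma> n > (0::real)"
  shows "(\<lambda>n. arctan (a n / \<sigma> n) / pi) \<longlonglongrightarrow> sgn A / 2"
proof -
  have inv: "filterlim (\<lambda>n. inverse (\<sigma> n)) at_top sequentially"
    by (rule filterlim_inverse_at_top[OF assms(3)]) (simp add: assms(4))
  show ?thesis
  proof (cases "A > 0")
    case True
    have "filterlim (\<lambda>n. a n / \<sigma> n) at_top sequentially"
      unfolding divide_inverse by (rule filterlim_tendsto_pos_mult_at_top[OF assms(1) True inv])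
    from filterlim_compose[OF tendsto_arctan_at_top this]
    have "(\<lambda>n. arctan (a n / \<sigma> n) / pi) \<longlonglongrightarrow> pi / 2 / pi"
      by (rule tendsto_divide[OF _ tendsto_const]) simp
    moreover have "pi / 2 / pi = sgn A / 2" using True by simp
    ultimately show ?thesis by (simp only:)
  next
    case False
    hence A: "A < 0" using assms(2) by simp
    have "filterlim (\<lambda>n. a n / \<sigma> n) at_bot sequentially"
      unfolding divide_inverse by (rule filterlim_tendsto_neg_mult_at_bot[OF assms(1) A inv])
    from filterlim_compose[OF tendsto_arctan_at_bot this]
    have "(\<lambda>n. arctan (a n / \<sigma> n) / pi) \<longlonglongrightarrow> - (pi / 2) / pi"
      by (rule tendsto_divide[OF _ tendsto_const]) simp
    moreover have "- (pi / 2) / pi = sgn A / 2" using A by simp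
    ultimately show ?thesis by (simp only:)
  qed
qed

text \<open>Off the limit line the terms converge to half signs. On it they need not converge, but
  there are at most two of them, each of size at most 1/2; this is the slack of 1.\<close>

lemma smooth_balance_limit:
  assumes "finite V" "u \<longlonglongrightarrow> U" "p \<longlonglongrightarrow> P" "\<sigma> \<longlonglongrightarrow> 0" "\<And>n. \<sigma> n > 0"
    and c: "card {v\<in>V. U \<bullet> (x v - P) = 0} \<le> 2"
    and D: "(\<lambda>n. D n) \<longlonglongrightarrow> D0"
  shows "(\<And>n. smooth_balance x V (\<sigma> n) (p n) (u n) \<le> D n) \<Longrightarrow> sign_balance x V P U \<le> D0 + 1"
    and "(\<And>n. smooth_balance x V (\<sigma> n) (p n) (u n) \<ge> D n) \<Longrightarrow> sign_balance x V P U \<ge> D0 - 1"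
proof -
  let ?Z = "{v\<in>V. U \<bullet> (x v - P) = 0}" and ?N = "{v\<in>V. U \<bullet> (x v - P) \<noteq> 0}"
  let ?h = "\<lambda>n v. arctan (u n \<bullet> (x v - p n) / \<sigma> n) / pi"
  have split: "(\<Sum>v\<in>V. f v) = (\<Sum>v\<in>?N. f v) + (\<Sum>v\<in>?Z. f v)" for f :: "_ \<Rightarrow> real"
  proof -
    have "sum f (?N \<union> ?Z) = sum f ?N + sum f ?Z" using assms(1) by (intro sum.union_disjoint) auto
    moreover have "?N \<union> ?Z = V" by auto
    ultimately show ?thesis by simp
  qed
  have "sign_balance x V P U = (\<Sum>v\<in>?N. sgn (U \<bullet> (x v - P)) / 2)"
    unfolding sign_balance_def split[of "\<lambda>v. sgn (U \<bullet> (x v - P))"] by (simp add: sum_divide_distrib)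
  moreover have lim: "(\<lambda>n. \<Sum>v\<in>?N. ?h n v) \<longlonglongrightarrow> (\<Sum>v\<in>?N. sgn (U \<bullet> (x v - P)) / 2)"
  proof (rule tendsto_sum)
    fix v assume v: "v \<in> ?N"
    have "(\<lambda>n. u n \<bullet> (x v - p n)) \<longlonglongrightarrow> U \<bullet> (x v - P)"
      by (rule tendsto_inner[OF assms(2) tendsto_diff[OF tendsto_const assms(3)]])
    thus "(\<lambda>n. ?h n v) \<longlonglongrightarrow> sgn (U \<bullet> (x v - P)) / 2"
      using v assms(4,5) by (intro tendsto_arctan_scaled) auto
  qed
  ultimately have lim: "(\<lambda>n. \<Sum>v\<in>?N. ?h n v) \<longlonglongrightarrow> sign_balance x V P U" by simp
  have bnd: "\<bar>?h n v\<bar> \<le> 1/2" for n v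
    using arctan_bounded[of "u n \<bullet> (x v - p n) / \<sigma> n"] by (simp add: abs_if field_simps)
  have Z: "\<bar>\<Sum>v\<in>?Z. ?h n v\<bar> \<le> 1" for n
  proof -
    have "\<bar>\<Sum>v\<in>?Z. ?h n v\<bar> \<le> (\<Sum>v\<in>?Z. \<bar>?h n v\<bar>)" by (rule sum_abs)
    also have "\<dots> \<le> (\<Sum>v\<in>?Z. 1/2)" by (intro sum_mono bnd)
    also have "\<dots> \<le> 1" using c by simp
    finally show ?thesis .
  qed
  have Z1: "(\<Sum>v\<in>?Z. ?h n v) \<le> 1" and Z2: "- 1 \<le> (\<Sum>v\<in>?Z. ?h n v)" for n
    using abs_le_D1[OF Z[of n]] abs_le_D2[OF Z[of n]] by linarith+
  have eq: "smooth_balance x V (\<sigma> n) (p n) (u n) = (\<Sum>v\<in>?N. ?h n v) + (\<Sum>v\<in>?Z. ?h n v)" for n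
    unfolding smooth_balance_def by (rule split)
  {
    assume le: "\<And>n. smooth_balance x V (\<sigma> n) (p n) (u n) \<le> D n"
    have "(\<Sum>v\<in>?N. ?h n v) \<le> D n + 1" for n using Z2[of n] eq[of n] le[of n] by linarith
    thus "sign_balance x V P U \<le> D0 + 1"
      by (intro LIMSEQ_le[OF lim tendsto_add[OF D tendsto_const]]) auto
  }
  {
    assume ge: "\<And>n. smooth_balance x V (\<sigma> n) (p n) (u n) \<ge> D n"
    have "D n - 1 \<le> (\<Sum>v\<in>?N. ?h n v)" for n using Z1[of n] eq[of n] ge[of n] by linarith
    thus "sign_balance x V P U \<ge> D0 - 1"
      by (intro LIMSEQ_le[OF tendsto_diff[OF D tendsto_const] lim]) auto
  }
qed

text \<open>
  The sign function is smoothed to \<open>arctan (\<cdot> / \<sigma>) / pi\<close> because the step argument needs a continuous and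
  strictly monotone imbalance.
\<close>
lemma smooth_balanced_point:
  fixes x :: "'v \<Rightarrow> real^2"
  assumes V: "finite V" "V \<noteq> {}"
  shows "\<exists>R. \<forall>\<sigma>. 0 < \<sigma> \<and> \<sigma> \<le> 1 \<longrightarrow> (\<exists>p D. norm p \<le> R \<and> (\<forall>u. norm u = 1 \<longrightarrow> smooth_balance x V \<sigma> p u \<le> D) \<and>
     0 \<in> convex hull {u. norm u = 1 \<and> smooth_balance x V \<sigma> p u = D})"
proof -
  let ?n = "real (card V)"
  have n: "?n > 0" using V by (simp add: card_gt_0_iff)
  obtain v0 where v0: "v0 \<in> V" using V by blast
  define r where "r = (\<Sum>v\<in>V. norm (x v))"
  have r: "norm (x v) \<le> r" if "v \<in> V" for v
    unfolding r_def using member_le_sum[of v V "\<lambda>v. norm (x v)"] V that by auto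
  \<comment> \<open>The threshold (n - 1)/2 separates inside from outside: at a point of the set its
    own term vanishes and the others stay below 1/2, whereas far away some direction has a total
    close to n/2.\<close>
  have "((\<lambda>z. ?n * (arctan z / pi)) \<longlongrightarrow> ?n * (pi / 2 / pi)) at_top"
    by (intro tendsto_intros tendsto_arctan_at_top) auto
  hence "\<forall>\<^sub>F z in at_top. (?n - 1) / 2 < ?n * (arctan z / pi)"
    by (rule order_tendstoD) (use n in \<open>simp add: field_simps\<close>)
  then obtain s where s: "\<And>z. z \<ge> s \<Longrightarrow> (?n - 1) / 2 < ?n * (arctan z / pi)"
    unfolding eventually_at_top_linorder by blast
  \<comment> \<open>The radius does not depend on \<sigma>: division by \<sigma> \<le> 1 can only
    enlarge the nonnegative arguments. This uniformity allows the limit \<sigma> \<rightarrow> 0 to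
    be taken by compactness.\<close>
  define R where "R = r + max s 0"
  have half: "arctan z / pi < 1/2" for z using arctan_bounded[of z] by (simp add: field_simps)
  show ?thesis
  proof (intro exI[of _ R] allI impI, elim conjE)
    fix \<sigma> :: real assume \<sigma>: "0 < \<sigma>" "\<sigma> \<le> 1"
    show "\<exists>p D. norm p \<le> R \<and> (\<forall>u. norm u = 1 \<longrightarrow> smooth_balance x V \<sigma> p u \<le> D) \<and>
     0 \<in> convex hull {u. norm u = 1 \<and> smooth_balance x V \<sigma> p u = D}"
    proof (rule minimax_balanced_directions[where B = "(?n - 1)/2" and ?p0.0 = "x v0"])
      show "continuous_on UNIV (\<lambda>z. smooth_balance x V \<sigma> (fst z) (snd z))"
        unfolding smooth_balance_def using \<sigma> by (intro continuous_intros) auto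
      show "smooth_balance x V \<sigma> (p + w) u < smooth_balance x V \<sigma> p u" if "norm u = 1" "u \<bullet> w > 0" for p u w
        unfolding smooth_balance_def
      proof (rule sum_strict_mono[OF V])
        fix v assume "v \<in> V"
        have "u \<bullet> (x v - (p + w)) < u \<bullet> (x v - p)" using that by (simp add: inner_diff_right inner_add_right)
        hence "u \<bullet> (x v - (p + w)) / \<sigma> < u \<bullet> (x v - p) / \<sigma>" using \<sigma> by (simp add: divide_strict_right_mono)
        thus "arctan (u \<bullet> (x v - (p + w)) / \<sigma>) / pi < arctan (u \<bullet> (x v - p) / \<sigma>) / pi"
          by (simp add: divide_strict_right_mono arctan_less_iff del: divide_less_cancel)
      qed
      show "norm (x v0) \<le> R" using r[OF v0] by (simp add: R_def)
      show "smooth_balance x V \<sigma> (x v0) u \<le> (?n - 1) / 2" for u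
      proof -
        have "smooth_balance x V \<sigma> (x v0) u = (\<Sum>v\<in>V - {v0}. arctan (u \<bullet> (x v - x v0) / \<sigma>) / pi)"
          unfolding smooth_balance_def using V v0 by (subst sum.remove[of _ v0]) auto
        also have "\<dots> \<le> (\<Sum>v\<in>V - {v0}. 1/2)" by (intro sum_mono less_imp_le half)
        also have "\<dots> = (?n - 1) / 2" using V v0 by (simp add: of_nat_diff card_gt_0_iff Suc_leI)
        finally show ?thesis .
      qed
      show "\<exists>u. norm u = 1 \<and> smooth_balance x V \<sigma> p u > (?n - 1) / 2" if "norm p > R" for p
      proof (intro exI conjI)
        have p0: "norm p > 0" using that r[OF v0] norm_ge_zero[of "x v0"] max.cobounded2[of 0 s]
          unfolding R_def by linarith
        let ?u = "- (1 / norm p) *\<^sub>R p"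
        show "norm ?u = 1" using p0 by simp
        have ge: "?u \<bullet> (x v - p) / \<sigma> \<ge> max s 0" if v: "v \<in> V" for v
        proof -
          have "?u \<bullet> (x v - p) = norm p - (p \<bullet> x v) / norm p"
            using p0 by (simp add: inner_diff_right dot_square_norm power2_eq_square)
          moreover have "(p \<bullet> x v) / norm p \<le> norm (x v)"
            using norm_cauchy_schwarz[of p "x v"] p0 by (simp add: field_simps)
          ultimately have g: "?u \<bullet> (x v - p) \<ge> max s 0" using r[OF v] \<open>norm p > R\<close>
            unfolding R_def by linarith
          have "y \<le> y / \<sigma>" if "0 \<le> y" for y
            using \<sigma> that by (simp add: pos_le_divide_eq mult_left_le)
          from this[of "?u \<bullet> (x v - p)"] show ?thesis using g max.cobounded2[of 0 s] by linarith
        qed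
        have "(?n - 1) / 2 < ?n * (arctan (max s 0) / pi)" by (rule s) simp
        also have "\<dots> = (\<Sum>v\<in>V. arctan (max s 0) / pi)" by simp
        also have "\<dots> \<le> smooth_balance x V \<sigma> p ?u"
          unfolding smooth_balance_def by (intro sum_mono divide_right_mono arctan_monotone' ge) auto
        finally show "smooth_balance x V \<sigma> p ?u > (?n - 1) / 2" .
      qed
    qed
  qed
qed

text \<open>Limit \<sigma> \<rightarrow> 0 of the smooth minimax points. The upper and the lower
  estimate each lose 1, for the at most two points on a limit line.\<close>

lemma balanced_point_exists:
  fixes x :: "'v \<Rightarrow> real^2"
  assumes V: "finite V" "V \<noteq> {}"
    and gp: "\<And>p u. norm u = 1 \<Longrightarrow> card {v\<in>V. u \<bullet> (x v - p) = 0} \<le> 2"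
  shows "\<exists>p D a b c \<alpha> \<beta> \<gamma>. (\<forall>u. norm u = 1 \<longrightarrow> sign_balance x V p u \<le> D + 1) \<and>
     norm a = 1 \<and> norm b = 1 \<and> norm c = 1 \<and>
     sign_balance x V p a \<ge> D - 1 \<and> sign_balance x V p b \<ge> D - 1 \<and> sign_balance x V p c \<ge> D - 1 \<and>
     \<alpha> \<ge> 0 \<and> \<beta> \<ge> 0 \<and> \<gamma> \<ge> 0 \<and> \<alpha> + \<beta> + \<gamma> = (1::real) \<and> \<alpha> *\<^sub>R a + \<beta> *\<^sub>R b + \<gamma> *\<^sub>R c = 0"
proof -
  obtain R where R: "\<And>\<sigma>. 0 < \<sigma> \<and> \<sigma> \<le> 1 \<Longrightarrow> (\<exists>p D. norm p \<le> R \<and> (\<forall>u. norm u = 1 \<longrightarrow> smooth_balance x V \<sigma> p u \<le> D) \<and>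
     0 \<in> convex hull {u. norm u = 1 \<and> smooth_balance x V \<sigma> p u = D})"
    using smooth_balanced_point[OF V, of x] by meson
  define \<sigma> where "\<sigma> n = 1 / real (Suc n)" for n
  have \<sigma>: "0 < \<sigma> n \<and> \<sigma> n \<le> 1" for n by (simp add: \<sigma>_def)
  have \<sigma>0: "\<sigma> \<longlonglongrightarrow> 0" unfolding \<sigma>_def[abs_def] by (rule LIMSEQ_Suc[OF lim_1_over_n])
  \<comment> \<open>Point, value, directions and weights are bundled into one tuple ranging over a
    bounded set, so one subsequence makes all of them converge.\<close>
  let ?Q = "\<lambda>n (p, D, a, b, c, \<alpha>, \<beta>, \<gamma>). norm p \<le> R \<and> (\<forall>u. norm u = 1 \<longrightarrow> smooth_balance x V (\<sigma> n) p u \<le> D) \<and>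
      norm a = 1 \<and> norm b = 1 \<and> norm c = 1 \<and> smooth_balance x V (\<sigma> n) p a = D \<and> smooth_balance x V (\<sigma> n) p b = D \<and>
      smooth_balance x V (\<sigma> n) p c = D \<and> \<alpha> \<ge> 0 \<and> \<beta> \<ge> 0 \<and> \<gamma> \<ge> 0 \<and> \<alpha> + \<beta> + \<gamma> = (1::real) \<and> \<alpha> *\<^sub>R a + \<beta> *\<^sub>R b + \<gamma> *\<^sub>R c = 0"
  have "\<forall>n. \<exists>z. ?Q n z"
  proof
    fix n
    obtain p D where pD: "norm p \<le> R" "\<forall>u. norm u = 1 \<longrightarrow> smooth_balance x V (\<sigma> n) p u \<le> D"
      "0 \<in> convex hull {u. norm u = 1 \<and> smooth_balance x V (\<sigma> n) p u = D}"
      using R[OF \<sigma>[of n]] by blast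
    from caratheodory_plane[OF pD(3)] obtain a b c \<alpha> \<beta> \<gamma> where
      "a \<in> {u. norm u = 1 \<and> smooth_balance x V (\<sigma> n) p u = D}"
      "b \<in> {u. norm u = 1 \<and> smooth_balance x V (\<sigma> n) p u = D}"
      "c \<in> {u. norm u = 1 \<and> smooth_balance x V (\<sigma> n) p u = D}"
      "\<alpha> \<ge> 0 \<and> \<beta> \<ge> 0 \<and> \<gamma> \<ge> 0 \<and> \<alpha> + \<beta> + \<gamma> = (1::real) \<and> \<alpha> *\<^sub>R a + \<beta> *\<^sub>R b + \<gamma> *\<^sub>R c = 0"
      by blast
    hence "?Q n (p, D, a, b, c, \<alpha>, \<beta>, \<gamma>)" using pD by simp
    thus "\<exists>z. ?Q n z" by (rule exI)
  qed
  from choice[OF this] obtain z where z: "\<forall>n. ?Q n (z n)" by (rule exE)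
  define p D a b c \<alpha> \<beta> \<gamma> where zdefs: "p = (\<lambda>n. fst (z n))" "D = (\<lambda>n. fst (snd (z n)))"
    "a = (\<lambda>n. fst (snd (snd (z n))))" "b = (\<lambda>n. fst (snd (snd (snd (z n)))))" "c = (\<lambda>n. fst (snd (snd (snd (snd (z n))))))"
    "\<alpha> = (\<lambda>n. fst (snd (snd (snd (snd (snd (z n)))))))" "\<beta> = (\<lambda>n. fst (snd (snd (snd (snd (snd (snd (z n))))))))"
    "\<gamma> = (\<lambda>n. snd (snd (snd (snd (snd (snd (snd (z n))))))))"
  have zn: "z n = (p n, D n, a n, b n, c n, \<alpha> n, \<beta> n, \<gamma> n)" for n by (simp add: zdefs)
  have Q: "norm (p n) \<le> R" "\<And>u. norm u = 1 \<Longrightarrow> smooth_balance x V (\<sigma> n) (p n) u \<le> D n"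
      "norm (a n) = 1" "norm (b n) = 1" "norm (c n) = 1" "smooth_balance x V (\<sigma> n) (p n) (a n) = D n"
      "smooth_balance x V (\<sigma> n) (p n) (b n) = D n" "smooth_balance x V (\<sigma> n) (p n) (c n) = D n"
      "\<alpha> n \<ge> 0" "\<beta> n \<ge> 0" "\<gamma> n \<ge> 0" "\<alpha> n + \<beta> n + \<gamma> n = 1" "\<alpha> n *\<^sub>R a n + \<beta> n *\<^sub>R b n + \<gamma> n *\<^sub>R c n = 0" for n
    using z[rule_format, of n] unfolding zn by simp_all
  have Db: "\<bar>D n\<bar> \<le> real (card V)" for n
  proof -
    have "\<bar>D n\<bar> \<le> (\<Sum>v\<in>V. \<bar>arctan (a n \<bullet> (x v - p n) / \<sigma> n) / pi\<bar>)"
      unfolding Q(6)[symmetric] smooth_balance_def by (rule sum_abs)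
    also have "\<dots> \<le> (\<Sum>v\<in>V. 1)"
    proof (rule sum_mono)
      fix v
      show "\<bar>arctan (a n \<bullet> (x v - p n) / \<sigma> n) / pi\<bar> \<le> 1"
        using arctan_bounded[of "a n \<bullet> (x v - p n) / \<sigma> n"] by (simp add: abs_if field_simps)
    qed
    finally show ?thesis by simp
  qed
  have "bounded (range z)"
  proof -
    have "range z \<subseteq> cball 0 R \<times> {- real (card V)..real (card V)} \<times> cball 0 1 \<times> cball 0 1 \<times> cball 0 1 \<times> {0..1} \<times> {0..1} \<times> {0..1}"
    proof (rule image_subsetI)
      fix n
      have "\<alpha> n \<le> 1" "\<beta> n \<le> 1" "\<gamma> n \<le> 1" using Q(9-12)[of n] by linarith+
      thus "z n \<in> cball 0 R \<times> {- real (card V)..real (card V)} \<times> cball 0 1 \<times> cball 0 1 \<times> cball 0 1 \<times> {0..1} \<times> {0..1} \<times> {0..1}"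
        using Q(1,3-5,9-11)[of n] Db[of n] by (simp add: zn dist_norm abs_le_iff minus_le_iff)
    qed
    moreover have "bounded \<dots>" by (intro bounded_Times bounded_cball bounded_closed_interval)
    ultimately show ?thesis using bounded_subset by blast
  qed
  then obtain l r where r: "strict_mono r" and lim: "(z \<circ> r) \<longlonglongrightarrow> l"
    using bounded_imp_convergent_subsequence by blast
  obtain p' D' a' b' c' \<alpha>' \<beta>' \<gamma>' where l: "l = (p',D',a',b',c',\<alpha>',\<beta>',\<gamma>')" by (cases l) auto
  have lims: "(p \<circ> r) \<longlonglongrightarrow> p'" "(D \<circ> r) \<longlonglongrightarrow> D'" "(a \<circ> r) \<longlonglongrightarrow> a'" "(b \<circ> r) \<longlonglongrightarrow> b'" "(c \<circ> r) \<longlonglongrightarrow> c'"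
    "(\<alpha> \<circ> r) \<longlonglongrightarrow> \<alpha>'" "(\<beta> \<circ> r) \<longlonglongrightarrow> \<beta>'" "(\<gamma> \<circ> r) \<longlonglongrightarrow> \<gamma>'"
    using tendsto_fst[OF lim] tendsto_fst[OF tendsto_snd[OF lim]] tendsto_fst[OF tendsto_snd[OF tendsto_snd[OF lim]]]
      tendsto_fst[OF tendsto_snd[OF tendsto_snd[OF tendsto_snd[OF lim]]]]
      tendsto_fst[OF tendsto_snd[OF tendsto_snd[OF tendsto_snd[OF tendsto_snd[OF lim]]]]]
      tendsto_fst[OF tendsto_snd[OF tendsto_snd[OF tendsto_snd[OF tendsto_snd[OF tendsto_snd[OF lim]]]]]]
      tendsto_fst[OF tendsto_snd[OF tendsto_snd[OF tendsto_snd[OF tendsto_snd[OF tendsto_snd[OF tendsto_snd[OF lim]]]]]]]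
      tendsto_snd[OF tendsto_snd[OF tendsto_snd[OF tendsto_snd[OF tendsto_snd[OF tendsto_snd[OF tendsto_snd[OF lim]]]]]]]
    unfolding l by (simp_all add: comp_def zn)
  have s0: "(\<sigma> \<circ> r) \<longlonglongrightarrow> 0" using LIMSEQ_subseq_LIMSEQ[OF \<sigma>0 r] .
  have n1: "norm a' = 1" "norm b' = 1" "norm c' = 1"
    using tendsto_norm[OF lims(3)] tendsto_norm[OF lims(4)] tendsto_norm[OF lims(5)] Q(3-5)
    by (simp_all add: comp_def LIMSEQ_const_iff)
  have up: "sign_balance x V p' u \<le> D' + 1" if "norm u = 1" for u
    using smooth_balance_limit(1)[OF V(1) tendsto_const[of u] lims(1) s0 _ gp[OF that] lims(2)] \<sigma> Q(2)[OF that] by simp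
  have lo: "sign_balance x V p' a' \<ge> D' - 1" "sign_balance x V p' b' \<ge> D' - 1" "sign_balance x V p' c' \<ge> D' - 1"
    using smooth_balance_limit(2)[OF V(1) lims(3) lims(1) s0 _ gp[OF n1(1)] lims(2)]
      smooth_balance_limit(2)[OF V(1) lims(4) lims(1) s0 _ gp[OF n1(2)] lims(2)]
      smooth_balance_limit(2)[OF V(1) lims(5) lims(1) s0 _ gp[OF n1(3)] lims(2)] \<sigma> Q(6-8) by simp_all
  have pos: "\<alpha>' \<ge> 0" "\<beta>' \<ge> 0" "\<gamma>' \<ge> 0"
    by (rule LIMSEQ_le_const[OF lims(6)], use Q(9) in simp, rule LIMSEQ_le_const[OF lims(7)], use Q(10) in simp,
        rule LIMSEQ_le_const[OF lims(8)], use Q(11) in simp)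
  have "(\<lambda>n. (\<alpha> \<circ> r) n + (\<beta> \<circ> r) n + (\<gamma> \<circ> r) n) \<longlonglongrightarrow> \<alpha>' + \<beta>' + \<gamma>'" by (intro tendsto_intros lims)
  hence s1: "\<alpha>' + \<beta>' + \<gamma>' = 1" using Q(12) by (simp add: comp_def LIMSEQ_const_iff)
  have "(\<lambda>n. (\<alpha> \<circ> r) n *\<^sub>R (a \<circ> r) n + (\<beta> \<circ> r) n *\<^sub>R (b \<circ> r) n + (\<gamma> \<circ> r) n *\<^sub>R (c \<circ> r) n) \<longlonglongrightarrow> \<alpha>' *\<^sub>R a' + \<beta>' *\<^sub>R b' + \<gamma>' *\<^sub>R c'"
    by (intro tendsto_intros lims)
  hence z0: "\<alpha>' *\<^sub>R a' + \<beta>' *\<^sub>R b' + \<gamma>' *\<^sub>R c' = 0" using Q(13) by (simp add: comp_def LIMSEQ_const_iff)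
  show ?thesis
    by (rule exI[of _ p'], rule exI[of _ D'], rule exI[of _ a'], rule exI[of _ b'], rule exI[of _ c'],
        rule exI[of _ \<alpha>'], rule exI[of _ \<beta>'], rule exI[of _ \<gamma>']) (use up n1 lo pos s1 z0 in simp)
qed

section \<open>Sign walks and cyclic triples\<close>

text \<open>Half the signed count for a line through p whose angle lies between those of the points
  with indices i - 1 and i. Halving makes the steps equal to 1; turning by pi gives the same line
  with reversed normal, whence W_n = - W_0.\<close>

definition walk :: "(nat \<Rightarrow> real) \<Rightarrow> nat \<Rightarrow> nat \<Rightarrow> real" where
  "walk s n i = ((\<Sum>j\<in>{i..<n}. s j) - (\<Sum>j<i. s j)) / 2"

lemma walk_Suc: "i < n \<Longrightarrow> walk s n (Suc i) = walk s n i - s i"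
  by (simp add: walk_def sum.atLeast_Suc_lessThan diff_divide_distrib add_divide_distrib)

lemma walk_end: "walk s n n = - walk s n 0"
  by (simp add: walk_def atLeast0LessThan)

lemma abs_walk_le:
  assumes "\<And>i. i < n \<Longrightarrow> \<bar>s i\<bar> = 1" "i \<le> n"
  shows "\<bar>walk s n i\<bar> \<le> real n / 2"
proof -
  have "\<bar>\<Sum>j\<in>{i..<n}. s j\<bar> \<le> (\<Sum>j\<in>{i..<n}. 1)"
    by (rule order_trans[OF sum_abs]) (use assms in \<open>auto intro!: sum_mono\<close>)
  moreover have "\<bar>\<Sum>j<i. s j\<bar> \<le> (\<Sum>j<i. 1)"
    by (rule order_trans[OF sum_abs]) (use assms in \<open>auto intro!: sum_mono\<close>)
  ultimately have "\<bar>\<Sum>j\<in>{i..<n}. s j\<bar> + \<bar>\<Sum>j<i. s j\<bar> \<le> real n" using assms(2) by (simp add: of_nat_diff)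
  moreover have "\<bar>(\<Sum>j\<in>{i..<n}. s j) - (\<Sum>j<i. s j)\<bar> \<le> \<bar>\<Sum>j\<in>{i..<n}. s j\<bar> + \<bar>\<Sum>j<i. s j\<bar>"
    by (rule abs_triangle_ineq4)
  ultimately show ?thesis unfolding walk_def by simp
qed

section \<open>Energy of a walk confined to a strip\<close>

definition potential :: "real \<Rightarrow> real \<Rightarrow> real" where
  "potential D w = D\<^sup>2 * w - w ^ 3 / 3"

lemma potential_minus: "potential D (- w) = - potential D w"
  by (simp add: potential_def power3_eq_cube)

lemma potential_mono:
  assumes "- D \<le> v" "v \<le> w" "w \<le> D"
  shows "potential D v \<le> potential D w"
proof -
  have D: "D \<ge> 0" using assms by linarith
  have v2: "v\<^sup>2 \<le> D\<^sup>2" and w2: "w\<^sup>2 \<le> D\<^sup>2" using assms D by (auto intro!: power2_le_iff_abs_le[THEN iffD2])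
  have "2 * (w * v) \<le> w\<^sup>2 + v\<^sup>2" using sum_squares_bound[of w v] by simp
  hence "0 \<le> D\<^sup>2 - (w\<^sup>2 + w * v + v\<^sup>2) / 3" using v2 w2 by simp
  hence "0 \<le> (w - v) * (D\<^sup>2 - (w\<^sup>2 + w * v + v\<^sup>2) / 3)" using assms by simp
  also have "\<dots> = potential D w - potential D v"
    by (simp add: potential_def field_simps power2_eq_square power3_eq_cube)
  finally show ?thesis by simp
qed

lemma potential_step:
  assumes "\<bar>s\<bar> = 1" "\<bar>w\<bar> \<le> D"
  shows "\<bar>potential D (w - s) - potential D w\<bar> \<le> D\<^sup>2 - w\<^sup>2 + D + 1"
proof -
  have w2: "w\<^sup>2 \<le> D\<^sup>2" using assms by (intro power2_le_iff_abs_le[THEN iffD2]) auto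
  have s: "s = 1 \<or> s = -1" using assms(1) by (auto simp: abs_if split: if_splits)
  have "potential D (w - s) - potential D w = - s * (D\<^sup>2 - w\<^sup>2) - w + s / 3"
    using s by (auto simp: potential_def field_simps power2_eq_square power3_eq_cube)
  thus ?thesis using s w2 assms(2) by (auto simp: abs_le_iff)
qed

lemma sum_variation_ge:
  fixes g :: "nat \<Rightarrow> real"
  assumes "a \<le> b"
  shows "\<bar>g b - g a\<bar> \<le> (\<Sum>i\<in>{a..<b}. \<bar>g (Suc i) - g i\<bar>)"
proof -
  have "(\<Sum>i\<in>{a..<b}. g (Suc i) - g i) = g b - g a" using assms by (rule sum_Suc_diff')
  thus ?thesis using sum_abs[of "\<lambda>i. g (Suc i) - g i" "{a..<b}"] by simp
qed

text \<open>
  The potential has derivative \<open>D\<^sup>2 - w\<^sup>2\<close>, so its total variation along the walk is at most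
  \<open>\<Sum>(D\<^sup>2 - W\<^sup>2)\<close> up to lower order terms, while each of the three crossings of the strip contributes
  \<open>4 D\<^sup>3 / 3\<close>. The third crossing wraps around, since the walk over a full turn changes sign.
\<close>
lemma walk_sum_squares_le:
  assumes s: "\<And>i. i < n \<Longrightarrow> \<bar>s i\<bar> = 1"
    and D: "\<And>i. i \<le> n \<Longrightarrow> \<bar>walk s n i\<bar> \<le> D"
    and tight: "D < 4 \<or> (\<exists>i1 i2 i3 e. i1 \<le> i2 \<and> i2 \<le> i3 \<and> i3 \<le> n \<and> \<bar>e\<bar> = 1 \<and>
        e * walk s n i1 \<ge> D - 4 \<and> - e * walk s n i2 \<ge> D - 4 \<and> e * walk s n i3 \<ge> D - 4)"
  shows "(\<Sum>i<n. (walk s n i)\<^sup>2) \<le> real n ^ 3 / 108 + 500 * (real n)\<^sup>2"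
proof (cases "n = 0")
  case False
  hence n1: "real n \<ge> 1" by simp
  hence nn: "real n \<le> (real n)\<^sup>2" "1 \<le> (real n)\<^sup>2"
    using self_le_power[of "real n" 2] one_le_power[of "real n" 2] by auto
  show ?thesis
  proof (cases "D < 4")
    case True
    have "(\<Sum>i<n. (walk s n i)\<^sup>2) \<le> (\<Sum>i<n. 4\<^sup>2)"
    proof (rule sum_mono)
      fix i assume "i \<in> {..<n}"
      hence "\<bar>walk s n i\<bar> \<le> 4" using D[of i] True by simp
      thus "(walk s n i)\<^sup>2 \<le> 4\<^sup>2" by (intro power2_le_iff_abs_le[THEN iffD2]) auto
    qed
    also have "\<dots> = 16 * real n" by simp
    moreover have "0 \<le> real n ^ 3 / 108" by simp
    ultimately show ?thesis using nn by linarith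
  next
    case False
    then obtain i1 i2 i3 e where i: "i1 \<le> i2" "i2 \<le> i3" "i3 \<le> n" and e: "\<bar>e\<bar> = 1"
      and t: "e * walk s n i1 \<ge> D - 4" "- e * walk s n i2 \<ge> D - 4" "e * walk s n i3 \<ge> D - 4"
      using tight by blast
    define g where "g i = potential D (e * walk s n i)" for i
    have e': "e = 1 \<or> e = -1" using e by (auto simp: abs_if split: if_splits)
    have bd: "- D \<le> e * walk s n i" "e * walk s n i \<le> D" if "i \<le> n" for i
      using D[OF that] e' by (auto simp: abs_le_iff)
    \<comment> \<open>D is a critical point of the potential, so stopping short of D by 4 costs only
      a term linear in D.\<close>
    have p4: "potential D (D - 4) \<ge> 2 * D ^ 3 / 3 - 16 * D"
      by (simp add: potential_def field_simps power2_eq_square power3_eq_cube)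
    have g1: "g i1 \<ge> potential D (D - 4)" "g i3 \<ge> potential D (D - 4)"
      unfolding g_def using False i by (intro potential_mono t bd; linarith)+
    have "potential D (- (e * walk s n i2)) \<ge> potential D (D - 4)"
      using False i t(2) bd[of i2] by (intro potential_mono) auto
    hence g2: "- g i2 \<ge> potential D (D - 4)" by (simp add: g_def potential_minus)
    have gn: "g n = - g 0" by (simp add: g_def walk_end potential_minus)
    let ?v = "\<lambda>i. \<bar>g (Suc i) - g i\<bar>"
    \<comment> \<open>Each of the three extreme values is used twice, and the values at both ends
      cancel by the sign change of the walk. Six extremes of size 2 D^3 / 3 give 4 D^3.\<close>
    have "6 * (2 * D ^ 3 / 3 - 16 * D) \<le> 6 * potential D (D - 4)" using p4 by simp
    also have "\<dots> \<le> (g i1 - g 0) + (g i1 - g i2) + (g i3 - g i2) + (g i3 - g n)" using g1 g2 gn by linarith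
    also have "\<dots> \<le> \<bar>g i1 - g 0\<bar> + \<bar>g i2 - g i1\<bar> + \<bar>g i3 - g i2\<bar> + \<bar>g n - g i3\<bar>" by linarith
    also have "\<dots> \<le> (\<Sum>i\<in>{0..<i1}. ?v i) + (\<Sum>i\<in>{i1..<i2}. ?v i) + (\<Sum>i\<in>{i2..<i3}. ?v i) + (\<Sum>i\<in>{i3..<n}. ?v i)"
      by (intro add_mono sum_variation_ge i) simp
    also have "\<dots> = (\<Sum>i\<in>{0..<n}. ?v i)"
      using i by (simp add: sum.atLeastLessThan_concat)
    also have "\<dots> \<le> (\<Sum>i<n. D\<^sup>2 - (walk s n i)\<^sup>2 + D + 1)"
      unfolding atLeast0LessThan
    proof (rule sum_mono)
      fix i assume "i \<in> {..<n}"
      hence il: "i < n" by simp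
      have "g (Suc i) = potential D (e * walk s n i - e * s i)" unfolding g_def walk_Suc[OF il] by (simp add: right_diff_distrib)
      moreover have "\<bar>e * s i\<bar> = 1" "\<bar>e * walk s n i\<bar> \<le> D" using e s[OF il] D[of i] il by (simp_all add: abs_mult)
      moreover have "(e * walk s n i)\<^sup>2 = (walk s n i)\<^sup>2" using e' by (auto simp: power_mult_distrib)
      ultimately show "?v i \<le> D\<^sup>2 - (walk s n i)\<^sup>2 + D + 1"
        using potential_step[of "e * s i" "e * walk s n i" D] by (simp add: g_def)
    qed
    also have "\<dots> = real n * D\<^sup>2 - (\<Sum>i<n. (walk s n i)\<^sup>2) + real n * (D + 1)"
      by (simp add: sum.distrib sum_subtractf algebra_simps)
    finally have 1: "(\<Sum>i<n. (walk s n i)\<^sup>2) \<le> real n * D\<^sup>2 - 4 * D ^ 3 + 96 * D + real n * (D + 1)"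
      by (simp add: algebra_simps)
    \<comment> \<open>The cubic n D^2 - 4 D^3 has its maximum n^3/108 at D = n/6; the product
      displays the double root there.\<close>
    have "0 \<le> (6 * D - real n)\<^sup>2 * (12 * D + real n)" using False by simp
    also have "\<dots> = real n ^ 3 - 108 * (real n * D\<^sup>2 - 4 * D ^ 3)"
      by (simp add: algebra_simps power2_eq_square power3_eq_cube)
    finally have 2: "real n * D\<^sup>2 - 4 * D ^ 3 \<le> real n ^ 3 / 108" by simp
    have Dn: "D \<le> real n / 2 + 4"
    proof -
      have "e * walk s n i1 \<le> \<bar>walk s n i1\<bar>" using e' by auto
      thus ?thesis using t(1) abs_walk_le[of n s i1, OF s] i by linarith
    qed
    have "real n * (D + 1) \<le> real n * (real n / 2 + 5)" using Dn by (intro mult_left_mono) auto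
    hence "96 * D + real n * (D + 1) \<le> (real n)\<^sup>2 / 2 + 53 * real n + 384"
      using Dn by (simp add: algebra_simps power2_eq_square)
    also have "\<dots> \<le> 500 * (real n)\<^sup>2" using nn by linarith
    finally show ?thesis using 1 2 by linarith
  qed
qed simp

text \<open>
  For three points listed by the angle modulo pi, cyclic orientation means alternating signs.
\<close>
definition orient :: "(nat \<Rightarrow> real) \<Rightarrow> nat \<Rightarrow> nat \<Rightarrow> real" where
  "orient s i j = s i * s j * sgn (real j - real i)"

lemma orient_antisym: "orient s j i = - orient s i j"
  by (simp add: orient_def sgn_if)

lemma orient_cases:
  assumes "\<bar>s i\<bar> = 1" "\<bar>s j\<bar> = 1" "i \<noteq> j"
  shows "orient s i j = 1 \<or> orient s i j = -1"
  using assms by (auto simp: orient_def sgn_if abs_if split: if_splits)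

text \<open>In the tournament given by \<open>orient\<close>, this is out-degree minus in-degree.
  The term -1 appears because the walk at \<open>i\<close> also counts the sign of \<open>i\<close>
  itself.\<close>

lemma sum_orient:
  assumes "i < n" "\<bar>s i\<bar> = 1"
  shows "(\<Sum>j<n. orient s i j) = 2 * s i * walk s n i - 1"
proof -
  have "{..<n} = {..<i} \<union> ({i} \<union> {Suc i..<n})" using assms by auto
  moreover have "{..<i} \<inter> {Suc i..<n} = {}" by auto
  ultimately have "(\<Sum>j<n. orient s i j) = (\<Sum>j<i. orient s i j) + (orient s i i + (\<Sum>j\<in>{Suc i..<n}. orient s i j))"
    by (simp add: sum.union_disjoint)
  also have "(\<Sum>j<i. orient s i j) = - s i * (\<Sum>j<i. s j)"
    unfolding sum_distrib_left by (intro sum.cong) (auto simp: orient_def sgn_if)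
  also have "(\<Sum>j\<in>{Suc i..<n}. orient s i j) = s i * (\<Sum>j\<in>{Suc i..<n}. s j)"
    unfolding sum_distrib_left by (intro sum.cong) (auto simp: orient_def sgn_if)
  also have "orient s i i = 0" by (simp add: orient_def)
  also have "(\<Sum>j\<in>{Suc i..<n}. s j) = (\<Sum>j\<in>{i..<n}. s j) - s i"
    using assms by (simp add: sum.atLeast_Suc_lessThan)
  finally show ?thesis using assms(2) by (auto simp: walk_def field_simps abs_if split: if_splits)
qed

definition cyclic :: "(nat \<Rightarrow> real) \<Rightarrow> nat \<Rightarrow> nat \<Rightarrow> nat \<Rightarrow> bool" where
  "cyclic s i j k \<longleftrightarrow> orient s i j \<noteq> 0 \<and> orient s i j = orient s j k \<and> orient s j k = orient s k i"

text \<open>Cyclic triples of a tournament are counted through its scores: summing products of two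
  orientations over a common vertex gives minus the sum of squared scores. Triples are ordered, so
  all quantities are six times those for sets.\<close>

lemma card_cyclic_ge:
  assumes s: "\<And>i. i < n \<Longrightarrow> \<bar>s i\<bar> = 1"
  shows "real (card {(i,j,k) \<in> cube {..<n}. cyclic s i j k})
     \<ge> real n ^ 3 / 4 - 3 * (\<Sum>i<n. (walk s n i)\<^sup>2) - 4 * (real n)\<^sup>2"
proof -
  let ?o = "orient s"
  let ?T = "cube {..<n}"
  \<comment> \<open>For distinct indices the right-hand side is exactly the indicator of being cyclic.\<close>
  have ind: "of_bool (cyclic s i j k) \<ge> (1 + ?o i j * ?o j k + ?o j k * ?o k i + ?o k i * ?o i j) / 4 - of_bool (i = j \<and> j = k)"
    if "i < n" "j < n" "k < n" for i j k
  proof -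
    have c: "?o i j = 1 \<or> ?o i j = -1" if "i \<noteq> j" "i < n" "j < n" for i j
      using orient_cases[of s i j] s that by blast
    have z: "?o i i = 0" for i by (simp add: orient_def)
    \<comment> \<open>If exactly two indices agree, one product is -1 and the other two vanish, so
      the expression is 0. Only the full diagonal, where it is 1/4, needs the correction.\<close>
    consider "i = j" "j = k" | "i = j" "j \<noteq> k" | "i \<noteq> j" "j = k" | "i \<noteq> j" "i = k" | "i \<noteq> j" "j \<noteq> k" "i \<noteq> k" by blast
    thus ?thesis
    proof cases
      case 1 thus ?thesis by (simp add: z)
    next
      case 2
      thus ?thesis using c[of j k] that orient_antisym[of s j k] by (auto simp: z)
    next
      case 3
      thus ?thesis using c[of i j] that orient_antisym[of s i j] by (auto simp: z)
    next
      case 4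
      thus ?thesis using c[of i j] that orient_antisym[of s i j] by (auto simp: z)
    next
      case 5
      thus ?thesis using c[of i j] c[of j k] c[of k i] that unfolding cyclic_def by auto
    qed
  qed
  let ?d = "\<lambda>i. \<Sum>j<n. ?o i j"
  have in_eq: "(\<Sum>i<n. ?o i j) = - ?d j" for j
    unfolding sum_negf[symmetric] by (intro sum.cong refl) (rule orient_antisym)
  have s1: "(\<Sum>i<n. \<Sum>j<n. \<Sum>k<n. ?o i j * ?o j k) = - (\<Sum>j<n. (?d j)\<^sup>2)"
  proof -
    have "(\<Sum>i<n. \<Sum>j<n. \<Sum>k<n. ?o i j * ?o j k) = (\<Sum>j<n. \<Sum>i<n. ?o i j * ?d j)"
      by (subst sum.swap) (simp add: sum_distrib_left)
    also have "\<dots> = (\<Sum>j<n. - ?d j * ?d j)" by (simp only: sum_distrib_right[symmetric] in_eq)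
    finally show ?thesis by (simp add: sum_negf power2_eq_square)
  qed
  have s2: "(\<Sum>i<n. \<Sum>j<n. \<Sum>k<n. ?o j k * ?o k i) = - (\<Sum>j<n. (?d j)\<^sup>2)"
  proof -
    have "(\<Sum>i<n. \<Sum>j<n. \<Sum>k<n. ?o j k * ?o k i) = (\<Sum>j<n. \<Sum>i<n. \<Sum>k<n. ?o j k * ?o k i)" by (rule sum.swap)
    also have "\<dots> = (\<Sum>j<n. \<Sum>k<n. \<Sum>i<n. ?o j k * ?o k i)" by (intro sum.cong refl sum.swap)
    finally show ?thesis using s1 by simp
  qed
  have s3: "(\<Sum>i<n. \<Sum>j<n. \<Sum>k<n. ?o k i * ?o i j) = - (\<Sum>j<n. (?d j)\<^sup>2)"
  proof -
    have "(\<Sum>i<n. \<Sum>j<n. \<Sum>k<n. ?o k i * ?o i j) = (\<Sum>i<n. \<Sum>k<n. \<Sum>j<n. ?o k i * ?o i j)" by (intro sum.cong refl sum.swap)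
    also have "\<dots> = (\<Sum>k<n. \<Sum>i<n. \<Sum>j<n. ?o k i * ?o i j)" by (rule sum.swap)
    finally show ?thesis using s1 by simp
  qed
  have diag: "(\<Sum>i<n. \<Sum>j<n. \<Sum>k<n. of_bool (i = j \<and> j = k)) = real n"
  proof -
    have "(\<Sum>j<n. \<Sum>k<n. of_bool (i = j \<and> j = k)) = (1::real)" if "i < n" for i
    proof -
      have "(\<Sum>k<n. of_bool (i = j \<and> j = k)) = (if j = i then 1 else 0 :: real)" if "j < n" for j
        using that by (cases "i = j") (simp_all add: of_bool_def sum.delta')
      thus ?thesis using that by (simp add: sum.delta)
    qed
    thus ?thesis by simp
  qed
  have d2: "(?d j)\<^sup>2 \<le> 4 * (walk s n j)\<^sup>2 + 2 * real n + 1" if "j < n" for j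
  proof -
    have sj: "s j = 1 \<or> s j = -1" using s[OF that] by (auto simp: abs_if split: if_splits)
    have "\<bar>walk s n j\<bar> \<le> real n / 2" using abs_walk_le[of n s j] s that by simp
    hence "-(real n / 2) \<le> walk s n j" "walk s n j \<le> real n / 2" by (simp_all only: abs_le_iff) linarith
    thus ?thesis unfolding sum_orient[of j n s, OF that s[OF that]] using sj
      by (auto simp: power2_eq_square algebra_simps)
  qed
  have "(\<Sum>j<n. (?d j)\<^sup>2) \<le> (\<Sum>j<n. 4 * (walk s n j)\<^sup>2 + 2 * real n + 1)" by (intro sum_mono d2) auto
  also have "\<dots> = 4 * (\<Sum>j<n. (walk s n j)\<^sup>2) + 2 * (real n)\<^sup>2 + real n"
    by (simp add: sum.distrib sum_distrib_left power2_eq_square algebra_simps)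
  finally have dd: "(\<Sum>j<n. (?d j)\<^sup>2) \<le> 4 * (\<Sum>j<n. (walk s n j)\<^sup>2) + 2 * (real n)\<^sup>2 + real n" .
  have arith: "c / 4 - 3 * W - 4 * m \<le> (c - 3 * S) / 4 - k" if "S \<le> 4 * W + 2 * m + k" "k \<le> m" "0 \<le> m"
    for S W m k c :: real using that by (simp add: field_simps)
  have nn: "real n \<le> (real n)\<^sup>2" by (cases n) (auto simp: power2_eq_square algebra_simps)
  have "real (card {(i,j,k) \<in> ?T. cyclic s i j k}) = (\<Sum>x\<in>?T. of_bool (case x of (i,j,k) \<Rightarrow> cyclic s i j k))"
    by (subst sum_of_bool_eq) (auto intro!: arg_cong[where f=card])
  also have "\<dots> = (\<Sum>i<n. \<Sum>j<n. \<Sum>k<n. of_bool (cyclic s i j k))"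
    unfolding sum.cartesian_product by (intro sum.cong refl) auto
  also have "\<dots> \<ge> (\<Sum>i<n. \<Sum>j<n. \<Sum>k<n. (1 + ?o i j * ?o j k + ?o j k * ?o k i + ?o k i * ?o i j) / 4 - of_bool (i = j \<and> j = k))"
    by (intro sum_mono ind) auto
  also have "(\<Sum>i<n. \<Sum>j<n. \<Sum>k<n. (1 + ?o i j * ?o j k + ?o j k * ?o k i + ?o k i * ?o i j) / 4 - of_bool (i = j \<and> j = k))
    = (real n ^ 3 - 3 * (\<Sum>j<n. (?d j)\<^sup>2)) / 4 - real n"
    unfolding sum_subtractf diag sum_divide_distrib[symmetric] sum.distrib s1 s2 s3
    by (simp add: power3_eq_cube)
  finally have "(real n ^ 3 - 3 * (\<Sum>j<n. (?d j)\<^sup>2)) / 4 - real n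
    \<le> real (card {(i,j,k) \<in> ?T. cyclic s i j k})" .
  moreover have "real n ^ 3 / 4 - 3 * (\<Sum>i<n. (walk s n i)\<^sup>2) - 4 * (real n)\<^sup>2
    \<le> (real n ^ 3 - 3 * (\<Sum>j<n. (?d j)\<^sup>2)) / 4 - real n"
    by (rule arith[OF dd nn zero_le_power2])
  ultimately show ?thesis by (rule order_trans[rotated])
qed

section \<open>The sign sequence of a planar point set\<close>

lemma inner_real2: "u \<bullet> (z :: real^2) = u $ 1 * z $ 1 + u $ 2 * z $ 2"
  by (simp add: inner_vec_def sum_2)

lemma real2_eq_iff: "(u :: real^2) = z \<longleftrightarrow> u $ 1 = z $ 1 \<and> u $ 2 = z $ 2"
  by (simp add: vec_eq_iff forall_2)

lemma polar_line:
  fixes z :: "real^2"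
  assumes "z \<noteq> 0"
  shows "\<exists>\<theta> \<sigma> r. 0 \<le> \<theta> \<and> \<theta> < pi \<and> \<bar>\<sigma>\<bar> = 1 \<and> r > 0 \<and> r = norm z \<and> z $ 1 = \<sigma> * r * cos \<theta> \<and> z $ 2 = \<sigma> * r * sin \<theta>"
proof -
  let ?r = "norm z"
  have r: "?r > 0" using assms by simp
  have r2: "?r\<^sup>2 = (z$1)\<^sup>2 + (z$2)\<^sup>2" by (simp only: power2_norm_eq_inner inner_real2) (simp add: power2_eq_square)
  have "(z$1 / ?r)\<^sup>2 + (z$2 / ?r)\<^sup>2 = ?r\<^sup>2 / ?r\<^sup>2"
    unfolding power_divide add_divide_distrib[symmetric] by (rule arg_cong2[where f="(/)", OF r2[symmetric] refl])
  hence "(z$1 / ?r)\<^sup>2 + (z$2 / ?r)\<^sup>2 = 1" using r by simp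
  then obtain t where t: "0 \<le> t" "t < 2 * pi" "z$1 / ?r = cos t" "z$2 / ?r = sin t"
    using sincos_total_2pi by metis
  have z: "z$1 = ?r * cos t" "z$2 = ?r * sin t" using t(3,4) r by (simp_all add: field_simps)
  show ?thesis
  proof (cases "t < pi")
    case True
    thus ?thesis using t z r by (intro exI[of _ t] exI[of _ 1] exI[of _ ?r]) auto
  next
    case False
    have "cos t = - cos (t - pi)" "sin t = - sin (t - pi)" by (simp_all add: cos_diff sin_diff)
    thus ?thesis using t z r False by (intro exI[of _ "t - pi"] exI[of _ "-1"] exI[of _ ?r]) auto
  qed
qed

text \<open>Chosen so that the inner product with \<sigma> r (cos \<theta>, sin \<theta>) is
  \<sigma> r sin (\<theta> - a), which for angles in [0, pi) compares \<theta> with a.\<close>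

definition normal_dir :: "real \<Rightarrow> real^2" where
  "normal_dir a = (\<chi> i. if i = 1 then - sin a else cos a)"

lemma normal_dir_nth [simp]: "normal_dir a $ 1 = - sin a" "normal_dir a $ 2 = cos a"
  by (simp_all add: normal_dir_def)

lemma norm_normal_dir [simp]: "norm (normal_dir a) = 1"
proof -
  have "(norm (normal_dir a))\<^sup>2 = (sin a)\<^sup>2 + (cos a)\<^sup>2"
    by (simp only: power2_norm_eq_inner inner_real2) (simp add: power2_eq_square)
  thus ?thesis by (simp add: power2_eq_1_iff) (smt (verit) norm_ge_zero)
qed

text \<open>A quarter turn of \<open>u\<close> is written in polar form modulo pi.\<close>

lemma unit_vector_normal_dir:
  fixes u :: "real^2"
  assumes "norm u = 1"
  shows "\<exists>a c. 0 \<le> a \<and> a < pi \<and> \<bar>c\<bar> = 1 \<and> u = c *\<^sub>R normal_dir a"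
proof -
  let ?z = "(\<chi> i. if i = 1 then u $ 2 else - u $ 1) :: real^2"
  have z: "?z $ 1 = u $ 2" "?z $ 2 = - u $ 1" by simp_all
  have "(norm ?z)\<^sup>2 = (norm u)\<^sup>2"
    by (simp add: power2_norm_eq_inner inner_real2)
  hence "norm ?z = norm u" by (simp only: power2_eq_iff_nonneg norm_ge_zero)
  hence n1: "norm ?z = 1" using assms by simp
  hence "?z \<noteq> 0" by (metis norm_zero zero_neq_one)
  from polar_line[OF this] obtain a c where "0 \<le> a" "a < pi" "\<bar>c\<bar> = 1" "?z $ 1 = c * cos a" "?z $ 2 = c * sin a"
    unfolding n1 by auto
  moreover from this have "u = c *\<^sub>R normal_dir a" unfolding z by (simp add: real2_eq_iff)
  ultimately show ?thesis by blast
qed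

lemma sorted_enumeration:
  fixes key :: "'v \<Rightarrow> real"
  assumes "finite A"
  shows "\<exists>e. bij_betw e {..<card A} A \<and> (\<forall>i j. i \<le> j \<longrightarrow> j < card A \<longrightarrow> key (e i) \<le> key (e j))"
proof -
  obtain ys where ys: "set ys = A" "distinct ys" using finite_distinct_list[OF assms] by blast
  let ?xs = "sort_key key ys"
  have l: "length ?xs = card A" using ys distinct_card by fastforce
  have "bij_betw ((!) ?xs) {..<length ?xs} (set ?xs)" using ys by (intro bij_betw_nth) auto
  hence "bij_betw ((!) ?xs) {..<card A} A" using ys l by simp
  moreover have "key (?xs ! i) \<le> key (?xs ! j)" if "i \<le> j" "j < card A" for i j
    using sorted_nth_mono[OF sorted_sort_key[of key ys], of i j] that l by simp
  ultimately show ?thesis by blast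
qed

definition angle_balance :: "(nat \<Rightarrow> real) \<Rightarrow> (nat \<Rightarrow> real) \<Rightarrow> nat \<Rightarrow> real \<Rightarrow> real" where
  "angle_balance s \<theta> n a = (\<Sum>i<n. s i * sgn (\<theta> i - a)) / 2"

text \<open>The two quantities differ only at points whose angle is exactly \<open>a\<close>: these
  count \<plusminus>1 in one and 0 in the other. At most two such points, halved, give the bound
  1.\<close>

lemma walk_near_angle_balance:
  assumes s: "\<And>i. i < n \<Longrightarrow> \<bar>s i\<bar> = 1" and i: "i \<le> n"
    and le: "\<And>j. j < i \<Longrightarrow> \<theta> j \<le> a" and ge: "\<And>j. i \<le> j \<Longrightarrow> j < n \<Longrightarrow> a \<le> \<theta> j"
    and c: "card {j\<in>{..<n}. \<theta> j = a} \<le> 2"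
  shows "\<bar>walk s n i - angle_balance s \<theta> n a\<bar> \<le> 1"
proof -
  let ?eps = "\<lambda>j. if j < i then -1 else 1 :: real"
  have "walk s n i = (\<Sum>j<n. s j * ?eps j) / 2"
  proof -
    have "(\<Sum>j<n. s j * ?eps j) = (\<Sum>j<i. s j * ?eps j) + (\<Sum>j\<in>{i..<n}. s j * ?eps j)"
      using sum.atLeastLessThan_concat[of 0 i n "\<lambda>j. s j * ?eps j"] i by (simp only: atLeast0LessThan)
    also have "\<dots> = - (\<Sum>j<i. s j) + (\<Sum>j\<in>{i..<n}. s j)" by (simp add: sum_negf)
    finally show ?thesis by (simp add: walk_def)
  qed
  hence "walk s n i - angle_balance s \<theta> n a = (\<Sum>j<n. s j * (?eps j - sgn (\<theta> j - a))) / 2"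
    unfolding angle_balance_def by (simp only: diff_divide_distrib[symmetric] sum_subtractf[symmetric] right_diff_distrib)
  moreover have "\<bar>\<Sum>j<n. s j * (?eps j - sgn (\<theta> j - a))\<bar> \<le> (\<Sum>j<n. of_bool (\<theta> j = a))"
  proof (rule order_trans[OF sum_abs sum_mono])
    fix j assume "j \<in> {..<n}"
    thus "\<bar>s j * (?eps j - sgn (\<theta> j - a))\<bar> \<le> of_bool (\<theta> j = a)"
      using s[of j] le[of j] ge[of j] by (cases "j < i"; cases "\<theta> j = a") (auto simp: abs_mult sgn_if)
  qed
  moreover have "(\<Sum>j<n. of_bool (\<theta> j = a)) \<le> (2::real)"
    using c by (simp add: Collect_conj_eq lessThan_def)
  ultimately show ?thesis by simp
qed

text \<open>
  The order is by angle modulo pi, so three normals with 0 in their hull appear with alternating signs.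
\<close>
lemma alternating_signs:
  fixes a1 a2 a3 :: real and T :: "real \<Rightarrow> real"
  assumes a: "0 \<le> a1" "a1 \<le> a2" "a2 \<le> a3" "a3 < pi"
    and e: "\<bar>e1\<bar> = 1" "\<bar>e2\<bar> = 1" "\<bar>e3\<bar> = 1"
    and w: "w1 \<ge> 0" "w2 \<ge> 0" "w3 \<ge> 0" "w1 + w2 + w3 = 1"
    and sum: "w1 *\<^sub>R e1 *\<^sub>R normal_dir a1 + w2 *\<^sub>R e2 *\<^sub>R normal_dir a2 + w3 *\<^sub>R e3 *\<^sub>R normal_dir a3 = 0"
    and T: "e1 * T a1 \<ge> D - 1" "e2 * T a2 \<ge> D - 1" "e3 * T a3 \<ge> D - 1" and D: "D > 1"
  shows "e2 = - e1 \<and> e3 = e1"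
proof -
  have E: "e1 = 1 \<or> e1 = -1" "e2 = 1 \<or> e2 = -1" "e3 = 1 \<or> e3 = -1" using e by (auto simp: abs_if split: if_splits)
  have sn: "w1 * e1 * sin a1 + w2 * e2 * sin a2 + w3 * e3 * sin a3 = 0"
    and cs: "w1 * e1 * cos a1 + w2 * e2 * cos a2 + w3 * e3 * cos a3 = 0"
    using arg_cong[OF sum, of "\<lambda>v. v $ 1"] arg_cong[OF sum, of "\<lambda>v. v $ 2"] by (simp_all add: mult.assoc)
  \<comment> \<open>Turning the vector relation by t, with t equal to one of the three angles,
    removes one term and leaves a relation between the other two.\<close>
  have rot: "w1 * e1 * sin (a1 - t) + w2 * e2 * sin (a2 - t) + w3 * e3 * sin (a3 - t) = 0" for t
  proof -
    have "w1 * e1 * sin (a1 - t) + w2 * e2 * sin (a2 - t) + w3 * e3 * sin (a3 - t)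
      = (w1 * e1 * sin a1 + w2 * e2 * sin a2 + w3 * e3 * sin a3) * cos t
        - (w1 * e1 * cos a1 + w2 * e2 * cos a2 + w3 * e3 * cos a3) * sin t"
      by (simp add: sin_diff algebra_simps)
    thus ?thesis using sn cs by simp
  qed
  have sw: "sin (x - y) = - sin (y - x)" for x y :: real using sin_minus[of "y - x"] by simp
  let ?p = "sin (a2 - a1)" and ?q = "sin (a3 - a2)" and ?r = "sin (a3 - a1)"
  have r1: "w2 * e2 * ?p + w3 * e3 * ?r = 0" using rot[of a1] by simp
  have r2: "w3 * e3 * ?q = w1 * e1 * ?p" using rot[of a2] sw[of a1 a2] by simp
  have r3: "w1 * e1 * ?r + w2 * e2 * ?q = 0" using rot[of a3] sw[of a1 a3] sw[of a2 a3] by simp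
  have ne: "e1 \<noteq> 0" "e2 \<noteq> 0" "e3 \<noteq> 0" using E by auto
  have opp: "c = - b" if "b \<noteq> c" "b = 1 \<or> b = -1" "c = 1 \<or> c = -1" for b c :: real using that by auto
  \<comment> \<open>At equal angles opposite signs would make both T and -T at least D - 1 >
    0.\<close>
  have eq12: "e1 = e2" if "a1 = a2"
  proof (rule ccontr)
    assume "e1 \<noteq> e2"
    hence "e2 = - e1" by (rule opp) (use E in blast)+
    hence "- (e1 * T a1) \<ge> D - 1" using T(2) that by simp
    thus False using T(1) D by linarith
  qed
  have eq23: "e2 = e3" if "a2 = a3"
  proof (rule ccontr)
    assume "e2 \<noteq> e3"
    hence "e3 = - e2" by (rule opp) (use E in blast)+
    hence "- (e2 * T a2) \<ge> D - 1" using T(3) that by simp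
    thus False using T(2) D by linarith
  qed
  consider "a1 = a2" "a2 = a3" | "a1 = a2" "a2 < a3" | "a1 < a2" "a2 = a3" | "a1 < a2" "a2 < a3" using a by linarith
  thus ?thesis
  proof cases
    case 1
    have "e1 * (w1 + w2 + w3) * sin a1 = 0" "e1 * (w1 + w2 + w3) * cos a1 = 0"
      using sn cs eq12[OF 1(1)] eq23[OF 1(2)] 1 by (simp_all add: algebra_simps)
    hence "sin a1 = 0" "cos a1 = 0" using w(4) ne by simp_all
    thus ?thesis using sin_cos_squared_add[of a1] by simp
  next
    case 2
    have r: "?r > 0" using 2 a by (intro sin_gt_zero) auto
    have "w3 = 0" using r1 2 r ne by simp
    moreover have "e1 * (w1 + w2) * ?r = 0" using r3 2 eq12[OF 2(1)] by (simp add: algebra_simps)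
    ultimately show ?thesis using r w(4) ne by simp
  next
    case 3
    have r: "?r > 0" using 3 a by (intro sin_gt_zero) auto
    have "w1 = 0" using r3 3 r ne by simp
    moreover have "e2 * (w2 + w3) * ?r = 0" using r1 3 eq23[OF 3(2)] by (simp add: algebra_simps)
    ultimately show ?thesis using r w(4) ne by simp
  next
    case 4
    have pqr: "?p > 0" "?q > 0" "?r > 0" using 4 a by (intro sin_gt_zero; linarith)+
    have i13: "w1 = 0 \<Longrightarrow> w3 = 0" and i31: "w3 = 0 \<Longrightarrow> w1 = 0" using r2 pqr ne by simp_all
    have i23: "w2 = 0 \<Longrightarrow> w3 = 0" and i32: "w3 = 0 \<Longrightarrow> w2 = 0" using r1 pqr ne by simp_all
    have "w3 \<noteq> 0" using i31 i32 w(4) by fastforce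
    hence "w1 \<noteq> 0" "w2 \<noteq> 0" "w3 \<noteq> 0" using i13 i23 by blast+
    hence wp: "w1 > 0" "w2 > 0" "w3 > 0" using w(1-3) by linarith+
    have pos: "w1 * ?p > 0" "w2 * ?p > 0" "w3 * ?q > 0" "w3 * ?r > 0" using wp pqr by simp_all
    have "e3 = e1"
    proof (rule ccontr)
      assume "e3 \<noteq> e1"
      hence "e1 = - e3" by (rule opp) (use E in blast)+
      hence "e3 * (w3 * ?q + w1 * ?p) = 0" using r2 by (simp add: algebra_simps)
      thus False using ne pos by simp
    qed
    moreover have "e2 = - e3"
    proof (rule ccontr)
      assume "e2 \<noteq> - e3"
      hence "e2 = e3" using E(2,3) by (elim disjE) simp_all
      hence "e3 * (w2 * ?p + w3 * ?r) = 0" using r1 by (simp add: algebra_simps)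
      thus False using ne pos by simp
    qed
    ultimately show ?thesis by simp
  qed
qed

lemma sgn_sin_diff:
  assumes "0 \<le> a" "a < pi" "0 \<le> t" "t < pi"
  shows "sgn (sin (t - a)) = sgn (t - a)"
proof -
  consider "t = a" | "t > a" | "t < a" by linarith
  thus ?thesis
  proof cases
    case 2
    hence "sin (t - a) > 0" using assms by (intro sin_gt_zero) auto
    thus ?thesis using 2 by simp
  next
    case 3
    hence "sin (a - t) > 0" using assms by (intro sin_gt_zero) auto
    moreover have "sin (t - a) = - sin (a - t)" using sin_minus[of "a - t"] by simp
    ultimately show ?thesis using 3 by simp
  qed simp
qed

text \<open>The balance is at most D + 1 everywhere and at least D - 1 in three directions; passing
  to the walk costs 1 more. So the walk is bounded by D + 2 and comes within 4 of this bound, which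
  is the slack in the energy estimate. For D \<le> 1 the bound itself is below 4.\<close>

lemma balanced_sign_sequence:
  fixes x :: "'v \<Rightarrow> real^2"
  assumes V: "finite V" "V \<noteq> {}"
    and gp: "\<And>p u. norm u = 1 \<Longrightarrow> card {v\<in>V. u \<bullet> (x v - p) = 0} \<le> 2"
  shows "\<exists>p n e s r \<theta>. bij_betw e {..<n} {v\<in>V. x v \<noteq> p} \<and>
     (\<forall>i<n. \<bar>s i\<bar> = 1 \<and> r i > 0 \<and> 0 \<le> \<theta> i \<and> \<theta> i < pi \<and>
        (x (e i) - p) $ 1 = s i * r i * cos (\<theta> i) \<and> (x (e i) - p) $ 2 = s i * r i * sin (\<theta> i)) \<and>
     (\<forall>i j. i \<le> j \<longrightarrow> j < n \<longrightarrow> \<theta> i \<le> \<theta> j) \<and>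
     (\<Sum>i<n. (walk s n i)\<^sup>2) \<le> real n ^ 3 / 108 + 500 * (real n)\<^sup>2"
proof -
  obtain p D a b c \<alpha> \<beta> \<gamma> where up: "\<And>u. norm u = 1 \<Longrightarrow> sign_balance x V p u \<le> D + 1" and
     abc: "norm a = 1" "norm b = 1" "norm c = 1"
     "sign_balance x V p a \<ge> D - 1" "sign_balance x V p b \<ge> D - 1" "sign_balance x V p c \<ge> D - 1" and
     w: "\<alpha> \<ge> 0" "\<beta> \<ge> 0" "\<gamma> \<ge> 0" "\<alpha> + \<beta> + \<gamma> = (1::real)" "\<alpha> *\<^sub>R a + \<beta> *\<^sub>R b + \<gamma> *\<^sub>R c = 0"
    using balanced_point_exists[OF V gp] by blast
  define V' where "V' = {v\<in>V. x v \<noteq> p}"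
  have finV': "finite V'" using V by (simp add: V'_def)
  have "\<forall>v. \<exists>\<theta> \<sigma> r. v \<in> V' \<longrightarrow> 0 \<le> \<theta> \<and> \<theta> < pi \<and> \<bar>\<sigma>\<bar> = 1 \<and> r > 0 \<and> (x v - p) $ 1 = \<sigma> * r * cos \<theta> \<and> (x v - p) $ 2 = \<sigma> * r * sin \<theta>"
  proof
    fix v
    show "\<exists>\<theta> \<sigma> r. v \<in> V' \<longrightarrow> 0 \<le> \<theta> \<and> \<theta> < pi \<and> \<bar>\<sigma>\<bar> = 1 \<and> r > 0 \<and> (x v - p) $ 1 = \<sigma> * r * cos \<theta> \<and> (x v - p) $ 2 = \<sigma> * r * sin \<theta>"
    proof (cases "v \<in> V'")
      case True
      hence "x v - p \<noteq> 0" by (simp add: V'_def)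
      from polar_line[OF this] show ?thesis by blast
    qed simp
  qed
  from choice[OF this] obtain \<Theta> where "\<forall>v. \<exists>\<sigma> r. v \<in> V' \<longrightarrow> 0 \<le> \<Theta> v \<and> \<Theta> v < pi \<and> \<bar>\<sigma>\<bar> = 1 \<and> r > 0 \<and>
      (x v - p) $ 1 = \<sigma> * r * cos (\<Theta> v) \<and> (x v - p) $ 2 = \<sigma> * r * sin (\<Theta> v)" by (rule exE)
  from choice[OF this] obtain \<Sigma> where "\<forall>v. \<exists>r. v \<in> V' \<longrightarrow> 0 \<le> \<Theta> v \<and> \<Theta> v < pi \<and> \<bar>\<Sigma> v\<bar> = 1 \<and> r > 0 \<and>
      (x v - p) $ 1 = \<Sigma> v * r * cos (\<Theta> v) \<and> (x v - p) $ 2 = \<Sigma> v * r * sin (\<Theta> v)" by (rule exE)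
  from choice[OF this] obtain \<rho> where pol: "\<And>v. v \<in> V' \<Longrightarrow> 0 \<le> \<Theta> v \<and> \<Theta> v < pi \<and> \<bar>\<Sigma> v\<bar> = 1 \<and> \<rho> v > 0 \<and>
      (x v - p) $ 1 = \<Sigma> v * \<rho> v * cos (\<Theta> v) \<and> (x v - p) $ 2 = \<Sigma> v * \<rho> v * sin (\<Theta> v)" by blast
  define n where "n = card V'"
  obtain e where e: "bij_betw e {..<n} V'" and mono0: "\<And>i j. i \<le> j \<Longrightarrow> j < n \<Longrightarrow> \<Theta> (e i) \<le> \<Theta> (e j)"
    using sorted_enumeration[OF finV', of \<Theta>] unfolding n_def by blast
  have eV: "e i \<in> V'" if "i < n" for i using bij_betwE[OF e] that by blast
  define s r \<theta> where "s = (\<lambda>i. \<Sigma> (e i))" and "r = (\<lambda>i. \<rho> (e i))" and "\<theta> = (\<lambda>i. \<Theta> (e i))"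
  have pt: "\<bar>s i\<bar> = 1 \<and> r i > 0 \<and> 0 \<le> \<theta> i \<and> \<theta> i < pi \<and>
        (x (e i) - p) $ 1 = s i * r i * cos (\<theta> i) \<and> (x (e i) - p) $ 2 = s i * r i * sin (\<theta> i)" if "i < n" for i
    using pol[OF eV[OF that]] unfolding s_def r_def \<theta>_def by simp
  have mono: "\<theta> i \<le> \<theta> j" if "i \<le> j" "j < n" for i j using mono0[OF that] by (simp add: \<theta>_def)
  let ?T = "angle_balance s \<theta> n"
  have inn: "normal_dir t \<bullet> (x (e i) - p) = s i * r i * sin (\<theta> i - t)" if "i < n" for i t
    using pt[OF that] unfolding inner_real2 by (simp add: sin_diff algebra_simps)
  have bal: "sign_balance x V p (k *\<^sub>R normal_dir t) = k * ?T t" if "0 \<le> t" "t < pi" "\<bar>k\<bar> = 1" for k t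
  proof -
    let ?f = "\<lambda>v. sgn ((k *\<^sub>R normal_dir t) \<bullet> (x v - p))"
    have sk: "sgn k = k" using that(3) by (auto simp: abs_if split: if_splits)
    have "(\<Sum>v\<in>V. ?f v) = (\<Sum>v\<in>V'. ?f v)"
      by (rule sum.mono_neutral_right[OF V(1)]) (auto simp: V'_def)
    also have "\<dots> = (\<Sum>i<n. ?f (e i))" using sum.reindex_bij_betw[OF e, of ?f] by simp
    also have "\<dots> = (\<Sum>i<n. k * (s i * sgn (\<theta> i - t)))"
    proof (rule sum.cong[OF refl])
      fix i assume "i \<in> {..<n}"
      hence i: "i < n" by simp
      have ss: "sgn (s i) = s i" using pt[OF i] by (auto simp: abs_if split: if_splits)
      have "?f (e i) = sgn (k * (s i * r i * sin (\<theta> i - t)))" using inn[OF i] by simp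
      also have "\<dots> = k * (s i * sgn (sin (\<theta> i - t)))" using pt[OF i] by (simp add: sgn_mult sk ss)
      also have "sgn (sin (\<theta> i - t)) = sgn (\<theta> i - t)" using pt[OF i] that by (intro sgn_sin_diff) auto
      finally show "?f (e i) = k * (s i * sgn (\<theta> i - t))" .
    qed
    also have "\<dots> = k * (\<Sum>i<n. s i * sgn (\<theta> i - t))" by (simp only: sum_distrib_left)
    finally show ?thesis by (simp add: sign_balance_def angle_balance_def)
  qed
  have ties: "card {j\<in>{..<n}. \<theta> j = t} \<le> 2" for t
  proof -
    have "card {j\<in>{..<n}. \<theta> j = t} = card (e ` {j\<in>{..<n}. \<theta> j = t})"
      using e by (intro card_image[symmetric]) (auto simp: bij_betw_def intro: inj_on_subset)
    also have "\<dots> \<le> card {v\<in>V. normal_dir t \<bullet> (x v - p) = 0}"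
    proof (rule card_mono)
      show "e ` {j\<in>{..<n}. \<theta> j = t} \<subseteq> {v\<in>V. normal_dir t \<bullet> (x v - p) = 0}"
        using eV inn by (auto simp: V'_def)
    qed (use V in simp)
    also have "\<dots> \<le> 2" by (rule gp) simp
    finally show ?thesis .
  qed
  have T_le: "\<bar>?T t\<bar> \<le> D + 1" if "0 \<le> t" "t < pi" for t
  proof -
    have "sign_balance x V p (1 *\<^sub>R normal_dir t) \<le> D + 1" "sign_balance x V p ((-1) *\<^sub>R normal_dir t) \<le> D + 1"
      by (rule up; simp)+
    thus ?thesis using bal[OF that, of 1] bal[OF that, of "-1"] by (simp add: abs_le_iff)
  qed
  have s1: "\<bar>s i\<bar> = 1" if "i < n" for i using pt[OF that] by simp
  have W_le: "\<bar>walk s n i\<bar> \<le> D + 2" if il: "i \<le> n" for i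
  proof -
    have less: "\<bar>walk s n i\<bar> \<le> D + 2" if "i < n" for i
    proof -
      have "\<bar>walk s n i - ?T (\<theta> i)\<bar> \<le> 1"
        using that by (intro walk_near_angle_balance s1 ties) (auto intro: mono)
      thus ?thesis using T_le[of "\<theta> i"] pt[OF that] by linarith
    qed
    consider "i < n" | "i = n" "n > 0" | "n = 0" "i = 0" using il by linarith
    thus ?thesis
    proof cases
      case 2
      thus ?thesis using less[of 0] by (simp add: walk_end)
    next
      case 3
      thus ?thesis using T_le[of 0] by (simp add: walk_def)
    qed (rule less)
  qed
  \<comment> \<open>The index of the first point with angle at least t, or n if there is none; the
    disjunct \<open>n \<le> i\<close> makes the minimum exist and bounds it by n.\<close>
  define pos where "pos t = (LEAST i. n \<le> i \<or> t \<le> \<theta> i)" for t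
  have pos_le: "pos t \<le> n" for t unfolding pos_def by (rule Least_le) simp
  have posI: "n \<le> pos t \<or> t \<le> \<theta> (pos t)" for t unfolding pos_def by (rule LeastI[of _ n]) simp
  have pos_lt: "\<theta> j < t" if "j < pos t" for j t
    using not_less_Least[of j "\<lambda>i. n \<le> i \<or> t \<le> \<theta> i"] that unfolding pos_def[symmetric] by auto
  have pos_mono: "pos t \<le> pos t'" if "t \<le> t'" for t t'
    unfolding pos_def[of t] by (rule Least_le) (use posI[of t'] that in auto)
  have near: "\<bar>walk s n (pos t) - ?T t\<bar> \<le> 1" for t
  proof (rule walk_near_angle_balance[OF s1 pos_le _ _ ties])
    show "\<theta> j \<le> t" if "j < pos t" for j using pos_lt[OF that] by simp
    show "t \<le> \<theta> j" if "pos t \<le> j" "j < n" for j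
      using posI[of t] mono[OF that] that by linarith
  qed
  let ?tight = "\<exists>i1 i2 i3 q. i1 \<le> i2 \<and> i2 \<le> i3 \<and> i3 \<le> n \<and> \<bar>q\<bar> = 1 \<and>
        q * walk s n i1 \<ge> D + 2 - 4 \<and> - q * walk s n i2 \<ge> D + 2 - 4 \<and> q * walk s n i3 \<ge> D + 2 - 4"
  have key: "?tight" if a: "0 \<le> a1" "a1 \<le> a2" "a2 \<le> a3" "a3 < pi"
    and e: "\<bar>e1\<bar> = 1" "\<bar>e2\<bar> = 1" "\<bar>e3\<bar> = 1"
    and w: "w1 \<ge> 0" "w2 \<ge> 0" "w3 \<ge> 0" "w1 + w2 + w3 = 1"
    and sum: "w1 *\<^sub>R e1 *\<^sub>R normal_dir a1 + w2 *\<^sub>R e2 *\<^sub>R normal_dir a2 + w3 *\<^sub>R e3 *\<^sub>R normal_dir a3 = 0"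
    and T: "e1 * ?T a1 \<ge> D - 1" "e2 * ?T a2 \<ge> D - 1" "e3 * ?T a3 \<ge> D - 1" and D: "D > 1"
    for a1 a2 a3 e1 e2 e3 w1 w2 w3
  proof -
    have alt: "e2 = - e1" "e3 = e1" using alternating_signs[OF a e w sum T D] by auto
    have nr: "q * walk s n (pos t) \<ge> q * ?T t - 1" if "\<bar>q\<bar> = 1" for q t
    proof -
      have "q = 1 \<or> q = -1" using that by (auto simp: abs_if split: if_splits)
      thus ?thesis using near[of t] by (auto simp: abs_le_iff)
    qed
    have "pos a1 \<le> pos a2" "pos a2 \<le> pos a3" using a by (auto intro: pos_mono)
    moreover have "e1 * walk s n (pos a1) \<ge> D + 2 - 4" using nr[OF e(1), of a1] T(1) by linarith
    moreover have "- e1 * walk s n (pos a2) \<ge> D + 2 - 4" using nr[OF e(2), of a2] T(2) unfolding alt(1) by linarith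
    moreover have "e1 * walk s n (pos a3) \<ge> D + 2 - 4" using nr[OF e(3), of a3] T(3) unfolding alt(2) by linarith
    ultimately show ?thesis using pos_le[of a3] e(1) by blast
  qed
  have "D + 2 < 4 \<or> ?tight"
  proof (cases "D > 1")
    case True
    obtain a1 k1 where 1: "0 \<le> a1" "a1 < pi" "\<bar>k1\<bar> = 1" "a = k1 *\<^sub>R normal_dir a1" using unit_vector_normal_dir[OF abc(1)] by blast
    obtain a2 k2 where 2: "0 \<le> a2" "a2 < pi" "\<bar>k2\<bar> = 1" "b = k2 *\<^sub>R normal_dir a2" using unit_vector_normal_dir[OF abc(2)] by blast
    obtain a3 k3 where 3: "0 \<le> a3" "a3 < pi" "\<bar>k3\<bar> = 1" "c = k3 *\<^sub>R normal_dir a3" using unit_vector_normal_dir[OF abc(3)] by blast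
    have T1: "k1 * ?T a1 \<ge> D - 1" using abc(4) unfolding 1(4) bal[OF 1(1-3)] .
    have T2: "k2 * ?T a2 \<ge> D - 1" using abc(5) unfolding 2(4) bal[OF 2(1-3)] .
    have T3: "k3 * ?T a3 \<ge> D - 1" using abc(6) unfolding 3(4) bal[OF 3(1-3)] .
    let ?n1 = "\<alpha> *\<^sub>R k1 *\<^sub>R normal_dir a1" and ?n2 = "\<beta> *\<^sub>R k2 *\<^sub>R normal_dir a2" and ?n3 = "\<gamma> *\<^sub>R k3 *\<^sub>R normal_dir a3"
    have z: "?n1 + ?n2 + ?n3 = 0" using w(5) unfolding 1(4) 2(4) 3(4) .
    have z': "?n1 + ?n3 + ?n2 = 0" "?n2 + ?n1 + ?n3 = 0" "?n2 + ?n3 + ?n1 = 0" "?n3 + ?n1 + ?n2 = 0" "?n3 + ?n2 + ?n1 = 0"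
      using z by (simp_all only: add_ac)
    have w': "\<alpha> + \<gamma> + \<beta> = 1" "\<beta> + \<alpha> + \<gamma> = 1" "\<beta> + \<gamma> + \<alpha> = 1" "\<gamma> + \<alpha> + \<beta> = 1" "\<gamma> + \<beta> + \<alpha> = 1" using w(4) by linarith+
    consider "a1 \<le> a2" "a2 \<le> a3" | "a1 \<le> a3" "a3 \<le> a2" | "a2 \<le> a1" "a1 \<le> a3"
      | "a2 \<le> a3" "a3 \<le> a1" | "a3 \<le> a1" "a1 \<le> a2" | "a3 \<le> a2" "a2 \<le> a1"
      using linear[of a1 a2] linear[of a2 a3] linear[of a1 a3] by blast
    hence ?tight
    proof cases
      case c: 1 show ?thesis by (rule key[OF 1(1) c 3(2) 1(3) 2(3) 3(3) w(1,2,3) w(4) z T1 T2 T3 True])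
    next
      case c: 2 show ?thesis by (rule key[OF 1(1) c 2(2) 1(3) 3(3) 2(3) w(1,3,2) w'(1) z'(1) T1 T3 T2 True])
    next
      case c: 3 show ?thesis by (rule key[OF 2(1) c 3(2) 2(3) 1(3) 3(3) w(2,1,3) w'(2) z'(2) T2 T1 T3 True])
    next
      case c: 4 show ?thesis by (rule key[OF 2(1) c 1(2) 2(3) 3(3) 1(3) w(2,3,1) w'(3) z'(3) T2 T3 T1 True])
    next
      case c: 5 show ?thesis by (rule key[OF 3(1) c 2(2) 3(3) 1(3) 2(3) w(3,1,2) w'(4) z'(4) T3 T1 T2 True])
    next
      case c: 6 show ?thesis by (rule key[OF 3(1) c 1(2) 3(3) 2(3) 1(3) w(3,2,1) w'(5) z'(5) T3 T2 T1 True])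
    qed
    thus ?thesis ..
  qed simp
  hence "(\<Sum>i<n. (walk s n i)\<^sup>2) \<le> real n ^ 3 / 108 + 500 * (real n)\<^sup>2"
    by (intro walk_sum_squares_le[where D = "D + 2"] s1 W_le)
  thus ?thesis
    using e pt mono unfolding V'_def
    by (intro exI[of _ p] exI[of _ n] exI[of _ e] exI[of _ s] exI[of _ r] exI[of _ \<theta>] conjI) simp_all
qed

section \<open>Labellings whose cyclic triples contain a common point\<close>

definition cross2 :: "real^2 \<Rightarrow> real^2 \<Rightarrow> real" where
  "cross2 u v = u $ 1 * v $ 2 - u $ 2 * v $ 1"

text \<open>The cross products of opposite pairs, divided by their sum, are barycentric coordinates
  of \<open>p\<close>. The factor \<open>q\<close> is the common orientation, and the positive sum
  excludes a degenerate division.\<close>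

lemma mem_triangle_if_cyclic:
  fixes a b c p :: "real^2"
  assumes "q * cross2 (a - p) (b - p) \<ge> 0" "q * cross2 (b - p) (c - p) \<ge> 0" "q * cross2 (c - p) (a - p) \<ge> 0"
    and ne: "q * cross2 (a - p) (b - p) + q * cross2 (b - p) (c - p) + q * cross2 (c - p) (a - p) > 0"
  shows "p \<in> convex hull {a, b, c}"
proof -
  define A B C S where "A = q * cross2 (b - p) (c - p)" and "B = q * cross2 (c - p) (a - p)"
    and "C = q * cross2 (a - p) (b - p)" and "S = A + B + C"
  have S: "S > 0" using ne by (simp add: S_def A_def B_def C_def)
  have "A *\<^sub>R (a - p) + B *\<^sub>R (b - p) + C *\<^sub>R (c - p) = 0"
    unfolding A_def B_def C_def cross2_def real2_eq_iff by (simp add: algebra_simps)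
  hence "S *\<^sub>R p = A *\<^sub>R a + B *\<^sub>R b + C *\<^sub>R c" by (simp add: S_def algebra_simps)
  hence "(1 / S) *\<^sub>R (S *\<^sub>R p) = (1 / S) *\<^sub>R (A *\<^sub>R a + B *\<^sub>R b + C *\<^sub>R c)" by simp
  hence p: "p = (A / S) *\<^sub>R a + (B / S) *\<^sub>R b + (C / S) *\<^sub>R c" using S by (simp add: scaleR_right_distrib)
  have "0 \<le> A / S" "0 \<le> B / S" "0 \<le> C / S" using assms S by (simp_all add: A_def B_def C_def)
  moreover have "A / S + B / S + C / S = 1" using S by (simp add: S_def add_divide_distrib[symmetric])
  ultimately show ?thesis unfolding convex_hull_3 using p by blast
qed

text \<open>A label consists of an interval number in the angular order and a sign. Two points of
  the same interval get 0, since their order is not visible from the labels.\<close>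

definition label_orient :: "nat \<times> bool \<Rightarrow> nat \<times> bool \<Rightarrow> real" where
  "label_orient x y = (if snd x = snd y then 1 else -1) * sgn (real (fst y) - real (fst x))"

text \<open>The label \<open>None\<close> is reserved for vertices mapped to the point itself, which
  have no angle; triples containing one are not counted.\<close>

definition label_cyclic :: "((nat \<times> bool) option \<times> (nat \<times> bool) option \<times> (nat \<times> bool) option) set" where
  "label_cyclic = {(Some x, Some y, Some z) | x y z.
     label_orient x y \<noteq> 0 \<and> label_orient x y = label_orient y z \<and> label_orient y z = label_orient z x}"

lemma label_orient_eq_orient:
  assumes "\<bar>s i\<bar> = 1" "\<bar>s j\<bar> = 1" "i div L \<noteq> j div L"
  shows "label_orient (i div L, s i = 1) (j div L, s j = 1) = orient s i j"
proof -
  have lt: "i < j" if "i div L < j div L" for i j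
  proof (rule ccontr)
    assume "\<not> i < j"
    hence "j div L \<le> i div L" by (intro div_le_mono) simp
    thus False using that by simp
  qed
  have "sgn (real (j div L) - real (i div L)) = sgn (real j - real i)"
  proof (cases "i div L < j div L")
    case True
    thus ?thesis using lt[OF True] by simp
  next
    case False
    hence ji: "j div L < i div L" using assms(3) by simp
    show ?thesis using ji lt[OF ji] by simp
  qed
  moreover have "(if (s i = 1) = (s j = 1) then 1 else -1) = s i * s j"
  proof -
    have "s i = 1 \<or> s i = -1" "s j = 1 \<or> s j = -1" using assms(1,2) by (auto simp: abs_if split: if_splits)
    thus ?thesis by (elim disjE) simp_all
  qed
  ultimately show ?thesis unfolding label_orient_def orient_def fst_conv snd_conv by (simp only:)
qed

lemma label_orient_nz: "label_orient (a, b) (a', b') \<noteq> 0 \<longleftrightarrow> a \<noteq> a'"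
  by (simp add: label_orient_def sgn_if)

lemma card_same_block_le:
  assumes "L > 0"
  shows "card {(i,j,k) \<in> cube {..<n}. i div L = j div L} \<le> n * L * n"
proof -
  have "{(i,j,k) \<in> cube {..<n}. i div L = j div L}
    \<subseteq> (SIGMA i:{..<n}. {(i div L) * L..<(i div L) * L + L} \<times> {..<n})"
  proof
    fix y assume "y \<in> {(i,j,k) \<in> cube {..<n}. i div L = j div L}"
    then obtain i j k where y: "y = (i,j,k)" and h: "i < n" "k < n" "i div L = j div L" by auto
    have "j div L * L \<le> j" "j < j div L * L + L"
      using dividend_less_div_times[OF assms, of j] by (simp_all add: add.commute)
    thus "y \<in> (SIGMA i:{..<n}. {(i div L) * L..<(i div L) * L + L} \<times> {..<n})" using y h by simp
  qed
  hence "card {(i,j,k) \<in> cube {..<n}. i div L = j div L}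
    \<le> card (SIGMA i:{..<n}. {(i div L) * L..<(i div L) * L + L} \<times> {..<n})"
    by (intro card_mono) auto
  also have "\<dots> = n * L * n" by (simp add: card_cartesian_product)
  finally show ?thesis .
qed

text \<open>A lost triple has two indices in one interval of length at most L. The pair of positions
  where this happens is moved to the front by a cyclic shift, so one count of n L n is used three
  times.\<close>

lemma card_cyclic_separated_ge:
  assumes L: "L > 0"
  shows "real (card {(i,j,k) \<in> cube {..<n}. cyclic s i j k \<and> i div L \<noteq> j div L \<and> j div L \<noteq> k div L \<and> k div L \<noteq> i div L})
    \<ge> real (card {(i,j,k) \<in> cube {..<n}. cyclic s i j k}) - 3 * (real n)\<^sup>2 * real L"
proof -
  let ?T = "cube {..<n}"
  let ?G = "{(i,j,k) \<in> ?T. cyclic s i j k \<and> i div L \<noteq> j div L \<and> j div L \<noteq> k div L \<and> k div L \<noteq> i div L}"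
  let ?A = "{(i,j,k) \<in> ?T. i div L = j div L}"
  let ?B = "(\<lambda>(i,j,k). (k,i,j)) ` ?A" and ?C = "(\<lambda>(i,j,k). (j,k,i)) ` ?A"
  have fin: "finite ?A" "finite ?B" "finite ?C" "finite ?G" by (auto intro: finite_subset[of _ ?T])
  have "{(i,j,k) \<in> ?T. cyclic s i j k} \<subseteq> ?G \<union> (?A \<union> (?B \<union> ?C))"
  proof
    fix y assume "y \<in> {(i,j,k) \<in> ?T. cyclic s i j k}"
    then obtain i j k where y: "y = (i,j,k)" and h: "i < n" "j < n" "k < n" "cyclic s i j k" by auto
    consider "i div L = j div L" | "j div L = k div L" | "k div L = i div L"
      | "i div L \<noteq> j div L" "j div L \<noteq> k div L" "k div L \<noteq> i div L" by blast
    thus "y \<in> ?G \<union> (?A \<union> (?B \<union> ?C))"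
    proof cases
      case 1 thus ?thesis using y h by simp
    next
      case 2
      hence "(j,k,i) \<in> ?A" using h by simp
      hence "(\<lambda>(i,j,k). (k,i,j)) (j,k,i) \<in> ?B" by (rule imageI)
      thus ?thesis using y by simp
    next
      case 3
      hence "(k,i,j) \<in> ?A" using h by simp
      hence "(\<lambda>(i,j,k). (j,k,i)) (k,i,j) \<in> ?C" by (rule imageI)
      thus ?thesis using y by simp
    next
      case 4 thus ?thesis using y h by simp
    qed
  qed
  hence "card {(i,j,k) \<in> ?T. cyclic s i j k} \<le> card (?G \<union> (?A \<union> (?B \<union> ?C)))"
    using fin by (intro card_mono) auto
  also have "\<dots> \<le> card ?G + (card ?A + (card ?B + card ?C))"
    by (meson add_left_mono card_Un_le order_trans)
  also have "\<dots> \<le> card ?G + (card ?A + (card ?A + card ?A))"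
    by (intro add_mono card_image_le fin order_refl)
  also have "\<dots> \<le> card ?G + 3 * (n * L * n)" using card_same_block_le[OF L, of n] by simp
  finally have "real (card {(i,j,k) \<in> ?T. cyclic s i j k}) \<le> real (card ?G + 3 * (n * L * n))"
    by (simp only: of_nat_le_iff)
  thus ?thesis by (simp add: power2_eq_square mult_ac)
qed

text \<open>Labels record the interval of length L in the angular order and the sign. From them
  alone the orientation of points in different intervals can be read off, so a cyclic label triple
  certifies containment of \<open>p\<close>.\<close>

lemma labelled_cyclic_triples:
  fixes x :: "'v \<Rightarrow> real^2"
  assumes V: "finite V" "V \<noteq> {}" and L: "L > 0"
    and gp: "\<And>p u. norm u = 1 \<Longrightarrow> card {v\<in>V. u \<bullet> (x v - p) = 0} \<le> 2"
  shows "\<exists>p t. t ` V \<subseteq> insert None (Some ` ({..card V div L} \<times> UNIV)) \<and>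
     (\<forall>u\<in>V. \<forall>v\<in>V. \<forall>w\<in>V. (t u, t v, t w) \<in> label_cyclic \<longrightarrow> p \<in> convex hull {x u, x v, x w}) \<and>
     real (card {(u,v,w) \<in> cube V. (t u, t v, t w) \<in> label_cyclic})
       \<ge> 2/9 * real (card V) ^ 3 - 1510 * (real (card V))\<^sup>2 - 3 * (real (card V))\<^sup>2 * real L"
proof -
  obtain p n e s r \<theta> where e: "bij_betw e {..<n} {v\<in>V. x v \<noteq> p}" and
     pt: "\<And>i. i < n \<Longrightarrow> \<bar>s i\<bar> = 1 \<and> r i > 0 \<and> 0 \<le> \<theta> i \<and> \<theta> i < pi \<and>
        (x (e i) - p) $ 1 = s i * r i * cos (\<theta> i) \<and> (x (e i) - p) $ 2 = s i * r i * sin (\<theta> i)" and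
     mono: "\<And>i j. i \<le> j \<Longrightarrow> j < n \<Longrightarrow> \<theta> i \<le> \<theta> j" and
     W: "(\<Sum>i<n. (walk s n i)\<^sup>2) \<le> real n ^ 3 / 108 + 500 * (real n)\<^sup>2"
    using balanced_sign_sequence[OF V gp] by blast
  let ?N = "card V"
  have s1: "\<bar>s i\<bar> = 1" if "i < n" for i using pt[OF that] by simp
  have injE: "inj_on e {..<n}" and imE: "e ` {..<n} = {v\<in>V. x v \<noteq> p}" using e by (auto simp: bij_betw_def)
  define idx where "idx = inv_into {..<n} e"
  have idx_e: "idx (e i) = i" if "i < n" for i unfolding idx_def using injE that by simp
  have e_idx: "idx v < n \<and> e (idx v) = v" if "v \<in> V" "x v \<noteq> p" for v
  proof -
    have "v \<in> e ` {..<n}" using that imE by simp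
    thus ?thesis unfolding idx_def using inv_into_into[of v e "{..<n}"] f_inv_into_f[of v e "{..<n}"] by simp
  qed
  have nN: "n \<le> ?N" "?N \<le> n + 2"
  proof -
    have cn: "card {v\<in>V. x v \<noteq> p} = n" using bij_betw_same_card[OF e] by simp
    show "n \<le> ?N" unfolding cn[symmetric] using V by (intro card_mono) auto
    have "{v\<in>V. x v = p} \<subseteq> {v\<in>V. normal_dir 0 \<bullet> (x v - p) = 0}" by auto
    hence "card {v\<in>V. x v = p} \<le> card {v\<in>V. normal_dir 0 \<bullet> (x v - p) = 0}" using V by (intro card_mono) auto
    also have "\<dots> \<le> 2" by (rule gp) simp
    finally have c2: "card {v\<in>V. x v = p} \<le> 2" .
    have "V = {v\<in>V. x v \<noteq> p} \<union> {v\<in>V. x v = p}" by auto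
    hence "?N = card ({v\<in>V. x v \<noteq> p} \<union> {v\<in>V. x v = p})" by simp
    also have "\<dots> \<le> card {v\<in>V. x v \<noteq> p} + card {v\<in>V. x v = p}" by (rule card_Un_le)
    finally show "?N \<le> n + 2" using cn c2 by linarith
  qed
  define t where "t v = (if x v = p then None else Some (idx v div L, s (idx v) = 1))" for v
  have cr: "cross2 (x (e i) - p) (x (e j) - p) = s i * s j * (r i * r j * sin (\<theta> j - \<theta> i))" if "i < n" "j < n" for i j
    using pt[OF that(1)] pt[OF that(2)] unfolding cross2_def by (simp add: sin_diff algebra_simps)
  \<comment> \<open>Only a weak inequality holds, because two points may lie on the same line
    through p and make the sine vanish.\<close>
  have cr_nn: "orient s i j * cross2 (x (e i) - p) (x (e j) - p) \<ge> 0" if "i < n" "j < n" for i j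
  proof -
    have gen: "(Q * g) * (Q * (R * S)) = R * (g * S)" if "Q * Q = 1" for Q g R S :: real
    proof -
      have "(Q * g) * (Q * (R * S)) = (Q * Q) * (R * (g * S))" by (simp only: mult_ac)
      thus ?thesis using that by simp
    qed
    have sq: "(s i * s j) * (s i * s j) = 1"
    proof -
      have "\<bar>s i * s j\<bar> = 1" using s1[OF that(1)] s1[OF that(2)] by (simp add: abs_mult)
      thus ?thesis by (auto simp: abs_if split: if_splits)
    qed
    have "orient s i j * cross2 (x (e i) - p) (x (e j) - p) = r i * r j * (sgn (real j - real i) * sin (\<theta> j - \<theta> i))"
      unfolding cr[OF that] orient_def by (rule gen[OF sq])
    moreover have "sgn (real j - real i) * sin (\<theta> j - \<theta> i) \<ge> 0"
    proof (cases i j rule: linorder_cases)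
      case less
      hence "sin (\<theta> j - \<theta> i) \<ge> 0" using mono[of i j] pt[OF that(1)] pt[OF that(2)] that by (intro sin_ge_zero) auto
      thus ?thesis using less by simp
    next
      case greater
      hence "sin (\<theta> i - \<theta> j) \<ge> 0" using mono[of j i] pt[OF that(1)] pt[OF that(2)] that by (intro sin_ge_zero) auto
      moreover have "sin (\<theta> j - \<theta> i) = - sin (\<theta> i - \<theta> j)" using sin_minus[of "\<theta> i - \<theta> j"] by simp
      ultimately show ?thesis using greater by simp
    qed simp
    ultimately show ?thesis using pt[OF that(1)] pt[OF that(2)] by simp
  qed
  have contain: "p \<in> convex hull {x (e i), x (e j), x (e k)}"
    if b: "i < n" "j < n" "k < n" and cyc: "cyclic s i j k" for i j k
  proof -
    define q where "q = orient s i j"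
    have q: "q \<noteq> 0" "orient s j k = q" "orient s k i = q" using cyc by (auto simp: cyclic_def q_def)
    have dist: "i \<noteq> j" "j \<noteq> k" "k \<noteq> i" using q by (auto simp: q_def orient_def)
    have nn: "q * cross2 (x (e i) - p) (x (e j) - p) \<ge> 0" "q * cross2 (x (e j) - p) (x (e k) - p) \<ge> 0"
      "q * cross2 (x (e k) - p) (x (e i) - p) \<ge> 0"
      using cr_nn[OF b(1,2)] cr_nn[OF b(2,3)] cr_nn[OF b(3,1)] q by (simp_all add: q_def)
    show ?thesis
    proof (rule mem_triangle_if_cyclic[OF nn])
      \<comment> \<open>If the sum were 0, all three points would lie on the line through p at angle
        \<theta> i, contradicting the general position assumption \<open>gp\<close>.\<close>
      show "q * cross2 (x (e i) - p) (x (e j) - p) + q * cross2 (x (e j) - p) (x (e k) - p) + q * cross2 (x (e k) - p) (x (e i) - p) > 0"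
      proof (rule ccontr)
        assume "\<not> ?thesis"
        hence "q * cross2 (x (e i) - p) (x (e j) - p) = 0" "q * cross2 (x (e k) - p) (x (e i) - p) = 0" using nn by linarith+
        hence "cross2 (x (e i) - p) (x (e j) - p) = 0" "cross2 (x (e k) - p) (x (e i) - p) = 0" using q by auto
        moreover have nz: "s l \<noteq> 0" "r l \<noteq> 0" if "l < n" for l using pt[OF that] by auto
        ultimately have sz: "sin (\<theta> j - \<theta> i) = 0" "sin (\<theta> i - \<theta> k) = 0"
          unfolding cr[OF b(1,2)] cr[OF b(3,1)] using nz[OF b(1)] nz[OF b(2)] nz[OF b(3)] by simp_all
        have nd: "normal_dir (\<theta> i) \<bullet> (x (e l) - p) = s l * r l * sin (\<theta> l - \<theta> i)" if "l < n" for l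
          using pt[OF that] unfolding inner_real2 by (simp add: sin_diff algebra_simps)
        have sz': "sin (\<theta> k - \<theta> i) = 0" using sz(2) sin_minus[of "\<theta> i - \<theta> k"] by simp
        have inV: "e l \<in> V" if "l < n" for l using imE that by blast
        have "normal_dir (\<theta> i) \<bullet> (x (e i) - p) = 0" "normal_dir (\<theta> i) \<bullet> (x (e j) - p) = 0"
          "normal_dir (\<theta> i) \<bullet> (x (e k) - p) = 0"
          unfolding nd[OF b(1)] nd[OF b(2)] nd[OF b(3)] sz(1) sz' by simp_all
        hence sub: "{e i, e j, e k} \<subseteq> {v\<in>V. normal_dir (\<theta> i) \<bullet> (x v - p) = 0}"
          using inV b by blast
        have "e i \<noteq> e j" "e j \<noteq> e k" "e k \<noteq> e i"
          using dist b inj_on_eq_iff[OF injE, of i j] inj_on_eq_iff[OF injE, of j k] inj_on_eq_iff[OF injE, of k i] by simp_all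
        hence "card {e i, e j, e k} = 3" by auto
        moreover have "finite {v\<in>V. normal_dir (\<theta> i) \<bullet> (x v - p) = 0}" using V by simp
        ultimately have "3 \<le> card {v\<in>V. normal_dir (\<theta> i) \<bullet> (x v - p) = 0}"
          using card_mono[OF _ sub] by simp
        thus False using gp[of "normal_dir (\<theta> i)" p] by simp
      qed
    qed
  qed
  have lab_iff: "(t u, t v, t w) \<in> label_cyclic \<longleftrightarrow> x u \<noteq> p \<and> x v \<noteq> p \<and> x w \<noteq> p \<and> cyclic s (idx u) (idx v) (idx w) \<and>
     idx u div L \<noteq> idx v div L \<and> idx v div L \<noteq> idx w div L \<and> idx w div L \<noteq> idx u div L"
    if uvw: "u \<in> V" "v \<in> V" "w \<in> V" for u v w
  proof (cases "x u \<noteq> p \<and> x v \<noteq> p \<and> x w \<noteq> p")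
    case True
    let ?l = "\<lambda>v. (idx v div L, s (idx v) = 1)"
    have ss: "\<bar>s (idx u)\<bar> = 1" "\<bar>s (idx v)\<bar> = 1" "\<bar>s (idx w)\<bar> = 1" using s1 e_idx True uvw by auto
    have "(t u, t v, t w) \<in> label_cyclic \<longleftrightarrow>
      label_orient (?l u) (?l v) \<noteq> 0 \<and> label_orient (?l u) (?l v) = label_orient (?l v) (?l w) \<and> label_orient (?l v) (?l w) = label_orient (?l w) (?l u)"
      using True by (simp add: t_def label_cyclic_def)
    also have "\<dots> \<longleftrightarrow> (idx u div L \<noteq> idx v div L \<and> idx v div L \<noteq> idx w div L \<and> idx w div L \<noteq> idx u div L) \<and>
       label_orient (?l u) (?l v) \<noteq> 0 \<and> label_orient (?l u) (?l v) = label_orient (?l v) (?l w) \<and> label_orient (?l v) (?l w) = label_orient (?l w) (?l u)"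
      using label_orient_nz by metis
    also have "\<dots> \<longleftrightarrow> (idx u div L \<noteq> idx v div L \<and> idx v div L \<noteq> idx w div L \<and> idx w div L \<noteq> idx u div L) \<and>
       cyclic s (idx u) (idx v) (idx w)"
      unfolding cyclic_def
    proof (rule conj_cong[OF refl])
      assume "idx u div L \<noteq> idx v div L \<and> idx v div L \<noteq> idx w div L \<and> idx w div L \<noteq> idx u div L"
      thus "(label_orient (?l u) (?l v) \<noteq> 0 \<and> label_orient (?l u) (?l v) = label_orient (?l v) (?l w) \<and> label_orient (?l v) (?l w) = label_orient (?l w) (?l u))
        \<longleftrightarrow> (orient s (idx u) (idx v) \<noteq> 0 \<and> orient s (idx u) (idx v) = orient s (idx v) (idx w) \<and> orient s (idx v) (idx w) = orient s (idx w) (idx u))"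
        using label_orient_eq_orient[of s "idx u" "idx v" L, OF ss(1,2)]
          label_orient_eq_orient[of s "idx v" "idx w" L, OF ss(2,3)]
          label_orient_eq_orient[of s "idx w" "idx u" L, OF ss(3,1)] by simp
    qed
    finally show ?thesis using True by blast
  next
    case False
    thus ?thesis by (auto simp: t_def label_cyclic_def)
  qed
  show ?thesis
  proof (intro exI[of _ p] exI[of _ t] conjI ballI impI)
    show "t ` V \<subseteq> insert None (Some ` ({..?N div L} \<times> UNIV))"
    proof (rule image_subsetI)
      fix v assume v: "v \<in> V"
      show "t v \<in> insert None (Some ` ({..?N div L} \<times> UNIV))"
      proof (cases "x v = p")
        case False
        hence "idx v \<le> ?N" using e_idx[OF v] nN by fastforce
        thus ?thesis using False by (auto simp: t_def div_le_mono)
      qed (simp add: t_def)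
    qed
    show "p \<in> convex hull {x u, x v, x w}" if "u \<in> V" "v \<in> V" "w \<in> V" "(t u, t v, t w) \<in> label_cyclic" for u v w
      using lab_iff[OF that(1-3)] that contain[of "idx u" "idx v" "idx w"] e_idx by auto
    let ?Y = "{(u,v,w) \<in> cube V. (t u, t v, t w) \<in> label_cyclic}"
    let ?G = "{(i,j,k) \<in> cube {..<n}. cyclic s i j k \<and> i div L \<noteq> j div L \<and> j div L \<noteq> k div L \<and> k div L \<noteq> i div L}"
    have eV: "e i \<in> V \<and> x (e i) \<noteq> p" if "i < n" for i using imE that by auto
    have "card ?G \<le> card ?Y"
    proof (rule card_inj_on_le[where f = "\<lambda>(i,j,k). (e i, e j, e k)"])
      show "inj_on (\<lambda>(i,j,k). (e i, e j, e k)) ?G"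
        by (rule inj_onI) (auto dest: inj_onD[OF injE])
      show "(\<lambda>(i,j,k). (e i, e j, e k)) ` ?G \<subseteq> ?Y"
      proof (rule image_subsetI)
        fix y assume "y \<in> ?G"
        then obtain i j k where y: "y = (i,j,k)" and b: "i < n" "j < n" "k < n" and
          h: "cyclic s i j k" "i div L \<noteq> j div L" "j div L \<noteq> k div L" "k div L \<noteq> i div L" by auto
        have "(t (e i), t (e j), t (e k)) \<in> label_cyclic"
          using lab_iff[of "e i" "e j" "e k"] eV b h by (simp add: idx_e)
        thus "(\<lambda>(i,j,k). (e i, e j, e k)) y \<in> ?Y" using y eV b by simp
      qed
      show "finite ?Y" by (rule finite_subset[of _ "cube V"]) (use V in auto)
    qed
    hence "real (card ?Y) \<ge> real (card ?G)" by simp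
    hence 1: "real (card ?Y) \<ge> real n ^ 3 / 4 - 3 * (\<Sum>i<n. (walk s n i)\<^sup>2) - 4 * (real n)\<^sup>2 - 3 * (real n)\<^sup>2 * real L"
      using card_cyclic_separated_ge[OF L, of n s] card_cyclic_ge[of n s, OF s1] by linarith
    \<comment> \<open>The main terms combine to 1/4 - 3/108 = 2/9, the error terms to 3 * 500 + 4 =
      1504.\<close>
    have 2: "real (card ?Y) \<ge> 2/9 * real n ^ 3 - 1504 * (real n)\<^sup>2 - 3 * (real n)\<^sup>2 * real L"
      using 1 W by linarith
    have n2: "(real n)\<^sup>2 \<le> (real ?N)\<^sup>2" using nN by (intro power_mono) auto
    have n2L: "(real n)\<^sup>2 * real L \<le> (real ?N)\<^sup>2 * real L" using n2 by (intro mult_right_mono) auto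
    have n3: "real ?N ^ 3 - 6 * (real ?N)\<^sup>2 \<le> real n ^ 3"
    proof -
      have c1: "(y - 1) ^ 3 = y ^ 3 - 3 * y\<^sup>2 + 3 * y - 1" and c2: "(y - 2) ^ 3 = y ^ 3 - 6 * y\<^sup>2 + 12 * y - 8" for y :: real
        by (simp_all add: power3_eq_cube power2_eq_square algebra_simps)
      have "?N = n \<or> ?N = n + 1 \<or> ?N = n + 2" using nN by linarith
      then consider "real n = real ?N" | "real n = real ?N - 1" "real ?N \<ge> 1" | "real n = real ?N - 2" "real ?N \<ge> 2"
        by fastforce
      thus ?thesis
      proof cases
        case 1
        show ?thesis unfolding 1 using zero_le_power2[of "real ?N"] by linarith
      next
        case 2
        show ?thesis unfolding 2(1) c1 using 2(2) zero_le_power2[of "real ?N"] by linarith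
      next
        case 3
        show ?thesis unfolding 3(1) c2 using 3(2) zero_le_power2[of "real ?N"] by linarith
      qed
    qed
    \<comment> \<open>At most two vertices sit at p, so n^3 is smaller than the cube of
      \<open>card V\<close> by at most 6 times its square; the loss 6 * 2/9 fits into 1510 -
      1504.\<close>
    show "real (card ?Y) \<ge> 2/9 * real ?N ^ 3 - 1510 * (real ?N)\<^sup>2 - 3 * (real ?N)\<^sup>2 * real L"
      using 2 n2 n2L n3 zero_le_power2[of "real ?N"] by linarith
  qed
qed

section \<open>From point sets in general position to arbitrary maps\<close>

lemma at_most_two_on_line:
  fixes g :: "nat \<Rightarrow> real^2"
  assumes V: "finite V" and nd: "\<And>u v w. \<lbrakk>u \<in> V; v \<in> V; w \<in> V; u \<noteq> v; v \<noteq> w; u \<noteq> w\<rbrakk> \<Longrightarrow> cross2 (g v - g u) (g w - g u) \<noteq> 0"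
    and y: "norm y = 1"
  shows "card {v\<in>V. y \<bullet> (g v - p) = 0} \<le> 2"
proof (rule ccontr)
  assume "\<not> ?thesis"
  hence "3 \<le> card {v\<in>V. y \<bullet> (g v - p) = 0}" by simp
  then obtain T where T: "T \<subseteq> {v\<in>V. y \<bullet> (g v - p) = 0}" "card T = 3" by (rule obtain_subset_with_card_n)
  obtain u v w where uvw: "T = {u,v,w}" "u \<noteq> v" "v \<noteq> w" "u \<noteq> w" using T(2) by (auto simp: card_3_iff)
  have mem: "u \<in> V" "v \<in> V" "w \<in> V" and z: "y \<bullet> (g u - p) = 0" "y \<bullet> (g v - p) = 0" "y \<bullet> (g w - p) = 0"
    using T(1) unfolding uvw(1) by simp_all
  have 1: "y $ 1 * (g v - g u) $ 1 + y $ 2 * (g v - g u) $ 2 = 0" and 2: "y $ 1 * (g w - g u) $ 1 + y $ 2 * (g w - g u) $ 2 = 0"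
    using z unfolding inner_real2 by (simp_all add: algebra_simps)
  define a b c d where "a = (g v - g u) $ 1" and "b = (g v - g u) $ 2" and "c = (g w - g u) $ 1" and "d = (g w - g u) $ 2"
  have e1: "y $ 1 * a + y $ 2 * b = 0" and e2: "y $ 1 * c + y $ 2 * d = 0" using 1 2 by (simp_all add: a_def b_def c_def d_def)
  \<comment> \<open>Eliminating one coordinate of y multiplies the other by the determinant of the
    two difference vectors, as in Cramer's rule.\<close>
  have "y $ 1 * (a * d - b * c) = d * (y $ 1 * a + y $ 2 * b) - b * (y $ 1 * c + y $ 2 * d)" by (simp add: algebra_simps)
  hence y1: "y $ 1 * (a * d - b * c) = 0" unfolding e1 e2 by simp
  have "y $ 2 * (a * d - b * c) = a * (y $ 1 * c + y $ 2 * d) - c * (y $ 1 * a + y $ 2 * b)" by (simp add: algebra_simps)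
  hence y2: "y $ 2 * (a * d - b * c) = 0" unfolding e1 e2 by simp
  have "a * d - b * c \<noteq> 0" using nd[OF mem uvw(2-4)] by (simp add: cross2_def a_def b_def c_def d_def)
  hence "y $ 1 = 0" "y $ 2 = 0" using y1 y2 by simp_all
  hence "y = 0" by (simp add: real2_eq_iff)
  thus False using y by simp
qed

text \<open>
  Shift along the moment curve: each collinearity determinant is then a quadratic polynomial in
  the shift parameter whose leading coefficient is a Vandermonde determinant.
\<close>
lemma generic_perturbation:
  fixes f :: "nat \<Rightarrow> real^2"
  assumes V: "finite V" and e: "\<epsilon> > 0"
  shows "\<exists>g. (\<forall>v\<in>V. norm (g v - f v) \<le> \<epsilon>) \<and> (\<forall>p y. norm y = 1 \<longrightarrow> card {v\<in>V. y \<bullet> (g v - p) = 0} \<le> 2)"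
proof -
  define c :: "nat \<Rightarrow> real^2" where "c v = (\<chi> i. if i = 1 then real v else (real v)\<^sup>2)" for v
  have c: "c v $ 1 = real v" "c v $ 2 = (real v)\<^sup>2" for v by (simp_all add: c_def)
  define g where "g s v = f v + s *\<^sub>R c v" for s v
  define D where "D s = (\<lambda>(u,v,w). cross2 (g s v - g s u) (g s w - g s u))" for s
  let ?T = "{(u,v,w) \<in> cube V. u \<noteq> v \<and> v \<noteq> w \<and> u \<noteq> w}"
  have fin: "finite {s. D s x = 0}" if x: "x \<in> ?T" for x
  proof -
    obtain u v w where uvw: "x = (u,v,w)" "u \<noteq> v" "v \<noteq> w" "u \<noteq> w" using x by auto
    define A where "A = cross2 (f v - f u) (f w - f u)"
    define B where "B = (real v - real u) * (f w - f u) $ 2 + (f v - f u) $ 1 * ((real w)\<^sup>2 - (real u)\<^sup>2)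
      - ((real v)\<^sup>2 - (real u)\<^sup>2) * (f w - f u) $ 1 - (f v - f u) $ 2 * (real w - real u)"
    define C where "C = (real v - real u) * (real w - real u) * (real w - real v)"
    have "D s x = poly [:A, B, C:] s" for s
      unfolding D_def uvw(1) prod.case cross2_def g_def A_def B_def C_def
      by (simp add: c algebra_simps power2_eq_square)
    moreover have "[:A, B, C:] \<noteq> 0" using uvw by (simp add: C_def)
    ultimately show ?thesis using poly_roots_finite[of "[:A, B, C:]"] by simp
  qed
  have "finite ?T" by (rule finite_subset[of _ "cube V"]) (use V in auto)
  hence finB: "finite (\<Union>x\<in>?T. {s. D s x = 0})" using fin by (intro finite_UN_I)
  define R where "R = 1 + (\<Sum>v\<in>V. norm (c v))"
  have R: "R > 0" unfolding R_def by (simp add: add_pos_nonneg sum_nonneg)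
  have "infinite {0<..<\<epsilon> / R}" using e R by (intro infinite_Ioo) simp
  then obtain s where s: "s \<in> {0<..<\<epsilon> / R}" "s \<notin> (\<Union>x\<in>?T. {s. D s x = 0})"
    using finite_subset[OF _ finB] by blast
  have "norm (g s v - f v) \<le> \<epsilon>" if "v \<in> V" for v
  proof -
    have "norm (c v) \<le> R" unfolding R_def using member_le_sum[of v V "\<lambda>v. norm (c v)"] V that by simp
    hence "s * norm (c v) \<le> (\<epsilon> / R) * R" using s(1) R e by (intro mult_mono) auto
    thus ?thesis using s(1) R by (simp add: g_def)
  qed
  moreover have "card {v\<in>V. y \<bullet> (g s v - p) = 0} \<le> 2" if "norm y = 1" for y p
  proof (rule at_most_two_on_line[OF V _ that])
    fix u v w assume "u \<in> V" "v \<in> V" "w \<in> V" "u \<noteq> v" "v \<noteq> w" "u \<noteq> w"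
    hence "(u,v,w) \<in> ?T" by simp
    hence "D s (u,v,w) \<noteq> 0" using s(2) by blast
    thus "cross2 (g s v - g s u) (g s w - g s u) \<noteq> 0" by (simp add: D_def)
  qed
  ultimately show ?thesis by blast
qed

text \<open>The same convex weights applied to the limit triangle give a point within \<epsilon> n
  of \<open>p n\<close>; the limit triangle is closed.\<close>

lemma triangle_limit:
  fixes p :: "nat \<Rightarrow> real^2"
  assumes p: "p \<longlonglongrightarrow> P" and eps: "\<epsilon> \<longlonglongrightarrow> 0"
    and mem: "\<And>n. p n \<in> convex hull {g n u, g n v, g n w}"
    and close: "\<And>n. norm (g n u - f u) \<le> \<epsilon> n" "\<And>n. norm (g n v - f v) \<le> \<epsilon> n" "\<And>n. norm (g n w - f w) \<le> \<epsilon> n"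
  shows "P \<in> convex hull {f u, f v, f w}"
proof -
  have "\<exists>q. q \<in> convex hull {f u, f v, f w} \<and> norm (p n - q) \<le> \<epsilon> n" for n
  proof -
    obtain \<alpha> \<beta> \<gamma> where h: "0 \<le> \<alpha>" "0 \<le> \<beta>" "0 \<le> \<gamma>" "\<alpha> + \<beta> + \<gamma> = 1" "p n = \<alpha> *\<^sub>R g n u + \<beta> *\<^sub>R g n v + \<gamma> *\<^sub>R g n w"
      using mem[of n] unfolding convex_hull_3 by blast
    let ?q = "\<alpha> *\<^sub>R f u + \<beta> *\<^sub>R f v + \<gamma> *\<^sub>R f w"
    have "?q \<in> convex hull {f u, f v, f w}" unfolding convex_hull_3 using h by blast
    moreover have "norm (p n - ?q) \<le> \<epsilon> n"
    proof -
      have "p n - ?q = \<alpha> *\<^sub>R (g n u - f u) + \<beta> *\<^sub>R (g n v - f v) + \<gamma> *\<^sub>R (g n w - f w)"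
        unfolding h(5) by (simp add: algebra_simps)
      also have "norm \<dots> \<le> norm (\<alpha> *\<^sub>R (g n u - f u)) + norm (\<beta> *\<^sub>R (g n v - f v)) + norm (\<gamma> *\<^sub>R (g n w - f w))"
        by (rule order_trans[OF norm_triangle_ineq add_right_mono[OF norm_triangle_ineq]])
      also have "\<dots> \<le> \<alpha> * \<epsilon> n + \<beta> * \<epsilon> n + \<gamma> * \<epsilon> n"
        using h(1-3) close[of n] by (intro add_mono) (simp_all add: mult_left_mono)
      also have "\<dots> = \<epsilon> n" using h(4) by (simp add: distrib_right[symmetric])
      finally show ?thesis .
    qed
    ultimately show ?thesis by blast
  qed
  then obtain q where q: "\<And>n. q n \<in> convex hull {f u, f v, f w}" "\<And>n. norm (p n - q n) \<le> \<epsilon> n" by metis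
  have "(\<lambda>n. p n - q n) \<longlonglongrightarrow> 0"
    by (rule Lim_null_comparison[OF _ eps]) (use q(2) in simp)
  from tendsto_diff[OF p this] have "q \<longlonglongrightarrow> P" by simp
  moreover have "closed (convex hull {f u, f v, f w})"
    by (intro compact_imp_closed finite_imp_compact_convex_hull) simp
  ultimately show ?thesis using q(1) closed_sequentially by blast
qed

text \<open>The map is approximated by generic ones. The label set depends only on the number of
  vertices and on L, so one labelling occurs infinitely often, and along it the points have a limit
  that serves all its cyclic triples at once.\<close>

lemma labelled_cyclic_triples_all:
  fixes f :: "nat \<Rightarrow> real^2"
  assumes V: "finite V" "V \<noteq> {}" and L: "L > 0"
  shows "\<exists>p t. t ` V \<subseteq> insert None (Some ` ({..card V div L} \<times> UNIV)) \<and>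
     (\<forall>u\<in>V. \<forall>v\<in>V. \<forall>w\<in>V. (t u, t v, t w) \<in> label_cyclic \<longrightarrow> p \<in> convex hull {f u, f v, f w}) \<and>
     real (card {(u,v,w) \<in> cube V. (t u, t v, t w) \<in> label_cyclic})
       \<ge> 2/9 * real (card V) ^ 3 - 1510 * (real (card V))\<^sup>2 - 3 * (real (card V))\<^sup>2 * real L"
proof -
  let ?C = "insert None (Some ` ({..card V div L} \<times> UNIV)) :: (nat \<times> bool) option set"
  let ?b = "2/9 * real (card V) ^ 3 - 1510 * (real (card V))\<^sup>2 - 3 * (real (card V))\<^sup>2 * real L"
  define \<epsilon> where "\<epsilon> n = 1 / real (Suc n)" for n
  have \<epsilon>: "\<epsilon> n > 0" "\<epsilon> n \<le> 1" for n by (simp_all add: \<epsilon>_def)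
  have \<epsilon>0: "\<epsilon> \<longlonglongrightarrow> 0" unfolding \<epsilon>_def[abs_def] by (rule LIMSEQ_Suc[OF lim_1_over_n])
  have "\<forall>n. \<exists>g. (\<forall>v\<in>V. norm (g v - f v) \<le> \<epsilon> n) \<and> (\<forall>p y. norm y = 1 \<longrightarrow> card {v\<in>V. y \<bullet> (g v - p) = 0} \<le> 2)"
    by (intro allI generic_perturbation[OF V(1) \<epsilon>(1)])
  from choice[OF this] obtain g where gg: "\<forall>n. (\<forall>v\<in>V. norm (g n v - f v) \<le> \<epsilon> n) \<and>
    (\<forall>p y. norm y = 1 \<longrightarrow> card {v\<in>V. y \<bullet> (g n v - p) = 0} \<le> 2)" by (rule exE)
  have g: "\<And>n v. v \<in> V \<Longrightarrow> norm (g n v - f v) \<le> \<epsilon> n"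
    "\<And>n p y. norm y = 1 \<Longrightarrow> card {v\<in>V. y \<bullet> (g n v - p) = 0} \<le> 2"
    using conjunct1[OF gg[THEN spec]] conjunct2[OF gg[THEN spec]] by blast+
  let ?P = "\<lambda>n p t. t ` V \<subseteq> ?C \<and>
     (\<forall>u\<in>V. \<forall>v\<in>V. \<forall>w\<in>V. (t u, t v, t w) \<in> label_cyclic \<longrightarrow> p \<in> convex hull {g n u, g n v, g n w}) \<and>
     real (card {(u,v,w) \<in> cube V. (t u, t v, t w) \<in> label_cyclic}) \<ge> ?b"
  have "\<forall>n. \<exists>p t. ?P n p t"
  proof
    fix n
    show "\<exists>p t. ?P n p t" by (rule labelled_cyclic_triples[OF V L g(2)])
  qed
  from choice[OF this] obtain p where "\<forall>n. \<exists>t. ?P n (p n) t" by (rule exE)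
  from choice[OF this] obtain t where P: "\<forall>n. ?P n (p n) (t n)" by (rule exE)
  note Pn = P[THEN spec]
  define T where "T n = restrict (t n) V" for n
  have TV: "T n v = t n v" if "v \<in> V" for n v using that by (simp add: T_def)
  have "T n \<in> V \<rightarrow>\<^sub>E ?C" for n
  proof -
    have "t n ` V \<subseteq> ?C" by (rule conjunct1[OF Pn])
    thus ?thesis unfolding T_def by (intro restrict_PiE_iff[THEN iffD2] ballI) blast
  qed
  hence "range T \<subseteq> V \<rightarrow>\<^sub>E ?C" by (intro image_subsetI)
  moreover have "finite (V \<rightarrow>\<^sub>E ?C)" using V by (intro finite_PiE) simp_all
  ultimately have "finite (range T)" by (rule finite_subset)
  from pigeonhole_infinite[OF infinite_UNIV_nat this] obtain n0 where "infinite {n \<in> UNIV. T n = T n0}" by blast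
  then obtain r :: "nat \<Rightarrow> nat" where r: "strict_mono r" "\<And>n. r n \<in> {n \<in> UNIV. T n = T n0}" using infinite_enumerate by blast
  have tr: "t (r n) v = t n0 v" if "v \<in> V" for n v
  proof -
    have "T (r n) = T n0" using r(2)[of n] by simp
    thus ?thesis using TV[OF that, of "r n"] TV[OF that, of n0] by simp
  qed
  have base: "t n0 ` V \<subseteq> ?C" "real (card {(u,v,w) \<in> cube V. (t n0 u, t n0 v, t n0 w) \<in> label_cyclic}) \<ge> ?b"
    by (rule conjunct1[OF Pn], rule conjunct2[OF conjunct2[OF Pn]])
  have good: "p (r n) \<in> convex hull {g (r n) u, g (r n) v, g (r n) w}"
    if "u \<in> V" "v \<in> V" "w \<in> V" "(t n0 u, t n0 v, t n0 w) \<in> label_cyclic" for u v w n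
  proof -
    have "(t (r n) u, t (r n) v, t (r n) w) \<in> label_cyclic" using that(4) unfolding tr[OF that(1)] tr[OF that(2)] tr[OF that(3)] .
    thus ?thesis using conjunct1[OF conjunct2[OF Pn[of "r n"]]] that(1-3) by blast
  qed
  show ?thesis
  proof (cases "\<exists>u\<in>V. \<exists>v\<in>V. \<exists>w\<in>V. (t n0 u, t n0 v, t n0 w) \<in> label_cyclic")
    case True
    then obtain u0 v0 w0 where uvw: "u0 \<in> V" "v0 \<in> V" "w0 \<in> V" "(t n0 u0, t n0 v0, t n0 w0) \<in> label_cyclic" by blast
    define M where "M = 1 + (\<Sum>v\<in>V. norm (f v))"
    have gM: "norm (g n v) \<le> M" if "v \<in> V" for n v
    proof -
      have "norm (f v) \<le> (\<Sum>v\<in>V. norm (f v))" using V that by (intro member_le_sum) auto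
      moreover have "norm (g n v) \<le> norm (g n v - f v) + norm (f v)" using norm_triangle_ineq[of "g n v - f v" "f v"] by simp
      ultimately show ?thesis using g(1)[OF that, of n] \<epsilon>(2)[of n] unfolding M_def by linarith
    qed
    \<comment> \<open>One cyclic triple suffices for boundedness: its perturbed triangles stay in a
      fixed ball and contain the points.\<close>
    have "p (r n) \<in> cball 0 M" for n
    proof -
      have "{g (r n) u0, g (r n) v0, g (r n) w0} \<subseteq> cball 0 M" using gM uvw by (simp add: dist_norm)
      hence "convex hull {g (r n) u0, g (r n) v0, g (r n) w0} \<subseteq> cball 0 M" by (intro hull_minimal convex_cball)
      thus ?thesis using good[OF uvw, of n] by blast
    qed
    hence "\<forall>n. (p \<circ> r) n \<in> cball 0 M" by simp
    then obtain pp q where q: "strict_mono q" "((p \<circ> r) \<circ> q) \<longlonglongrightarrow> pp"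
      using compact_cball[of "0::real^2" M] unfolding compact_def by blast
    have rq: "strict_mono (r \<circ> q)" using r(1) q(1) by (rule strict_mono_o)
    have lim: "pp \<in> convex hull {f u, f v, f w}"
      if b: "u \<in> V" "v \<in> V" "w \<in> V" "(t n0 u, t n0 v, t n0 w) \<in> label_cyclic" for u v w
    proof (rule triangle_limit[where p = "\<lambda>n. p (r (q n))" and \<epsilon> = "\<lambda>n. \<epsilon> (r (q n))" and g = "\<lambda>n. g (r (q n))"])
      show "(\<lambda>n. p (r (q n))) \<longlonglongrightarrow> pp" using q(2) by (simp add: comp_def)
      show "(\<lambda>n. \<epsilon> (r (q n))) \<longlonglongrightarrow> 0" using LIMSEQ_subseq_LIMSEQ[OF \<epsilon>0 rq] by (simp add: comp_def)
      show "p (r (q n)) \<in> convex hull {g (r (q n)) u, g (r (q n)) v, g (r (q n)) w}" for n by (rule good[OF b])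
    qed (rule g(1), fact b)+
    show ?thesis
      by (rule exI[of _ pp], rule exI[of _ "t n0"], intro conjI base ballI impI, rule lim)
  next
    case False
    \<comment> \<open>Without a cyclic triple the containment claim is vacuous, so any point will
      do; 0 is a default.\<close>
    show ?thesis
      by (rule exI[of _ 0], rule exI[of _ "t n0"], intro conjI base ballI impI) (use False in blast)
  qed
qed

section \<open>Random types\<close>

lemma sum_PiE_union:
  fixes F :: "('a \<Rightarrow> 'b) \<Rightarrow> real"
  assumes "A \<inter> B = {}"
  shows "(\<Sum>t\<in>(A \<union> B) \<rightarrow>\<^sub>E T. F t) = (\<Sum>(f,g)\<in>(A \<rightarrow>\<^sub>E T) \<times> (B \<rightarrow>\<^sub>E T). F (\<lambda>x\<in>A \<union> B. if x \<in> A then f x else g x))"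
proof (rule sum.reindex_bij_witness[where j = "\<lambda>t. (restrict t A, restrict t B)" and
    i = "\<lambda>(f,g). \<lambda>x\<in>A \<union> B. if x \<in> A then f x else g x"])
  fix t assume t: "t \<in> (A \<union> B) \<rightarrow>\<^sub>E T"
  have eq: "(\<lambda>x\<in>A \<union> B. if x \<in> A then restrict t A x else restrict t B x) = t"
    using t by (auto simp: fun_eq_iff PiE_iff extensional_def restrict_def)
  show "(case (restrict t A, restrict t B) of (f,g) \<Rightarrow> \<lambda>x\<in>A \<union> B. if x \<in> A then f x else g x) = t"
    using eq by simp
  show "(restrict t A, restrict t B) \<in> (A \<rightarrow>\<^sub>E T) \<times> (B \<rightarrow>\<^sub>E T)" using t by (auto simp: PiE_iff)
  show "(case (restrict t A, restrict t B) of (f,g) \<Rightarrow> F (\<lambda>x\<in>A \<union> B. if x \<in> A then f x else g x)) = F t"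
    using eq by simp
next
  fix b assume "b \<in> (A \<rightarrow>\<^sub>E T) \<times> (B \<rightarrow>\<^sub>E T)"
  then obtain f g where b: "b = (f,g)" and f: "f \<in> A \<rightarrow>\<^sub>E T" and g: "g \<in> B \<rightarrow>\<^sub>E T" by auto
  let ?m = "\<lambda>x\<in>A \<union> B. if x \<in> A then f x else g x"
  have "restrict ?m A = f" using f by (auto simp: fun_eq_iff PiE_iff extensional_def restrict_def)
  moreover have "restrict ?m B = g" using g assms by (auto simp: fun_eq_iff PiE_iff extensional_def restrict_def)
  ultimately show "(restrict (case b of (f,g) \<Rightarrow> \<lambda>x\<in>A \<union> B. if x \<in> A then f x else g x) A,
        restrict (case b of (f,g) \<Rightarrow> \<lambda>x\<in>A \<union> B. if x \<in> A then f x else g x) B) = b" using b by simp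
  show "(case b of (f,g) \<Rightarrow> \<lambda>x\<in>A \<union> B. if x \<in> A then f x else g x) \<in> (A \<union> B) \<rightarrow>\<^sub>E T"
    using f g b by (auto simp: PiE_iff)
qed

text \<open>The probability that the set of types of a fixed edge lies in \<open>Q\<close> when its
  vertices receive independent uniform types. Families of sets are used because edges are unordered;
  types may coincide.\<close>

definition pattern_density :: "nat \<Rightarrow> nat set set \<Rightarrow> real" where
  "pattern_density m Q = real (card {(a,b,c) \<in> cube {..<m}. {a,b,c} \<in> Q}) / real m ^ 3"

lemma sum_PiE_triple:
  fixes g :: "nat set \<Rightarrow> real"
  assumes e: "card e = 3"
  shows "(\<Sum>t\<in>e \<rightarrow>\<^sub>E {..<m}. g (t ` e)) = (\<Sum>(a,b,c)\<in>cube {..<m}. g {a,b,c})"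
proof -
  from e obtain u v w where e: "e = {u,v,w}" "u \<noteq> v" "v \<noteq> w" "u \<noteq> w" by (auto simp: card_3_iff)
  show ?thesis
  proof (rule sum.reindex_bij_witness[where j = "\<lambda>t. (t u, t v, t w)" and
      i = "\<lambda>(a,b,c). \<lambda>x\<in>e. if x = u then a else if x = v then b else c"])
    fix t assume t: "t \<in> e \<rightarrow>\<^sub>E {..<m}"
    show "(case (t u, t v, t w) of (a,b,c) \<Rightarrow> \<lambda>x\<in>e. if x = u then a else if x = v then b else c) = t"
      using t e by (auto simp: fun_eq_iff PiE_iff extensional_def restrict_def)
    show "(t u, t v, t w) \<in> cube {..<m}" using t e by (auto simp: PiE_iff)
    show "(case (t u, t v, t w) of (a,b,c) \<Rightarrow> g {a,b,c}) = g (t ` e)" using e by simp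
  next
    fix b assume "b \<in> cube {..<m}"
    thus "(case (case b of (a,b,c) \<Rightarrow> \<lambda>x\<in>e. if x = u then a else if x = v then b else c) of t \<Rightarrow> (t u, t v, t w)) = b"
      "(case b of (a,b,c) \<Rightarrow> \<lambda>x\<in>e. if x = u then a else if x = v then b else c) \<in> e \<rightarrow>\<^sub>E {..<m}"
      using e by (auto simp: PiE_iff)
  qed
qed

lemma sum_pattern_triple:
  assumes e: "card e = 3" and m: "m > 0"
  shows "(\<Sum>t\<in>e \<rightarrow>\<^sub>E {..<m}. of_bool (t ` e \<in> Q) - pattern_density m Q) = 0"
proof -
  let ?T = "cube {..<m}"
  have "(\<Sum>t\<in>e \<rightarrow>\<^sub>E {..<m}. of_bool (t ` e \<in> Q) - pattern_density m Q)
     = (\<Sum>(a,b,c)\<in>?T. of_bool ({a,b,c} \<in> Q) - pattern_density m Q)"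
    using sum_PiE_triple[OF e, of "\<lambda>y. of_bool (y \<in> Q) - pattern_density m Q"] .
  also have "\<dots> = (\<Sum>y\<in>?T. of_bool (case y of (a,b,c) \<Rightarrow> {a,b,c} \<in> Q) - pattern_density m Q)"
    by (intro sum.cong) auto
  also have "\<dots> = (\<Sum>y\<in>?T. of_bool (case y of (a,b,c) \<Rightarrow> {a,b,c} \<in> Q)) - real m ^ 3 * pattern_density m Q"
    by (simp add: sum_subtractf card_cartesian_product power3_eq_cube mult.assoc)
  also have "(\<Sum>y\<in>?T. of_bool (case y of (a,b,c) \<Rightarrow> {a,b,c} \<in> Q)) = real (card {(a,b,c) \<in> ?T. {a,b,c} \<in> Q})"
  proof -
    have "?T \<inter> {y. case y of (a,b,c) \<Rightarrow> {a,b,c} \<in> Q} = {(a,b,c) \<in> ?T. {a,b,c} \<in> Q}" by auto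
    thus ?thesis by (subst sum_of_bool_eq) simp_all
  qed
  finally show ?thesis using m by (simp add: pattern_density_def)
qed

text \<open>Disjoint edges have independent types, so the sum splits into a product whose first
  factor is a centred sum.\<close>

lemma covariance_disjoint:
  fixes V :: "'a set"
  assumes V: "finite V" "e \<subseteq> V" "e' \<subseteq> V" "e \<inter> e' = {}" and e: "card e = 3" and m: "m > 0"
  shows "(\<Sum>t\<in>V \<rightarrow>\<^sub>E {..<m}. (of_bool (t ` e \<in> Q) - pattern_density m Q) * (of_bool (t ` e' \<in> Q) - pattern_density m Q)) = 0"
proof -
  let ?q = "pattern_density m Q"
  let ?B = "V - e"
  have U: "e \<union> ?B = V" using V by auto
  have "(\<Sum>t\<in>V \<rightarrow>\<^sub>E {..<m}. (of_bool (t ` e \<in> Q) - ?q) * (of_bool (t ` e' \<in> Q) - ?q))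
    = (\<Sum>(f,g)\<in>(e \<rightarrow>\<^sub>E {..<m}) \<times> (?B \<rightarrow>\<^sub>E {..<m}). (of_bool ((\<lambda>x\<in>e \<union> ?B. if x \<in> e then f x else g x) ` e \<in> Q) - ?q) *
        (of_bool ((\<lambda>x\<in>e \<union> ?B. if x \<in> e then f x else g x) ` e' \<in> Q) - ?q))"
    using sum_PiE_union[of e ?B "\<lambda>t. (of_bool (t ` e \<in> Q) - ?q) * (of_bool (t ` e' \<in> Q) - ?q)" "{..<m}"] unfolding U by simp
  also have "\<dots> = (\<Sum>(f,g)\<in>(e \<rightarrow>\<^sub>E {..<m}) \<times> (?B \<rightarrow>\<^sub>E {..<m}). (of_bool (f ` e \<in> Q) - ?q) * (of_bool (g ` e' \<in> Q) - ?q))"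
  proof (intro sum.cong refl, clarify)
    fix f g :: "'a \<Rightarrow> nat"
    have 1: "(\<lambda>x\<in>e \<union> ?B. if x \<in> e then f x else g x) ` e = f ` e" by (intro image_cong) auto
    have 2: "(\<lambda>x\<in>e \<union> ?B. if x \<in> e then f x else g x) ` e' = g ` e'" using V by (intro image_cong) auto
    show "(of_bool ((\<lambda>x\<in>e \<union> ?B. if x \<in> e then f x else g x) ` e \<in> Q) - ?q) *
        (of_bool ((\<lambda>x\<in>e \<union> ?B. if x \<in> e then f x else g x) ` e' \<in> Q) - ?q)
      = (of_bool (f ` e \<in> Q) - ?q) * (of_bool (g ` e' \<in> Q) - ?q)" unfolding 1 2 ..
  qed
  also have "\<dots> = (\<Sum>f\<in>e \<rightarrow>\<^sub>E {..<m}. of_bool (f ` e \<in> Q) - ?q) * (\<Sum>g\<in>?B \<rightarrow>\<^sub>E {..<m}. of_bool (g ` e' \<in> Q) - ?q)"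
    by (simp only: sum_product sum.cartesian_product)
  also have "\<dots> = 0" unfolding sum_pattern_triple[OF e m] by simp
  finally show ?thesis .
qed

lemma pattern_density_bounds:
  assumes "m > 0" shows "0 \<le> pattern_density m Q" "pattern_density m Q \<le> 1"
proof -
  have "card {(a,b,c) \<in> cube {..<m}. {a,b,c} \<in> Q} \<le> card (cube {..<m})"
    by (intro card_mono) auto
  hence "real (card {(a,b,c) \<in> cube {..<m}. {a,b,c} \<in> Q}) \<le> real (m ^ 3)"
    by (simp only: of_nat_le_iff card_cartesian_product power3_eq_cube mult.assoc card_lessThan)
  thus "pattern_density m Q \<le> 1" unfolding pattern_density_def using assms by (simp add: divide_le_eq_1)
qed (simp add: pattern_density_def)

lemma card_intersecting_edges_le:
  assumes H: "three_uniform_hypergraph V E" and R: "regular_hypergraph k V E" and e: "e \<in> E"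
  shows "card {e'\<in>E. e \<inter> e' \<noteq> {}} \<le> 3 * k"
proof -
  have eV: "e \<subseteq> V" "card e = 3" using H e by (auto simp: three_uniform_hypergraph_def)
  hence fe: "finite e" by (simp add: card_ge_0_finite)
  have "{e'\<in>E. e \<inter> e' \<noteq> {}} = (\<Union>v\<in>e. {e'\<in>E. v \<in> e'})" by auto
  hence "card {e'\<in>E. e \<inter> e' \<noteq> {}} \<le> (\<Sum>v\<in>e. card {e'\<in>E. v \<in> e'})" using card_UN_le[OF fe] by simp
  also have "\<dots> = (\<Sum>v\<in>e. k)" using R eV by (intro sum.cong) (auto simp: regular_hypergraph_def)
  finally show ?thesis using eV by simp
qed

text \<open>After expanding the square only pairs of intersecting edges survive, at most
  \<open>3 * k\<close> for each edge, and each contributes at most 1 per assignment.\<close>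

lemma second_moment_pattern:
  assumes H: "three_uniform_hypergraph V E" and R: "regular_hypergraph k V E" and m: "m > 0"
  shows "(\<Sum>t\<in>V \<rightarrow>\<^sub>E {..<m}. (real (card {e\<in>E. t ` e \<in> Q}) - pattern_density m Q * real (card E))\<^sup>2)
     \<le> real m ^ card V * (3 * real k * real (card E))"
proof -
  let ?q = "pattern_density m Q"
  let ?Y = "\<lambda>e t. of_bool (t ` e \<in> Q) - ?q"
  have V: "finite V" and EV: "\<And>e. e \<in> E \<Longrightarrow> e \<subseteq> V \<and> card e = 3" using H by (auto simp: three_uniform_hypergraph_def)
  have E: "finite E" using V EV by (intro finite_subset[of E "Pow V"]) auto
  have cO: "real (card (V \<rightarrow>\<^sub>E {..<m})) = real m ^ card V" using V by (simp add: card_PiE)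
  have Y: "real (card {e\<in>E. t ` e \<in> Q}) - ?q * real (card E) = (\<Sum>e\<in>E. ?Y e t)" for t
  proof -
    have "(\<Sum>e\<in>E. of_bool (t ` e \<in> Q)) = real (card {e\<in>E. t ` e \<in> Q})"
    proof -
      have "E \<inter> {e. t ` e \<in> Q} = {e\<in>E. t ` e \<in> Q}" by auto
      thus ?thesis by (subst sum_of_bool_eq) (use E in simp_all)
    qed
    thus ?thesis by (simp add: sum_subtractf)
  qed
  have Yb: "\<bar>?Y e t\<bar> \<le> 1" for e t
    using pattern_density_bounds[OF m, of Q] by (cases "t ` e \<in> Q") simp_all
  have "(\<Sum>t\<in>V \<rightarrow>\<^sub>E {..<m}. (real (card {e\<in>E. t ` e \<in> Q}) - ?q * real (card E))\<^sup>2)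
    = (\<Sum>t\<in>V \<rightarrow>\<^sub>E {..<m}. \<Sum>e\<in>E. \<Sum>e'\<in>E. ?Y e t * ?Y e' t)"
    unfolding Y power2_eq_square sum_product ..
  also have "\<dots> = (\<Sum>e\<in>E. \<Sum>t\<in>V \<rightarrow>\<^sub>E {..<m}. \<Sum>e'\<in>E. ?Y e t * ?Y e' t)" by (rule sum.swap)
  also have "\<dots> = (\<Sum>e\<in>E. \<Sum>e'\<in>E. \<Sum>t\<in>V \<rightarrow>\<^sub>E {..<m}. ?Y e t * ?Y e' t)" by (intro sum.cong refl sum.swap)
  also have "\<dots> \<le> (\<Sum>e\<in>E. \<Sum>e'\<in>E. if e \<inter> e' \<noteq> {} then real m ^ card V else 0)"
  proof (intro sum_mono)
    fix e e' assume e: "e \<in> E" "e' \<in> E"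
    show "(\<Sum>t\<in>V \<rightarrow>\<^sub>E {..<m}. ?Y e t * ?Y e' t) \<le> (if e \<inter> e' \<noteq> {} then real m ^ card V else 0)"
    proof (cases "e \<inter> e' = {}")
      case True
      thus ?thesis using covariance_disjoint[OF V _ _ True _ m, of Q] EV e by simp
    next
      case False
      have "(\<Sum>t\<in>V \<rightarrow>\<^sub>E {..<m}. ?Y e t * ?Y e' t) \<le> (\<Sum>t\<in>V \<rightarrow>\<^sub>E {..<m}. 1)"
      proof (rule sum_mono)
        fix t
        have "\<bar>?Y e t * ?Y e' t\<bar> \<le> 1 * 1" unfolding abs_mult by (intro mult_mono Yb) auto
        thus "?Y e t * ?Y e' t \<le> 1" by linarith
      qed
      also have "\<dots> = real m ^ card V" using cO by simp
      finally show ?thesis using False by simp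
    qed
  qed
  also have "\<dots> = (\<Sum>e\<in>E. real (card {e'\<in>E. e \<inter> e' \<noteq> {}}) * real m ^ card V)"
  proof (rule sum.cong[OF refl])
    fix e
    have "(\<Sum>e'\<in>E. if e \<inter> e' \<noteq> {} then real m ^ card V else 0) = (\<Sum>e'\<in>{e'\<in>E. e \<inter> e' \<noteq> {}}. real m ^ card V)"
      by (rule sum.inter_filter[OF E, symmetric])
    thus "(\<Sum>e'\<in>E. if e \<inter> e' \<noteq> {} then real m ^ card V else 0) = real (card {e'\<in>E. e \<inter> e' \<noteq> {}}) * real m ^ card V"
      by simp
  qed
  also have "\<dots> \<le> (\<Sum>e\<in>E. real (3 * k) * real m ^ card V)"
  proof (intro sum_mono mult_right_mono)
    fix e assume "e \<in> E"
    from card_intersecting_edges_le[OF H R this]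
    show "real (card {e'\<in>E. e \<inter> e' \<noteq> {}}) \<le> real (3 * k)" by (simp only: of_nat_le_iff)
  qed simp
  also have "\<dots> = real m ^ card V * (3 * real k * real (card E))" by simp
  finally show ?thesis .
qed

text \<open>Chebyshev's inequality together with a union bound over all 2^(2^m) families Q. Having
  all families at once is what later covers every point of the plane with one assignment.\<close>

lemma typical_types_exist:
  assumes H: "three_uniform_hypergraph V E" and R: "regular_hypergraph k V E" and m: "m > 0" and d: "\<delta> > 0"
    and large: "\<delta>\<^sup>2 * real (card E) > 2 ^ (2 ^ m) * (3 * real k)"
  shows "\<exists>t. t ` V \<subseteq> {..<m} \<and> (\<forall>Q. Q \<subseteq> Pow {..<m} \<longrightarrow>
     real (card {e\<in>E. t ` e \<in> Q}) \<le> (pattern_density m Q + \<delta>) * real (card E))"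
proof (rule ccontr)
  assume neg: "\<not> ?thesis"
  let ?Om = "V \<rightarrow>\<^sub>E {..<m}"
  let ?X = "\<lambda>Q t. (real (card {e\<in>E. t ` e \<in> Q}) - pattern_density m Q * real (card E))\<^sup>2"
  have V: "finite V" using H by (auto simp: three_uniform_hypergraph_def)
  have cO: "real (card ?Om) = real m ^ card V" using V by (simp add: card_PiE)
  have cE: "real (card E) > 0"
  proof (rule ccontr)
    assume "\<not> ?thesis"
    hence "real (card E) = 0" by simp
    hence "\<delta>\<^sup>2 * real (card E) = 0" by simp
    moreover have "(0::real) \<le> 2 ^ (2 ^ m) * (3 * real k)" by (rule mult_nonneg_nonneg) simp_all
    ultimately show False using large by linarith
  qed
  have fP: "finite (Pow (Pow {..<m}))" by simp
  \<comment> \<open>An assignment that fails for some Q contributes at least the square of \<delta>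
    times the edge count to the total of all squared deviations, so universal failure contradicts
    the second moment bound.\<close>
  have low: "(\<delta> * real (card E))\<^sup>2 \<le> (\<Sum>Q\<in>Pow (Pow {..<m}). ?X Q t)" if t: "t \<in> ?Om" for t
  proof -
    have tV: "t ` V \<subseteq> {..<m}" using t by auto
    have "\<not> (\<forall>Q. Q \<subseteq> Pow {..<m} \<longrightarrow>
       real (card {e\<in>E. t ` e \<in> Q}) \<le> (pattern_density m Q + \<delta>) * real (card E))"
    proof
      assume "\<forall>Q. Q \<subseteq> Pow {..<m} \<longrightarrow>
        real (card {e\<in>E. t ` e \<in> Q}) \<le> (pattern_density m Q + \<delta>) * real (card E)"
      with tV have "\<exists>t. t ` V \<subseteq> {..<m} \<and> (\<forall>Q. Q \<subseteq> Pow {..<m} \<longrightarrow>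
        real (card {e\<in>E. t ` e \<in> Q}) \<le> (pattern_density m Q + \<delta>) * real (card E))"
        by (intro exI[of _ t] conjI)
      with neg show False by (rule notE)
    qed
    then obtain Q where Q: "Q \<subseteq> Pow {..<m}" "\<not> real (card {e\<in>E. t ` e \<in> Q}) \<le> (pattern_density m Q + \<delta>) * real (card E)"
      by (simp only: not_all not_imp) (elim exE conjE)
    hence "\<delta> * real (card E) \<le> real (card {e\<in>E. t ` e \<in> Q}) - pattern_density m Q * real (card E)"
      by (simp add: algebra_simps)
    hence "(\<delta> * real (card E))\<^sup>2 \<le> ?X Q t" using d by (intro power_mono) auto
    also have "\<dots> \<le> (\<Sum>Q\<in>Pow (Pow {..<m}). ?X Q t)"
      using Q(1) by (intro member_le_sum fP) auto
    finally show ?thesis .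
  qed
  have "real m ^ card V * (\<delta> * real (card E))\<^sup>2 = (\<Sum>t\<in>?Om. (\<delta> * real (card E))\<^sup>2)" using cO by simp
  also have "\<dots> \<le> (\<Sum>t\<in>?Om. \<Sum>Q\<in>Pow (Pow {..<m}). ?X Q t)" by (intro sum_mono low)
  also have "\<dots> = (\<Sum>Q\<in>Pow (Pow {..<m}). \<Sum>t\<in>?Om. ?X Q t)" by (rule sum.swap)
  also have "\<dots> \<le> (\<Sum>Q\<in>Pow (Pow {..<m}). real m ^ card V * (3 * real k * real (card E)))"
    by (intro sum_mono second_moment_pattern[OF H R m])
  also have "\<dots> = real m ^ card V * (real (card E) * (2 ^ (2 ^ m) * (3 * real k)))"
    by (simp only: sum_constant card_Pow finite_Pow_iff finite_lessThan card_lessThan of_nat_power of_nat_numeral mult_ac)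
  finally have "(\<delta> * real (card E))\<^sup>2 \<le> real (card E) * (2 ^ (2 ^ m) * (3 * real k))"
    using m by (simp only: mult_le_cancel_left_pos zero_less_power of_nat_0_less_iff)
  hence "real (card E) * (\<delta>\<^sup>2 * real (card E)) \<le> real (card E) * (2 ^ (2 ^ m) * (3 * real k))"
    by (simp add: power2_eq_square mult_ac)
  hence "\<delta>\<^sup>2 * real (card E) \<le> 2 ^ (2 ^ m) * (3 * real k)" using cE by (simp only: mult_le_cancel_left_pos)
  thus False using large by linarith
qed

section \<open>Points on a steep exponential curve\<close>

text \<open>The abscissa ln (p $ 2) / K is where the curve reaches the height of p. Points at least
  1/2 to the right of it are higher by a factor exp (K / 2), so their total weight is below 1/(4 m +
  8). The remaining points carry almost all the weight and must balance p horizontally, hence lie on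
  both sides of it.\<close>

lemma stair_triangle:
  fixes S :: "(real^2) set" and p :: "real^2" and K m :: real
  assumes S: "finite S" "p \<in> convex hull S"
    and pts: "\<And>z. z \<in> S \<Longrightarrow> 0 \<le> z $ 1 \<and> z $ 1 \<le> m \<and> z $ 2 = exp (K * z $ 1)"
    and K: "K > 0" "exp (K / 2) > 4 * m + 8"
    and sep: "\<And>z. z \<in> S \<Longrightarrow> z $ 1 \<ge> ln (p $ 2) / K + 1/2 \<or> z $ 1 < ln (p $ 2) / K"
    and gap: "\<And>z. z \<in> S \<Longrightarrow> z $ 1 < p $ 1 - 1/4 \<or> z $ 1 > p $ 1 + 1/4"
  shows "(\<exists>z\<in>S. z $ 1 \<ge> ln (p $ 2) / K + 1/2) \<and>
     (\<exists>z\<in>S. z $ 1 < ln (p $ 2) / K \<and> z $ 1 < p $ 1 - 1/4) \<and>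
     (\<exists>z\<in>S. z $ 1 < ln (p $ 2) / K \<and> z $ 1 > p $ 1 + 1/4)"
proof -
  obtain c where c: "\<And>z. z \<in> S \<Longrightarrow> 0 \<le> c z" "sum c S = 1" "(\<Sum>z\<in>S. c z *\<^sub>R z) = p"
    using S(2) unfolding convex_hull_finite[OF S(1)] by blast
  have a: "p $ 1 = (\<Sum>z\<in>S. c z * z $ 1)" and b: "p $ 2 = (\<Sum>z\<in>S. c z * z $ 2)"
    unfolding c(3)[symmetric] by (simp_all add: sum_component)
  let ?a = "p $ 1" and ?b = "p $ 2" and ?\<beta> = "ln (p $ 2) / K"
  obtain z0 where z0: "z0 \<in> S" "c z0 > 0"
  proof -
    have "\<exists>z0\<in>S. c z0 > 0"
    proof (rule ccontr)
      assume "\<not> ?thesis"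
      hence "sum c S \<le> (\<Sum>z\<in>S. 0)" by (intro sum_mono) (simp add: not_less)
      thus False using c(2) by simp
    qed
    thus ?thesis using that by blast
  qed
  have z0le: "c z0 * g z0 \<le> (\<Sum>z\<in>S. c z * g z)" if "\<And>z. z \<in> S \<Longrightarrow> g z \<ge> 0" for g :: "real^2 \<Rightarrow> real"
    using c(1) that by (intro member_le_sum z0 S) auto
  have bpos: "?b > 0"
  proof -
    have "0 < c z0 * z0 $ 2" using z0 pts by simp
    also have "\<dots> \<le> ?b" unfolding b using z0le[of "\<lambda>z. z $ 2"] pts by simp
    finally show ?thesis .
  qed
  have eb: "exp (K * ?\<beta>) = ?b" using bpos K by simp
  define Hi where "Hi = {z\<in>S. z $ 1 \<ge> ?\<beta> + 1/2}"
  define Lo where "Lo = {z\<in>S. z $ 1 < ?\<beta>}"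
  have part: "S = Hi \<union> Lo" "Hi \<inter> Lo = {}" "finite Hi" "finite Lo" using sep S(1) by (auto simp: Hi_def Lo_def)
  define W where "W = sum c Hi"
  have split: "(\<Sum>z\<in>S. g z) = (\<Sum>z\<in>Hi. g z) + (\<Sum>z\<in>Lo. g z)" for g :: "real^2 \<Rightarrow> real"
    by (subst part(1)) (rule sum.union_disjoint[OF part(3,4,2)])
  have Wlo: "sum c Lo = 1 - W" using c(2) split[of c] by (simp add: W_def)
  have W0: "W \<ge> 0" unfolding W_def using c(1) by (intro sum_nonneg) (simp add: Hi_def)
  have yHi: "z $ 2 \<ge> exp (K / 2) * ?b" if "z \<in> Hi" for z
  proof -
    have "K * z $ 1 \<ge> K * (?\<beta> + 1/2)" using that K by (intro mult_left_mono) (auto simp: Hi_def)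
    hence "exp (K * z $ 1) \<ge> exp (K / 2 + K * ?\<beta>)" by (simp only: exp_le_cancel_iff) (simp add: algebra_simps)
    thus ?thesis using pts[of z] that eb by (simp add: Hi_def exp_add)
  qed
  have W1: "W * exp (K / 2) \<le> 1"
  proof -
    have "W * (exp (K / 2) * ?b) = (\<Sum>z\<in>Hi. c z * (exp (K / 2) * ?b))" unfolding W_def by (simp add: sum_distrib_right)
    also have "\<dots> \<le> (\<Sum>z\<in>Hi. c z * z $ 2)"
      using c(1) yHi by (intro sum_mono mult_left_mono) (auto simp: Hi_def)
    also have "\<dots> \<le> ?b"
    proof -
      have "0 \<le> (\<Sum>z\<in>Lo. c z * z $ 2)" using c(1) pts by (intro sum_nonneg) (auto simp: Lo_def)
      thus ?thesis unfolding b split by simp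
    qed
    finally show ?thesis using bpos by (simp add: mult.assoc[symmetric])
  qed
  have m0: "m \<ge> 0" using pts[OF z0(1)] by linarith
  have Wm: "W * (4 * m + 8) < 1"
  proof (cases "W = 0")
    case False
    hence "W > 0" using W0 by simp
    hence "W * (4 * m + 8) < W * exp (K / 2)" using K(2) by (rule mult_strict_left_mono[rotated])
    thus ?thesis using W1 by linarith
  qed simp
  have a0: "?a \<ge> 0" unfolding a using c(1) pts by (intro sum_nonneg) auto
  have am: "?a \<le> m"
  proof -
    have "?a \<le> (\<Sum>z\<in>S. c z * m)" unfolding a using c(1) pts by (intro sum_mono mult_left_mono) auto
    thus ?thesis using c(2) by (simp add: sum_distrib_right[symmetric])
  qed
  have Wbd: "W * y < 1/4" if "y \<le> m + 1/2" for y
  proof -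
    have "W * y \<le> W * (m + 1/2)" using W0 that by (rule mult_left_mono[rotated])
    moreover have "W * (m + 1/2) * 4 \<le> W * (4 * m + 8)" using W0 by (simp add: algebra_simps)
    ultimately show ?thesis using Wm by linarith
  qed
  have hi: "Hi \<noteq> {}"
  proof
    assume "Hi = {}"
    hence SLo: "S \<subseteq> Lo" using part(1) by blast
    have yl: "z $ 2 < ?b" if "z \<in> S" for z
    proof -
      have "z \<in> Lo" using that SLo by blast
      hence "z $ 1 < ?\<beta>" by (simp add: Lo_def)
      hence "K * z $ 1 < K * ?\<beta>" using K(1) by (rule mult_strict_left_mono)
      hence "exp (K * z $ 1) < exp (K * ?\<beta>)" by (simp only: exp_less_cancel_iff)
      hence "exp (K * z $ 1) < ?b" unfolding eb .
      thus ?thesis using pts[OF that] by simp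
    qed
    have "(\<Sum>z\<in>S. c z * z $ 2) < (\<Sum>z\<in>S. c z * ?b)"
    proof (rule sum_strict_mono_ex1[OF S(1)])
      show "\<forall>z\<in>S. c z * z $ 2 \<le> c z * ?b"
        using mult_left_mono[OF less_imp_le[OF yl] c(1)] by blast
      show "\<exists>z\<in>S. c z * z $ 2 < c z * ?b"
        using mult_strict_left_mono[OF yl[OF z0(1)] z0(2)] z0(1) by (rule bexI)
    qed
    also have "\<dots> = ?b" using c(2) by (simp add: sum_distrib_right[symmetric])
    finally show False using b by simp
  qed
  \<comment> \<open>If every low point lay to the right of p by 1/4, the low points alone would push
    the mean too far; the missing weight W is too small to make up for this.\<close>
  have lf: "\<exists>z\<in>Lo. z $ 1 < ?a - 1/4"
  proof (rule ccontr)
    assume neg: "\<not> ?thesis"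
    have all: "z $ 1 \<ge> ?a + 1/4" if zL: "z \<in> Lo" for z
    proof -
      have "z \<in> S" using zL by (simp add: Lo_def)
      moreover have "\<not> z $ 1 < ?a - 1/4" using neg zL by blast
      ultimately show ?thesis using gap[of z] by linarith
    qed
    have "(1 - W) * (?a + 1/4) = (\<Sum>z\<in>Lo. c z * (?a + 1/4))" unfolding Wlo[symmetric] by (rule sum_distrib_right)
    also have "\<dots> \<le> (\<Sum>z\<in>Lo. c z * z $ 1)" using c(1) all by (intro sum_mono mult_left_mono) (auto simp: Lo_def)
    also have "\<dots> \<le> ?a"
    proof -
      have "0 \<le> (\<Sum>z\<in>Hi. c z * z $ 1)" using c(1) pts by (intro sum_nonneg) (auto simp: Hi_def)
      thus ?thesis unfolding a split by simp
    qed
    finally have "1/4 \<le> W * (?a + 1/4)" by (simp add: algebra_simps)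
    thus False using Wbd[of "?a + 1/4"] am by linarith
  qed
  have rt: "\<exists>z\<in>Lo. z $ 1 > ?a + 1/4"
  proof (rule ccontr)
    assume neg: "\<not> ?thesis"
    have all: "z $ 1 \<le> ?a - 1/4" if zL: "z \<in> Lo" for z
    proof -
      have "z \<in> S" using zL by (simp add: Lo_def)
      moreover have "\<not> z $ 1 > ?a + 1/4" using neg zL by blast
      ultimately show ?thesis using gap[of z] by linarith
    qed
    \<comment> \<open>Here the high points might pull the mean to the right, but by at most
      \<open>W * m\<close>, since abscissae are bounded by m.\<close>
    have "?a = (\<Sum>z\<in>Hi. c z * z $ 1) + (\<Sum>z\<in>Lo. c z * z $ 1)" unfolding a by (rule split)
    also have "\<dots> \<le> (\<Sum>z\<in>Hi. c z * m) + (\<Sum>z\<in>Lo. c z * (?a - 1/4))"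
      using c(1) all pts by (intro add_mono sum_mono mult_left_mono) (auto simp: Lo_def Hi_def)
    also have "\<dots> = W * m + (1 - W) * (?a - 1/4)" by (simp only: sum_distrib_right[symmetric] Wlo W_def[symmetric])
    finally have "1/4 \<le> W * (m + 1/4 - ?a)" by (simp add: field_simps)
    thus False using Wbd[of "m + 1/4 - ?a"] a0 by linarith
  qed
  show ?thesis using hi lf rt by (auto simp: Hi_def Lo_def)
qed

section \<open>Density of the type patterns allowed by one point\<close>

lemma amgm3:
  fixes x y z :: real assumes "x \<ge> 0" "y \<ge> 0" "z \<ge> 0"
  shows "27 * (x * y * z) \<le> (x + y + z) ^ 3"
proof -
  have "(x + y + z) ^ 3 - 27 * (x * y * z) =
    (x + y + z) * ((x - y)\<^sup>2 + (y - z)\<^sup>2 + (z - x)\<^sup>2) / 2 + 3 * (x * (y - z)\<^sup>2 + y * (z - x)\<^sup>2 + z * (x - y)\<^sup>2)"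
    by (simp add: power2_eq_square power3_eq_cube field_simps)
  moreover have "\<dots> \<ge> 0" using assms by (intro add_nonneg_nonneg divide_nonneg_nonneg mult_nonneg_nonneg) auto
  ultimately show ?thesis by linarith
qed

text \<open>An exceptional type in one of three positions has probability at most 3 * 2/m. Otherwise
  the classes \<open>H\<close>, \<open>L\<close>, \<open>R\<close> occur in one of six orders, and
  AM-GM bounds the product of their sizes by m^3/27.\<close>

lemma pattern_density_le:
  assumes m: "m > 0" and X: "X \<subseteq> {..<m}" "card X \<le> 2"
    and sub: "H \<subseteq> {..<m}" "L \<subseteq> {..<m}" "R \<subseteq> {..<m}" and dis: "H \<inter> L = {}" "H \<inter> R = {}" "L \<inter> R = {}"
  shows "pattern_density m {s \<in> Pow {..<m}. s \<inter> X \<noteq> {} \<or> (s \<inter> H \<noteq> {} \<and> s \<inter> L \<noteq> {} \<and> s \<inter> R \<noteq> {})} \<le> 2/9 + 6 / real m"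
proof -
  let ?M = "{..<m}"
  let ?Q = "{s \<in> Pow ?M. s \<inter> X \<noteq> {} \<or> (s \<inter> H \<noteq> {} \<and> s \<inter> L \<noteq> {} \<and> s \<inter> R \<noteq> {})}"
  let ?Y = "{(a,b,c) \<in> cube ?M. {a,b,c} \<in> ?Q}"
  have fin: "finite H" "finite L" "finite R" "finite X"
    by (rule finite_subset[OF sub(1)] finite_subset[OF sub(2)] finite_subset[OF sub(3)] finite_subset[OF X(1)], simp)+
  let ?Z = "X \<times> ?M \<times> ?M \<union> (?M \<times> X \<times> ?M \<union> (?M \<times> ?M \<times> X \<union> (H \<times> L \<times> R \<union> (H \<times> R \<times> L \<union> (L \<times> H \<times> R \<union> (L \<times> R \<times> H \<union> (R \<times> H \<times> L \<union> R \<times> L \<times> H)))))))"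
  have sub': "?Y \<subseteq> ?Z"
  proof
    fix y assume "y \<in> ?Y"
    moreover obtain a b c where abc: "y = (a,b,c)" by (rule prod_cases3)
    ultimately have y: "y = (a,b,c)" "a \<in> ?M" "b \<in> ?M" "c \<in> ?M"
      "{a,b,c} \<inter> X \<noteq> {} \<or> ({a,b,c} \<inter> H \<noteq> {} \<and> {a,b,c} \<inter> L \<noteq> {} \<and> {a,b,c} \<inter> R \<noteq> {})"
      by (simp_all only: mem_Collect_eq prod.case mem_Sigma_iff)
    show "y \<in> ?Z"
    proof (cases "{a,b,c} \<inter> X = {}")
      case False
      then consider "a \<in> X" | "b \<in> X" | "c \<in> X" by blast
      thus ?thesis unfolding y(1) using y(2-4) by cases simp_all
    next
      case True
      hence d: "a \<in> H \<or> b \<in> H \<or> c \<in> H" "a \<in> L \<or> b \<in> L \<or> c \<in> L" "a \<in> R \<or> b \<in> R \<or> c \<in> R" using y(5) by blast+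
      have n: "x \<in> L \<Longrightarrow> x \<notin> H" "x \<in> R \<Longrightarrow> x \<notin> H" "x \<in> R \<Longrightarrow> x \<notin> L" for x using dis by blast+
      have "(a \<in> H \<and> b \<in> L \<and> c \<in> R) \<or> (a \<in> H \<and> b \<in> R \<and> c \<in> L) \<or> (a \<in> L \<and> b \<in> H \<and> c \<in> R) \<or>
        (a \<in> L \<and> b \<in> R \<and> c \<in> H) \<or> (a \<in> R \<and> b \<in> H \<and> c \<in> L) \<or> (a \<in> R \<and> b \<in> L \<and> c \<in> H)"
        using d n[of a] n[of b] n[of c] by argo
      thus ?thesis unfolding y(1) by (elim disjE) simp_all
    qed
  qed
  let ?h = "card H" and ?l = "card L" and ?r = "card R"
  have "card ?Y \<le> card ?Z" using fin by (intro card_mono sub') simp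
  also have "\<dots> \<le> card (X \<times> ?M \<times> ?M) + (card (?M \<times> X \<times> ?M) + (card (?M \<times> ?M \<times> X) + (card (H \<times> L \<times> R) + (card (H \<times> R \<times> L)
     + (card (L \<times> H \<times> R) + (card (L \<times> R \<times> H) + (card (R \<times> H \<times> L) + card (R \<times> L \<times> H))))))))"
    by ((rule order_trans[OF card_Un_le], rule add_left_mono)+, rule order_refl)
  also have "\<dots> = 3 * (card X * m * m) + 6 * (?h * ?l * ?r)"
    by (simp add: card_cartesian_product mult_ac)
  also have "\<dots> \<le> 3 * (2 * m * m) + 6 * (?h * ?l * ?r)" 
    using mult_le_mono1[OF mult_le_mono1[OF X(2)], of m m] by linarith
  finally have 1: "real (card ?Y) \<le> real (3 * (2 * m * m) + 6 * (?h * ?l * ?r))" by (simp only: of_nat_le_iff)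
  have "?h + ?l + ?r \<le> m"
  proof -
    have "(H \<union> L) \<inter> R = {}" using dis by blast
    hence "card (H \<union> L \<union> R) = card (H \<union> L) + ?r" using fin by (intro card_Un_disjoint) simp_all
    hence "card (H \<union> L \<union> R) = ?h + ?l + ?r" using card_Un_disjoint[OF fin(1,2) dis(1)] by simp
    moreover have "card (H \<union> L \<union> R) \<le> card ?M" using sub by (intro card_mono) auto
    ultimately show ?thesis by simp
  qed
  hence "real ?h + real ?l + real ?r \<le> real m" by linarith
  hence "(real ?h + real ?l + real ?r) ^ 3 \<le> real m ^ 3" by (rule power_mono) simp
  moreover have "27 * (real ?h * real ?l * real ?r) \<le> (real ?h + real ?l + real ?r) ^ 3" by (rule amgm3) simp_all
  ultimately have "27 * (real ?h * real ?l * real ?r) \<le> real m ^ 3" by (rule order_trans[rotated])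
  hence "real (card ?Y) \<le> 6 * (real m * real m) + 2/9 * real m ^ 3" using 1 by simp
  hence "real (card ?Y) / real m ^ 3 \<le> (6 * (real m * real m) + 2/9 * real m ^ 3) / real m ^ 3"
    by (intro divide_right_mono) auto
  also have "\<dots> = 2/9 + 6 / real m" using m by (simp add: add_divide_distrib power3_eq_cube)
  finally show ?thesis unfolding pattern_density_def .
qed

text \<open>Strict convexity: both outer points lie strictly above the tangent at the middle
  one.\<close>

lemma exp_curve_not_collinear:
  assumes K: "K > 0" and x: "x1 < x2" "x2 < (x3::real)"
    and f: "a $ 1 = x1" "a $ 2 = exp (K * x1)" "b $ 1 = x2" "b $ 2 = exp (K * x2)" "c $ 1 = x3" "c $ 2 = exp (K * x3)"
  shows "\<not> collinear {a, b, c :: real^2}"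
proof
  assume "collinear {a, b, c}"
  then obtain u where u: "\<And>y z. y \<in> {a,b,c} \<Longrightarrow> z \<in> {a,b,c} \<Longrightarrow> \<exists>k. y - z = k *\<^sub>R u" unfolding collinear_def by blast
  obtain k where k: "a - b = k *\<^sub>R u" using u by blast
  obtain l where l: "c - b = l *\<^sub>R u" using u by blast
  have "(a - b) $ 1 * (c - b) $ 2 = (c - b) $ 1 * (a - b) $ 2" unfolding k l by simp
  hence eq: "(x1 - x2) * (exp (K * x3) - exp (K * x2)) = (x3 - x2) * (exp (K * x1) - exp (K * x2))" using f by simp
  have tang: "exp (K * y) - exp (K * x2) > K * (y - x2) * exp (K * x2)" if "y \<noteq> x2" for y
  proof -
    have "K * (y - x2) \<noteq> 0" using that K by simp
    hence "1 + K * (y - x2) < exp (K * (y - x2))" using exp_minus_greater[of "- (K * (y - x2))"] by simp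
    hence "(1 + K * (y - x2)) * exp (K * x2) < exp (K * (y - x2)) * exp (K * x2)" by simp
    also have "\<dots> = exp (K * y)" by (simp add: exp_add[symmetric] algebra_simps)
    finally show ?thesis by (simp add: algebra_simps)
  qed
  have "(x2 - x1) * (exp (K * x3) - exp (K * x2)) > (x2 - x1) * (K * (x3 - x2) * exp (K * x2))"
    using tang[of x3] x by (intro mult_strict_left_mono) auto
  moreover have "(x3 - x2) * (exp (K * x1) - exp (K * x2)) > (x3 - x2) * (K * (x1 - x2) * exp (K * x2))"
    using tang[of x1] x by (intro mult_strict_left_mono) auto
  ultimately show False using eq by (simp add: algebra_simps)
qed

text \<open>Double counting of incidences. For fixed k the number of edges thus grows with the
  number of vertices, as the second moment bound requires.\<close>

lemma regular_edge_count:
  assumes H: "three_uniform_hypergraph V E" and R: "regular_hypergraph k V E"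
  shows "3 * card E = k * card V"
proof -
  have V: "finite V" and EV: "\<And>e. e \<in> E \<Longrightarrow> e \<subseteq> V \<and> card e = 3" using H by (auto simp: three_uniform_hypergraph_def)
  have E: "finite E" using V EV by (intro finite_subset[of E "Pow V"]) auto
  have "k * card V = (\<Sum>v\<in>V. card {e\<in>E. v \<in> e})" using R by (simp add: regular_hypergraph_def)
  also have "\<dots> = (\<Sum>v\<in>V. \<Sum>e\<in>E. if v \<in> e then 1 else 0)"
    by (rule sum.cong[OF refl]) (simp only: card_eq_sum sum.inter_filter[OF E])
  also have "\<dots> = (\<Sum>e\<in>E. \<Sum>v\<in>V. if v \<in> e then 1 else 0)" by (rule sum.swap)
  also have "\<dots> = (\<Sum>e\<in>E. 3)"
  proof (rule sum.cong[OF refl])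
    fix e assume e: "e \<in> E"
    have "(\<Sum>v\<in>V. if v \<in> e then 1 else 0) = card {v\<in>V. v \<in> e}"
      by (simp only: card_eq_sum sum.inter_filter[OF V])
    also have "{v\<in>V. v \<in> e} = e" using EV[OF e] by auto
    finally show "(\<Sum>v\<in>V. if v \<in> e then 1 else 0) = (3::nat)" using EV[OF e] by simp
  qed
  finally show ?thesis by simp
qed

text \<open>The integer type is shifted by an offset in (0, 1/4] that differs from vertex to vertex:
  abscissae become distinct, while different types stay at least 3/4 apart.\<close>

definition stair_x :: "(nat \<Rightarrow> nat) \<Rightarrow> nat \<Rightarrow> real" where
  "stair_x t v = real (t v) + 1 / (4 * (real v + 1))"

definition stair_map :: "real \<Rightarrow> (nat \<Rightarrow> nat) \<Rightarrow> nat \<Rightarrow> real^2" where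
  "stair_map K t v = (\<chi> i. if i = 1 then stair_x t v else exp (K * stair_x t v))"

lemma stair_map_nth [simp]:
  "stair_map K t v $ 1 = stair_x t v" "stair_map K t v $ 2 = exp (K * stair_x t v)"
  by (simp_all add: stair_map_def)

lemma stair_x_bounds: "real (t v) < stair_x t v" "stair_x t v \<le> real (t v) + 1/4"
  by (simp_all add: stair_x_def divide_le_eq_1)

lemma stair_x_inj: "stair_x t v = stair_x t w \<Longrightarrow> v = w"
proof -
  assume eq: "stair_x t v = stair_x t w"
  hence "real (t v) < real (t w) + 1" "real (t w) < real (t v) + 1"
    using stair_x_bounds[of t v] stair_x_bounds[of t w] by linarith+
  hence "t v = t w" by linarith
  hence "1 / (4 * (real v + 1)) = 1 / (4 * (real w + 1))" using eq by (simp add: stair_x_def)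
  thus "v = w" by simp
qed

lemma stair_map_general_position:
  assumes K: "K > 0"
  shows "general_position_map V (stair_map K t)"
  unfolding general_position_map_def
proof
  have inj: "inj (stair_map K t)"
  proof (rule injI)
    fix v w assume "stair_map K t v = stair_map K t w"
    hence "stair_map K t v $ 1 = stair_map K t w $ 1" by simp
    thus "v = w" using stair_x_inj by simp
  qed
  thus "inj_on (stair_map K t) V" using inj_on_subset by blast
  show "in_general_position (stair_map K t ` V)"
    unfolding in_general_position_def
  proof (intro allI impI)
    fix T assume T: "T \<subseteq> stair_map K t ` V" "card T = 3"
    have nc: "\<not> collinear {stair_map K t u, stair_map K t v, stair_map K t w}"
      if "stair_x t u < stair_x t v" "stair_x t v < stair_x t w" for u v w
      by (rule exp_curve_not_collinear[OF K that]) simp_all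
    obtain a b c where abc: "T = {a,b,c}" "a \<noteq> b" "b \<noteq> c" "a \<noteq> c" using T(2) by (auto simp: card_3_iff)
    have "a \<in> stair_map K t ` V" "b \<in> stair_map K t ` V" "c \<in> stair_map K t ` V" using T(1) unfolding abc(1) by simp_all
    then obtain u v w where uvw: "a = stair_map K t u" "b = stair_map K t v" "c = stair_map K t w" by (elim imageE)
    have "u \<noteq> v" "v \<noteq> w" "u \<noteq> w" using abc(2-4) uvw by auto
    hence "stair_x t u \<noteq> stair_x t v" "stair_x t v \<noteq> stair_x t w" "stair_x t u \<noteq> stair_x t w"
      using stair_x_inj[of t u v] stair_x_inj[of t v w] stair_x_inj[of t u w] by auto
    hence "stair_x t u < stair_x t v \<or> stair_x t v < stair_x t u" "stair_x t v < stair_x t w \<or> stair_x t w < stair_x t v"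
      "stair_x t u < stair_x t w \<or> stair_x t w < stair_x t u" by linarith+
    then consider "stair_x t u < stair_x t v" "stair_x t v < stair_x t w" | "stair_x t u < stair_x t w" "stair_x t w < stair_x t v"
      | "stair_x t v < stair_x t u" "stair_x t u < stair_x t w" | "stair_x t v < stair_x t w" "stair_x t w < stair_x t u"
      | "stair_x t w < stair_x t u" "stair_x t u < stair_x t v" | "stair_x t w < stair_x t v" "stair_x t v < stair_x t u"
      by blast
    hence "\<not> collinear {stair_map K t u, stair_map K t v, stair_map K t w}"
    proof cases
      case 1 thus ?thesis by (rule nc)
    next
      case 2
      have eq: "{stair_map K t u, stair_map K t v, stair_map K t w} = {stair_map K t u, stair_map K t w, stair_map K t v}" by blast
      show ?thesis unfolding eq using 2 by (rule nc)
    next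
      case 3
      have eq: "{stair_map K t u, stair_map K t v, stair_map K t w} = {stair_map K t v, stair_map K t u, stair_map K t w}" by blast
      show ?thesis unfolding eq using 3 by (rule nc)
    next
      case 4
      have eq: "{stair_map K t u, stair_map K t v, stair_map K t w} = {stair_map K t v, stair_map K t w, stair_map K t u}" by blast
      show ?thesis unfolding eq using 4 by (rule nc)
    next
      case 5
      have eq: "{stair_map K t u, stair_map K t v, stair_map K t w} = {stair_map K t w, stair_map K t u, stair_map K t v}" by blast
      show ?thesis unfolding eq using 5 by (rule nc)
    next
      case 6
      have eq: "{stair_map K t u, stair_map K t v, stair_map K t w} = {stair_map K t w, stair_map K t v, stair_map K t u}" by blast
      show ?thesis unfolding eq using 6 by (rule nc)
    qed
    thus "\<not> collinear T" unfolding abc(1) uvw .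
  qed
qed

lemma card_nat_interval_le_1:
  fixes y :: real
  assumes "\<And>j. j \<in> A \<Longrightarrow> y \<le> real j \<and> real j < y + 1"
  shows "card A \<le> 1"
proof -
  have eq: "j = j'" if "j \<in> A" "j' \<in> A" for j j'
  proof -
    have "real j < real j' + 1" "real j' < real j + 1" using assms[OF that(1)] assms[OF that(2)] by linarith+
    thus ?thesis by linarith
  qed
  show ?thesis
  proof (cases "finite A")
    case True
    have "\<forall>j\<in>A. \<forall>j'\<in>A. j = j'" using eq by blast
    thus ?thesis using card_le_Suc0_iff_eq[OF True] by simp
  qed simp
qed

text \<open>For fixed p an edge whose triangle contains p either uses one of at most two exceptional
  types or meets all of the classes \<open>Hi\<close>, \<open>Le\<close> and \<open>Ri\<close>. This
  is a condition on its type set, so \<open>typical\<close> applies.\<close>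

lemma stair_map_depth_le:
  assumes H: "three_uniform_hypergraph V E" and m: "m > 0" and t: "t ` V \<subseteq> {..<m}"
    and typical: "\<And>Q. Q \<subseteq> Pow {..<m} \<Longrightarrow> real (card {e\<in>E. t ` e \<in> Q}) \<le> (pattern_density m Q + \<delta>) * real (card E)"
    and K: "K > 0" "exp (K / 2) > 4 * real m + 8"
  shows "real (card {e\<in>E. p \<in> convex hull (stair_map K t ` e)}) \<le> (2/9 + 6 / real m + \<delta>) * real (card E)"
proof -
  let ?f = "stair_map K t"
  let ?\<beta> = "ln (p $ 2) / K" and ?a = "p $ 1"
  have V: "finite V" and EV: "\<And>e. e \<in> E \<Longrightarrow> e \<subseteq> V \<and> card e = 3" using H by (auto simp: three_uniform_hypergraph_def)
  have E: "finite E" using V EV by (intro finite_subset[of E "Pow V"]) auto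
  \<comment> \<open>Types too close to the height of p or to its abscissa to be classified. Both
    intervals have length 3/4 < 1 and so contain at most one integer; they extend 1/4 further to the
    left because of the offsets.\<close>
  define X1 where "X1 = {j\<in>{..<m}. ?\<beta> - 1/4 \<le> real j \<and> real j < ?\<beta> + 1/2}"
  define X2 where "X2 = {j\<in>{..<m}. ?a - 1/2 \<le> real j \<and> real j \<le> ?a + 1/4}"
  define X where "X = X1 \<union> X2"
  define Hi where "Hi = {j\<in>{..<m}. real j \<ge> ?\<beta> + 1/2}"
  define Le where "Le = {j\<in>{..<m}. real j < ?\<beta> - 1/4 \<and> real j < ?a - 1/2}"
  define Ri where "Ri = {j\<in>{..<m}. real j < ?\<beta> - 1/4 \<and> real j > ?a + 1/4}"
  have "card X1 \<le> 1" by (rule card_nat_interval_le_1[of _ "?\<beta> - 1/4"]) (auto simp: X1_def)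
  moreover have "card X2 \<le> 1" by (rule card_nat_interval_le_1[of _ "?a - 1/2"]) (auto simp: X2_def)
  ultimately have cX: "card X \<le> 2" using card_Un_le[of X1 X2] unfolding X_def by linarith
  define Q where "Q = {s \<in> Pow {..<m}. s \<inter> X \<noteq> {} \<or> (s \<inter> Hi \<noteq> {} \<and> s \<inter> Le \<noteq> {} \<and> s \<inter> Ri \<noteq> {})}"
  have qQ: "pattern_density m Q \<le> 2/9 + 6 / real m"
    unfolding Q_def by (rule pattern_density_le[OF m]) (use cX in \<open>auto simp: X_def X1_def X2_def Hi_def Le_def Ri_def\<close>)
  have "{e\<in>E. p \<in> convex hull (?f ` e)} \<subseteq> {e\<in>E. t ` e \<in> Q}"
  proof
    fix e assume "e \<in> {e\<in>E. p \<in> convex hull (?f ` e)}"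
    hence e: "e \<in> E" "p \<in> convex hull (?f ` e)" by auto
    have eV: "e \<subseteq> V" using EV[OF e(1)] by simp
    have te: "t ` e \<subseteq> {..<m}" using t eV by blast
    have tv: "t v < m" if "v \<in> e" for v using te that by blast
    have "t ` e \<inter> X \<noteq> {} \<or> (t ` e \<inter> Hi \<noteq> {} \<and> t ` e \<inter> Le \<noteq> {} \<and> t ` e \<inter> Ri \<noteq> {})"
    proof (cases "t ` e \<inter> X = {}")
      case True
      have sep: "stair_x t v \<ge> ?\<beta> + 1/2 \<and> real (t v) \<ge> ?\<beta> + 1/2 \<or> stair_x t v < ?\<beta> \<and> real (t v) < ?\<beta> - 1/4" if v: "v \<in> e" for v
      proof -
        have "t v \<notin> X1" using True v by (auto simp: X_def)
        hence "real (t v) < ?\<beta> - 1/4 \<or> real (t v) \<ge> ?\<beta> + 1/2" using tv[OF v] by (auto simp: X1_def)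
        thus ?thesis using stair_x_bounds[of t v] by linarith
      qed
      have gap: "stair_x t v < ?a - 1/4 \<and> real (t v) < ?a - 1/2 \<or> stair_x t v > ?a + 1/4 \<and> real (t v) > ?a + 1/4" if v: "v \<in> e" for v
      proof -
        have "t v \<notin> X2" using True v by (auto simp: X_def)
        hence "real (t v) < ?a - 1/2 \<or> real (t v) > ?a + 1/4" using tv[OF v] by (auto simp: X2_def)
        thus ?thesis using stair_x_bounds[of t v] by linarith
      qed
      have fin: "finite (?f ` e)" using V eV finite_subset by blast
      have "(\<exists>z\<in>?f ` e. z $ 1 \<ge> ?\<beta> + 1/2) \<and>
         (\<exists>z\<in>?f ` e. z $ 1 < ?\<beta> \<and> z $ 1 < ?a - 1/4) \<and> (\<exists>z\<in>?f ` e. z $ 1 < ?\<beta> \<and> z $ 1 > ?a + 1/4)"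
      proof (rule stair_triangle[OF fin e(2) _ K])
        fix z assume "z \<in> ?f ` e"
        then obtain v where v: "v \<in> e" "z = ?f v" by blast
        have "real (t v) + 1 \<le> real m" using tv[OF v(1)] by linarith
        thus "0 \<le> z $ 1 \<and> z $ 1 \<le> real m \<and> z $ 2 = exp (K * z $ 1)"
          using stair_x_bounds[of t v] v(2) by simp
        show "z $ 1 \<ge> ?\<beta> + 1/2 \<or> z $ 1 < ?\<beta>" using sep[OF v(1)] v(2) by auto
        show "z $ 1 < ?a - 1/4 \<or> z $ 1 > ?a + 1/4" using gap[OF v(1)] v(2) by auto
      qed
      then obtain u v w where uvw: "u \<in> e" "v \<in> e" "w \<in> e" "stair_x t u \<ge> ?\<beta> + 1/2"
        "stair_x t v < ?\<beta>" "stair_x t v < ?a - 1/4" "stair_x t w < ?\<beta>" "stair_x t w > ?a + 1/4" by auto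
      have "real (t u) \<ge> ?\<beta> + 1/2" using sep[OF uvw(1)] uvw(4) by linarith
      hence "t u \<in> Hi" using tv[OF uvw(1)] by (simp add: Hi_def)
      moreover have "real (t v) < ?\<beta> - 1/4" "real (t v) < ?a - 1/2" using sep[OF uvw(2)] gap[OF uvw(2)] uvw(5,6) by linarith+
      hence "t v \<in> Le" using tv[OF uvw(2)] by (simp add: Le_def)
      moreover have "real (t w) < ?\<beta> - 1/4" "real (t w) > ?a + 1/4" using sep[OF uvw(3)] gap[OF uvw(3)] uvw(7,8) by linarith+
      hence "t w \<in> Ri" using tv[OF uvw(3)] by (simp add: Ri_def)
      ultimately show ?thesis using uvw(1-3) by blast
    qed simp
    hence "t ` e \<in> Q" using te unfolding Q_def by blast
    thus "e \<in> {e\<in>E. t ` e \<in> Q}" using e by simp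
  qed
  hence "card {e\<in>E. p \<in> convex hull (?f ` e)} \<le> card {e\<in>E. t ` e \<in> Q}" using E by (intro card_mono) auto
  hence "real (card {e\<in>E. p \<in> convex hull (?f ` e)}) \<le> real (card {e\<in>E. t ` e \<in> Q})" by (simp only: of_nat_le_iff)
  also have "\<dots> \<le> (pattern_density m Q + \<delta>) * real (card E)" by (rule typical) (auto simp: Q_def)
  also have "\<dots> \<le> (2/9 + 6 / real m + \<delta>) * real (card E)" using qQ by (intro mult_right_mono) auto
  finally show ?thesis .
qed

text \<open>The claimed property fixes k before the hypergraph sequence, so one may go far enough
  along the sequence for the edge count to exceed what m types and degree k demand.\<close>

lemma not_overlap_general_position:
  assumes c: "c > 2/9"
  shows "\<not> overlap_property general_position_map c"
proof
  assume O: "overlap_property general_position_map c"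
  \<comment> \<open>With this choice c - \<epsilon> = 2/9 + \<epsilon>, while the errors 6/m and
    \<delta> = \<epsilon>/2 add up to less than \<epsilon>.\<close>
  define \<epsilon> where "\<epsilon> = (c - 2/9) / 2"
  have e: "\<epsilon> > 0" using c by (simp add: \<epsilon>_def)
  let ?P = "\<lambda>k (V :: nat \<Rightarrow> nat set) (E :: nat \<Rightarrow> nat set set). (\<forall>i. three_uniform_hypergraph (V i) (E i)) \<and>
     filterlim (\<lambda>i. card (V i)) at_top sequentially \<and> (\<forall>i. regular_hypergraph k (V i) (E i)) \<and>
     (\<forall>i f. general_position_map (V i) f \<longrightarrow>
       (\<exists>p. real (card {e \<in> E i. p \<in> convex hull (f ` e)}) \<ge> (c - \<epsilon>) * real (card (E i))))"
  have "\<exists>k>0. \<exists>V E. ?P k V E"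
    by (rule O[unfolded overlap_property_def, THEN spec, THEN mp, OF e])
  then obtain k where kP: "k > 0 \<and> (\<exists>V E. ?P k V E)" by (rule exE)
  from kP have k: "k > 0" by (rule conjunct1)
  from kP have "\<exists>V E. ?P k V E" by (rule conjunct2)
  then obtain V where "\<exists>E. ?P k V E" by (rule exE)
  then obtain E where P: "?P k V E" by (rule exE)
  note H' = conjunct1[OF P] and P2 = conjunct2[OF P]
  note lim = conjunct1[OF P2] and R' = conjunct1[OF conjunct2[OF P2]] and ov = conjunct2[OF conjunct2[OF P2]]
  note H = H'[THEN spec] and R = R'[THEN spec]
  obtain m :: nat where m: "real m > 12 / \<epsilon>" using reals_Archimedean2 by blast
  have "0 < 12 / \<epsilon>" using e by simp
  hence m0: "m > 0" using m by linarith
  have m6: "6 / real m < \<epsilon> / 2" using m m0 e by (simp add: field_simps)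
  let ?\<delta> = "\<epsilon> / 2"
  define C where "C = 2 ^ (2 ^ m) * (3 * real k)"
  have d2: "?\<delta>\<^sup>2 > 0" using e by simp
  obtain B :: nat where B: "real B > C * 3 / ?\<delta>\<^sup>2" using reals_Archimedean2 by blast
  have "\<forall>\<^sub>F i in sequentially. B + 1 \<le> card (V i)" using lim unfolding filterlim_at_top by (rule spec)
  then obtain i where i: "card (V i) \<ge> B + 1" using eventually_happens sequentially_bot by blast
  have "card (V i) \<le> k * card (V i)" using k by simp
  hence "card (V i) \<le> 3 * card (E i)" unfolding regular_edge_count[OF H R] .
  hence cE: "3 * real (card (E i)) \<ge> real B + 1" using i by linarith
  hence "C * 3 / ?\<delta>\<^sup>2 < 3 * real (card (E i))" using B by linarith
  hence "C * 3 < 3 * real (card (E i)) * ?\<delta>\<^sup>2" by (simp only: pos_divide_less_eq[OF d2])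
  hence large: "?\<delta>\<^sup>2 * real (card (E i)) > 2 ^ (2 ^ m) * (3 * real k)" unfolding C_def[symmetric] by (simp add: mult_ac)
  have d0: "?\<delta> > 0" using e by simp
  from typical_types_exist[OF H R m0 d0 large]
  obtain t where t: "t ` V i \<subseteq> {..<m}" and typ': "\<forall>Q. Q \<subseteq> Pow {..<m} \<longrightarrow>
      real (card {e\<in>E i. t ` e \<in> Q}) \<le> (pattern_density m Q + ?\<delta>) * real (card (E i))"
    by blast
  note tp = typ'[THEN spec, THEN mp]
  \<comment> \<open>Then exp (K / 2) = 4 m + 9, just above the required steepness.\<close>
  define K where "K = 2 * ln (4 * real m + 9)"
  have K: "K > 0" "exp (K / 2) > 4 * real m + 8" by (simp_all add: K_def)
  obtain p where p: "real (card {e \<in> E i. p \<in> convex hull (stair_map K t ` e)}) \<ge> (c - \<epsilon>) * real (card (E i))"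
    using ov[THEN spec, THEN spec, THEN mp, OF stair_map_general_position[OF K(1)]] by blast
  have "(c - \<epsilon>) * real (card (E i)) \<le> (2/9 + 6 / real m + ?\<delta>) * real (card (E i))"
    using stair_map_depth_le[OF H m0 t tp K, of p] p by linarith
  moreover have "real (card (E i)) > 0" using cE by linarith
  ultimately have "c - \<epsilon> \<le> 2/9 + 6 / real m + ?\<delta>" by (simp only: mult_le_cancel_right_pos)
  thus False using m6 unfolding \<epsilon>_def by (simp add: field_simps)
qed

section \<open>The overlap constant\<close>

text \<open>The label set must be fixed before k. Of the error \<epsilon>, one quarter each goes to
  mixing, to triples with two vertices in one interval (3/M), and to the lower order terms.\<close>

lemma overlap_injective:
  "overlap_property injective_map (2/9)"
  unfolding overlap_property_def
proof (intro allI impI)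
  fix \<epsilon> :: real assume e: "\<epsilon> > 0"
  obtain M :: nat where M: "real M > 12 / \<epsilon>" using reals_Archimedean2 by blast
  have "0 < 12 / \<epsilon>" using e by simp
  hence M0: "M > 0" using M by linarith
  have M3: "3 / real M \<le> \<epsilon> / 4" using M M0 e by (simp add: field_simps)
  define C :: "(nat \<times> bool) option set" where "C = insert None (Some ` ({..M} \<times> UNIV))"
  have C: "finite C" "C \<noteq> {}" by (simp_all add: C_def)
  have d: "\<epsilon> / 4 > 0" using e by simp
  define good where "good k N E \<longleftrightarrow> three_uniform_hypergraph {..<3*N} E \<and>
    regular_hypergraph k {..<3*N} E \<and> (\<forall>t W. t ` {..<3*N} \<subseteq> C \<longrightarrow> W \<subseteq> cube C \<longrightarrow>
      (triple_density t W {..<3*N} - \<epsilon> / 4) * real (card E)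
        \<le> real (card (labelled_edges t W {..<3*N} E)))"
    for k N E
  obtain k where k: "k > 0" and ev: "\<forall>\<^sub>F N in sequentially. \<exists>E. good k N E"
    using mixing_hypergraphs_exist[OF C d] unfolding good_def by blast
  then obtain N0 where N0: "\<And>N. N \<ge> N0 \<Longrightarrow> \<exists>E. good k N E" unfolding eventually_sequentially by blast
  \<comment> \<open>1513 = 1510 + 3; the 3 stems from rounding up the interval length.\<close>
  obtain N1 :: nat where N1: "real N1 > 1513 * 4 / \<epsilon>" using reals_Archimedean2 by blast
  define N where "N i = N0 + N1 + Suc i" for i
  have "\<forall>i. \<exists>E. good k (N i) E" using N0 by (simp add: N_def)
  from choice[OF this] obtain E where E: "\<forall>i. good k (N i) (E i)" by (rule exE)
  define V where "V i = {..<3 * N i}" for i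
  have H: "three_uniform_hypergraph (V i) (E i)" and R: "regular_hypergraph k (V i) (E i)" for i
    using E[THEN spec, of i] unfolding good_def V_def by blast+
  have mix: "(triple_density t W (V i) - \<epsilon> / 4) * real (card (E i))
        \<le> real (card (labelled_edges t W (V i) (E i)))"
    if "t ` V i \<subseteq> C" "W \<subseteq> cube C" for i t W
    using E[THEN spec, of i] that unfolding good_def V_def by blast
  have lim: "filterlim (\<lambda>i. card (V i)) at_top sequentially"
    by (rule filterlim_at_top_mono[OF filterlim_ident]) (auto simp: V_def N_def)
  have depth: "\<exists>p. real (card {e \<in> E i. p \<in> convex hull (f ` e)}) \<ge> (2/9 - \<epsilon>) * real (card (E i))"
    for i and f :: "nat \<Rightarrow> real^2"
  proof -
    let ?n = "card (V i)"
    have n: "?n = 3 * N i" by (simp add: V_def)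
    have n0: "?n > 0" by (simp add: n N_def)
    have Vf: "finite (V i)" "V i \<noteq> {}" using n0 by (auto simp: card_gt_0_iff)
    \<comment> \<open>The least length of this form that leaves interval numbers at most M for every
      n, so that labels always lie in \<open>C\<close>.\<close>
    define L where "L = ?n div M + 1"
    have L: "L > 0" by (simp add: L_def)
    have "?n < L * M" using dividend_less_div_times[OF M0, of ?n] by (simp add: L_def algebra_simps)
    hence divL: "?n div L \<le> M" using less_mult_imp_div_less[of ?n M L] by (simp add: mult.commute)
    from labelled_cyclic_triples_all[OF Vf L, of f]
    obtain p t where t: "t ` V i \<subseteq> insert None (Some ` ({..?n div L} \<times> UNIV))" and
      hull: "\<forall>u\<in>V i. \<forall>v\<in>V i. \<forall>w\<in>V i. (t u, t v, t w) \<in> label_cyclic \<longrightarrow> p \<in> convex hull {f u, f v, f w}" and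
      cnt: "real (card {(u,v,w) \<in> cube (V i). (t u, t v, t w) \<in> label_cyclic})
        \<ge> 2/9 * real ?n ^ 3 - 1510 * (real ?n)\<^sup>2 - 3 * (real ?n)\<^sup>2 * real L" by blast
    have tC: "t ` V i \<subseteq> C"
    proof -
      have "insert None (Some ` ({..?n div L} \<times> UNIV)) \<subseteq> C" unfolding C_def using divL by auto
      thus ?thesis using t by (rule order_trans[rotated])
    qed
    define W where "W = label_cyclic \<inter> (cube C)"
    have tW: "(t u, t v, t w) \<in> W \<longleftrightarrow> (t u, t v, t w) \<in> label_cyclic" if "u \<in> V i" "v \<in> V i" "w \<in> V i" for u v w
      using that tC by (auto simp: W_def)
    have "{(u,v,w) \<in> cube (V i). (t u, t v, t w) \<in> W} = {(u,v,w) \<in> cube (V i). (t u, t v, t w) \<in> label_cyclic}"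
      using tW by auto
    hence td: "triple_density t W (V i) \<ge> (2/9 * real ?n ^ 3 - 1510 * (real ?n)\<^sup>2 - 3 * (real ?n)\<^sup>2 * real L) / real ?n ^ 3"
      unfolding triple_density_def using cnt by (simp add: divide_right_mono)
    have "(2/9 * real ?n ^ 3 - 1510 * (real ?n)\<^sup>2 - 3 * (real ?n)\<^sup>2 * real L) / real ?n ^ 3 = 2/9 - (1510 + 3 * real L) / real ?n"
      using n0 by (simp add: field_simps power2_eq_square power3_eq_cube)
    moreover have "(1510 + 3 * real L) / real ?n \<le> \<epsilon> / 2"
    proof -
      have "real (?n div M * M) \<le> real ?n" by (simp only: of_nat_le_iff div_times_less_eq_dividend)
      hence "real (?n div M) \<le> real ?n / real M" using M0 by (simp add: pos_le_divide_eq)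
      hence "1510 + 3 * real L \<le> 1513 + 3 * (real ?n / real M)" unfolding L_def by simp
      hence "(1510 + 3 * real L) / real ?n \<le> (1513 + 3 * (real ?n / real M)) / real ?n" by (intro divide_right_mono) auto
      also have "\<dots> = 1513 / real ?n + 3 / real M" using n0 by (simp add: field_simps)
      also have "1513 / real ?n \<le> \<epsilon> / 4"
      proof -
        have "1513 * 4 / \<epsilon> < real ?n" using N1 by (simp add: n N_def)
        thus ?thesis using e n0 by (simp add: field_simps)
      qed
      finally show ?thesis using M3 by linarith
    qed
    ultimately have "triple_density t W (V i) - \<epsilon> / 4 \<ge> 2/9 - \<epsilon>" using td e by linarith
    hence "(2/9 - \<epsilon>) * real (card (E i)) \<le> (triple_density t W (V i) - \<epsilon> / 4) * real (card (E i))"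
      by (intro mult_right_mono) auto
    also have "\<dots> \<le> real (card (labelled_edges t W (V i) (E i)))"
      by (rule mix[OF tC]) (simp add: W_def)
    also have "\<dots> \<le> real (card {e \<in> E i. p \<in> convex hull (f ` e)})"
    proof -
      have fE: "finite (E i)" using H[of i] Vf
        by (intro finite_subset[of "E i" "Pow (V i)"]) (auto simp: three_uniform_hypergraph_def)
      have "(labelled_edges t W (V i) (E i))
        \<subseteq> {e \<in> E i. p \<in> convex hull (f ` e)}"
      proof
        fix e assume "e \<in> (labelled_edges t W (V i) (E i))"
        then obtain u v w where h: "e \<in> E i" "e = {u,v,w}" "u \<in> V i" "v \<in> V i" "w \<in> V i" "(t u, t v, t w) \<in> W" by blast
        hence "p \<in> convex hull {f u, f v, f w}" using hull tW by blast
        thus "e \<in> {e \<in> E i. p \<in> convex hull (f ` e)}" using h by simp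
      qed
      hence "card (labelled_edges t W (V i) (E i))
        \<le> card {e \<in> E i. p \<in> convex hull (f ` e)}" using fE by (intro card_mono) auto
      thus ?thesis by (simp only: of_nat_le_iff)
    qed
    finally show ?thesis by (rule exI)
  qed
  show "\<exists>k>0. \<exists>(V :: nat \<Rightarrow> nat set) (E :: nat \<Rightarrow> nat set set).
       (\<forall>i. three_uniform_hypergraph (V i) (E i)) \<and>
       filterlim (\<lambda>i. card (V i)) at_top sequentially \<and>
       (\<forall>i. regular_hypergraph k (V i) (E i)) \<and>
       (\<forall>i f. injective_map (V i) f \<longrightarrow>
          (\<exists>p. real (card {e \<in> E i. p \<in> convex hull (f ` e)}) \<ge> (2/9 - \<epsilon>) * real (card (E i))))"
    by (rule exI[of _ k], rule conjI[OF k], rule exI[of _ V], rule exI[of _ E], intro conjI allI impI H lim R depth)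
qed

text \<open>Fewer admissible maps make the property weaker. Hence the lower bound is proved for
  injective maps and the upper bound for maps into general position, and each carries over to the
  other class.\<close>

lemma overlap_property_antimono:
  assumes "overlap_property adm c" "\<And>V f. adm' V f \<Longrightarrow> adm V f"
  shows "overlap_property adm' c"
  unfolding overlap_property_def
proof (intro allI impI)
  fix \<epsilon> :: real assume "\<epsilon> > 0"
  let ?P = "\<lambda>a k (V :: nat \<Rightarrow> nat set) (E :: nat \<Rightarrow> nat set set). (\<forall>i. three_uniform_hypergraph (V i) (E i)) \<and>
     filterlim (\<lambda>i. card (V i)) at_top sequentially \<and> (\<forall>i. regular_hypergraph k (V i) (E i)) \<and>
     (\<forall>i f. a (V i) f \<longrightarrow> (\<exists>p. real (card {e \<in> E i. p \<in> convex hull (f ` e)}) \<ge> (c - \<epsilon>) * real (card (E i))))"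
  have "\<exists>k>0. \<exists>V E. ?P adm k V E"
    by (rule assms(1)[unfolded overlap_property_def, THEN spec, THEN mp, OF \<open>\<epsilon> > 0\<close>])
  then obtain k where kP: "k > 0 \<and> (\<exists>V E. ?P adm k V E)" by (rule exE)
  from kP have "\<exists>V E. ?P adm k V E" by (rule conjunct2)
  then obtain V where "\<exists>E. ?P adm k V E" by (rule exE)
  then obtain E where P: "?P adm k V E" by (rule exE)
  note P2 = conjunct2[OF P]
  note P3 = conjunct2[OF P2]
  have P': "?P adm' k V E"
    by (rule conjI[OF conjunct1[OF P] conjI[OF conjunct1[OF P2] conjI[OF conjunct1[OF P3]]]], intro allI impI,
        rule conjunct2[OF P3, THEN spec, THEN spec, THEN mp], rule assms(2))
  show "\<exists>k>0. \<exists>V E. ?P adm' k V E"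
    by (rule exI[of _ k], rule conjI, rule conjunct1[OF kP], rule exI[of _ V], rule exI[of _ E], rule P')
qed

theorem theorem1p4:
  shows "\<forall>adm \<in> {injective_map, general_position_map}.
           overlap_property adm (2/9) \<and> (\<forall>c>2/9. \<not> overlap_property adm c)"
proof -
  have sub: "general_position_map V f \<Longrightarrow> injective_map V f" for V :: "nat set" and f
    by (simp add: general_position_map_def injective_map_def)
  have "overlap_property general_position_map (2/9)"
    using overlap_injective sub by (rule overlap_property_antimono)
  moreover have "\<not> overlap_property injective_map c" if "c > 2/9" for c
    using not_overlap_general_position[OF that] overlap_property_antimono[of injective_map c general_position_map] sub by blast
  ultimately show ?thesis using overlap_injective not_overlap_general_position by simp
qed

end
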